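(* Let $d\ge1$, $0<s<1$, $a=1-2s$. Assume either that $\frac12\le s<1$ and $u\in\operatorname{Dom}(\mathcal L^s)$, or that $0<s<\frac12$ and $u\in\operatorname{Dom}(\mathcal L^{\frac14+\frac s2})$. Define $U$ by $\widehat U(\xi,z,\tau)=m_s(z;\xi,\tau)\widehat u(\xi,\tau)$ for $z>0$. Then, as a strong limit in $L^2(\mathbb R^{d+1})$, $$-\lim_{z\to0^+}\frac{\Gamma(s)e^{i\pi s/2}}{2^{1-2s}\Gamma(1-s)}\,z^a\,\partial_zU(\cdot,z,\cdot)=\mathcal L^su .$$
   Context: Fourier transform on $\mathbb R^{d+1}=\mathbb R^d_x\times\mathbb R_t$: $\widehat u(\xi,\tau)=\int e^{-2\pi i(\tau t+\langle\xi,x\rangle)}u(x,t)\,dx\,dt$; $\widehat U(\xi,z,\tau)$ is the transform in $(x,t)$ for fixed $z$. $p(\xi,\tau)=2\pi\tau+4\pi^2|\xi|^2$. $\theta(\xi,\tau)=1$ if $p>0$, $\theta=-i$ if $p<0$. For $p(\xi,\tau)\ne0$, $$m_s(z;\xi,\tau)=\frac{2^{1-s}}{\Gamma(s)}\bigl(z\theta|p|^{1/2}\bigr)^sK_s\bigl(z\theta|p|^{1/2}\bigr),$$ with principal-branch powers and $K_s$ the modified Bessel function of the third kind. For $0<\alpha<1$: $\operatorname{Dom}(\mathcal L^\alpha)=\{u\in L^2(\mathbb R^{d+1}):|p|^\alpha\widehat u\in L^2(\mathbb R^{d+1})\}$, $\widehat{\mathcal L^\alpha u}=(ip)^\alpha\widehat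 u$ (principal branch). *)

theory Defs
  imports "HOL-Analysis.Analysis"
begin

text \<open>
  Elements of the complex space \<open>L\<^sup>2\<close> are represented by Borel functions; equality in \<open>L\<^sup>2\<close> is
  equality almost everywhere. A point of \<open>\<real>\<^sup>d\<^sup>+\<^sup>1\<close> is a pair \<open>(x, t)\<close>, resp. \<open>(\<xi>, \<tau>)\<close>,
  of type \<open>(real^'d) \<times> real\<close>.
\<close>

definition L2 :: "('a::euclidean_space \<Rightarrow> complex) set" where
  "L2 = {f \<in> borel_measurable lborel. integrable lborel (\<lambda>x. (cmod (f x))\<^sup>2)}"

definition L2_norm :: "('a::euclidean_space \<Rightarrow> complex) \<Rightarrow> real" where
  "L2_norm f = sqrt (\<integral>x. (cmod (f x))\<^sup>2 \<partial>lborel)"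

text \<open>Membership in \<open>L2\<close> is part of convergence because the Bochner integral in
  \<open>L2_norm\<close> is 0 for functions that are not square integrable.\<close>

definition L2_tendsto ::
  "('i \<Rightarrow> 'a::euclidean_space \<Rightarrow> complex) \<Rightarrow> ('a \<Rightarrow> complex) \<Rightarrow> 'i filter \<Rightarrow> bool" where
  "L2_tendsto F f net \<longleftrightarrow>
     f \<in> L2 \<and> (\<forall>\<^sub>F i in net. F i \<in> L2) \<and>
     ((\<lambda>i. L2_norm (\<lambda>x. F i x - f x)) \<longlongrightarrow> 0) net"

definition L2_has_deriv ::
  "(real \<Rightarrow> 'a::euclidean_space \<Rightarrow> complex) \<Rightarrow> ('a \<Rightarrow> complex) \<Rightarrow> real \<Rightarrow> bool" where
  "L2_has_deriv U V z \<longleftrightarrow>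
     L2_tendsto (\<lambda>h x. (U (z + h) x - U z x) / of_real h) V (at 0)"

definition fourier_integral ::
  "((real^'d) \<times> real \<Rightarrow> complex) \<Rightarrow> (real^'d) \<times> real \<Rightarrow> complex" where
  "fourier_integral f = (\<lambda>(\<xi>, \<tau>).
     \<integral>(x, t). exp (- (2 * of_real pi * \<i> * of_real (\<tau> * t + \<xi> \<bullet> x))) * f (x, t) \<partial>lborel)"

text \<open>Plancherel's extension of the Fourier transform to \<open>L\<^sup>2\<close>: the \<open>L\<^sup>2\<close> limit of the
  Fourier integrals of the truncations of \<open>f\<close> to balls, which lie in \<open>L\<^sup>1 \<inter> L\<^sup>2\<close>.
  The result is determined up to equality almost everywhere; a representative is chosen.\<close>

definition fourier :: "((real^'d) \<times> real \<Rightarrow> complex) \<Rightarrow> (real^'d) \<times> real \<Rightarrow> complex" where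
  "fourier f = (SOME g. L2_tendsto
     (\<lambda>n::nat. fourier_integral (\<lambda>y. indicator (cball 0 (real n)) y * f y)) g sequentially)"

text \<open>The element of \<open>L\<^sup>2\<close> whose Fourier transform is the given \<open>L\<^sup>2\<close> function
  (again a representative).\<close>

definition inv_fourier :: "((real^'d) \<times> real \<Rightarrow> complex) \<Rightarrow> (real^'d) \<times> real \<Rightarrow> complex" where
  "inv_fourier g = (SOME f. f \<in> L2 \<and> (AE \<omega> in lborel. fourier f \<omega> = g \<omega>))"

definition bessel_I :: "real \<Rightarrow> complex \<Rightarrow> complex" where
  "bessel_I \<nu> w = (w / 2) powr of_real \<nu> *
     (\<Sum>k. (w\<^sup>2 / 4) ^ k / (fact k * Gamma (of_real \<nu> + of_nat k + 1)))"

text \<open>Modified Bessel function of the third kind (Macdonald function); for integer order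
  the defining quotient is replaced by its limit in the order.\<close>

definition bessel_K :: "real \<Rightarrow> complex \<Rightarrow> complex" where
  "bessel_K \<nu> w =
     (let Q = (\<lambda>\<mu>. of_real (pi / 2) * (bessel_I (- \<mu>) w - bessel_I \<mu> w) / of_real (sin (\<mu> * pi)))
      in if \<nu> \<in> \<int> then Lim (at \<nu>) Q else Q \<nu>)"

definition p_symbol :: "(real^'d) \<times> real \<Rightarrow> real" where
  "p_symbol = (\<lambda>(\<xi>, \<tau>). 2 * pi * \<tau> + 4 * pi\<^sup>2 * (norm \<xi>)\<^sup>2)"

text \<open>The values of \<open>theta\<close> and \<open>m_mult\<close> on the null set where \<open>p_symbol\<close> vanishes
  are immaterial.\<close>

definition theta :: "(real^'d) \<times> real \<Rightarrow> complex" where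
  "theta \<omega> = (if p_symbol \<omega> > 0 then 1 else - \<i>)"

definition m_mult :: "real \<Rightarrow> real \<Rightarrow> (real^'d) \<times> real \<Rightarrow> complex" where
  "m_mult s z \<omega> =
     (let w = of_real z * theta \<omega> * of_real (\<bar>p_symbol \<omega>\<bar> powr (1/2))
      in of_real (2 powr (1 - s) / Gamma s) * w powr of_real s * bessel_K s w)"

definition heat_pow_dom :: "real \<Rightarrow> ((real^'d) \<times> real \<Rightarrow> complex) set" where
  "heat_pow_dom \<alpha> = {u \<in> L2. (\<lambda>\<omega>. of_real (\<bar>p_symbol \<omega>\<bar> powr \<alpha>) * fourier u \<omega>) \<in> L2}"

definition heat_pow ::
  "real \<Rightarrow> ((real^'d) \<times> real \<Rightarrow> complex) \<Rightarrow> (real^'d) \<times> real \<Rightarrow> complex" where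
  "heat_pow \<alpha> u = inv_fourier (\<lambda>\<omega>. (\<i> * of_real (p_symbol \<omega>)) powr of_real \<alpha> * fourier u \<omega>)"

end

theory Submission
  imports Defs "HOL-Probability.Characteristic_Functions"
begin

text \<open>
  On the Fourier side \<open>U z\<close> is multiplication by \<open>m_mult s z\<close>, so by Plancherel's theorem both the
  differentiability in \<open>z\<close> and the limit are questions about multipliers, and dominated convergence
  reduces them to pointwise statements together with one uniform bound.

  Pointwise, put \<open>\<rho> = z\<^sup>2 \<bar>p\<bar> / 4\<close>. Then \<open>m_mult s z\<close> is \<open>Gamma (1 - s)\<close> times a function of \<open>\<rho>\<close> and of the
  sign of \<open>p\<close> alone, \<open>bessel_profile\<close>, and the recurrences of the Bessel functions say that the
  \<open>\<rho>\<close>-derivative of the profile for \<open>s\<close> is \<open>\<rho> powr (s - 1)\<close> times the profile for \<open>1 - s\<close>, up to a phase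
  (\<open>bessel_profile_deriv\<close>). The powers of \<open>z\<close> cancel against \<open>z powr (1 - 2 * s)\<close>, the phase combines with
  \<open>exp (\<i> * pi * s / 2)\<close> to the phase of the principal power, and the normalized derivative of the
  multiplier is exactly \<open>(\<i> * p) powr s * m_mult (1 - s) z\<close> (\<open>normalized_m_mult_dz\<close>). As \<open>z\<close> tends to 0
  the last factor tends to 1.

  The uniform bound needs the behaviour of the profile at infinity. For \<open>p > 0\<close> it is bounded: it is a
  multiple of a Laplace integral, which is identified with the difference of the two Bessel series by
  uniqueness for the first order system that couples \<open>s\<close> and \<open>1 - s\<close> (\<open>bessel_difference_eq\<close>). For
  \<open>p < 0\<close> it oscillates with amplitude \<open>\<rho> powr (s / 2 - 1 / 4)\<close>, which follows from a corrected energy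
  for the same system (\<open>oscillating_system_bound\<close>). For \<open>1 - s\<close> in place of \<open>s\<close>, and with the factor
  \<open>\<bar>p\<bar> powr s\<close>, the resulting weight is \<open>\<bar>p\<bar> powr \<alpha>\<close> with \<open>\<alpha> = s + max 0 (1/4 - s/2)\<close>, and this is
  the weight in the hypothesis on \<open>u\<close>.

  Plancherel's theorem is proved for an arbitrary Euclidean space. The multiplication formula
  \<open>ft_multiplication\<close> and the self-dual Gaussian give the identity of norms for bounded continuous
  integrable functions, density extends it to \<open>L1 \<inter> L2\<close> (\<open>ft_isometry\<close>), and completeness of \<open>L2\<close>
  extends the transform to \<open>L2\<close>. The transform is onto because its adjoint is an isometry too
  (\<open>has_fourier_surj\<close>).
\<close>

section \<open>The space of square integrable functions\<close>

lemma L2_measurable [measurable_dest]: "f \<in> L2 \<Longrightarrow> f \<in> borel_measurable borel"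
  by (simp add: L2_def)

lemma L2_integrable: "f \<in> L2 \<Longrightarrow> integrable lborel (\<lambda>x. (cmod (f x))\<^sup>2)"
  by (simp add: L2_def)

lemma L2_norm_nonneg [simp]: "L2_norm f \<ge> 0"
  by (simp add: L2_norm_def)

lemma L2_norm_power2: "(L2_norm f)\<^sup>2 = (\<integral>x. (cmod (f x))\<^sup>2 \<partial>lborel)"
  by (simp add: L2_norm_def)

lemma L2_norm_minus_commute: "L2_norm (\<lambda>x. f x - g x) = L2_norm (\<lambda>x. g x - f x)"
  by (simp add: L2_norm_def norm_minus_commute)

lemma L2_nn_integral:
  assumes "f \<in> L2"
  shows "(\<integral>\<^sup>+x. ennreal ((cmod (f x))\<^sup>2) \<partial>lborel) = ennreal ((L2_norm f)\<^sup>2)"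
  unfolding L2_norm_power2
  by (rule nn_integral_eq_integral[OF L2_integrable[OF assms]]) simp

text \<open>
  The Bochner integral inside \<open>L2_norm\<close> is 0 for functions that are not square integrable, so a bound
  on \<open>L2_norm\<close> alone proves nothing. Membership and norm bound are therefore obtained together from
  a bound on the nonnegative integral; limit arguments with Fatou's lemma end here.
\<close>

lemma L2_nn_integral_le:
  assumes [measurable]: "f \<in> borel_measurable borel" and "0 \<le> c"
    and le: "(\<integral>\<^sup>+x. ennreal ((cmod (f x))\<^sup>2) \<partial>lborel) \<le> ennreal (c\<^sup>2)"
  shows "f \<in> L2" and "L2_norm f \<le> c"
proof -
  have "(\<integral>\<^sup>+x. ennreal (norm ((cmod (f x))\<^sup>2)) \<partial>lborel) < \<infinity>"
    using le_less_trans[OF le ennreal_less_top] by simp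
  then have "integrable lborel (\<lambda>x. (cmod (f x))\<^sup>2)"
    by (intro integrableI_bounded) auto
  then show *: "f \<in> L2"
    by (simp add: L2_def)
  have "(L2_norm f)\<^sup>2 \<le> c\<^sup>2"
    using le unfolding L2_nn_integral[OF *] by simp
  then show "L2_norm f \<le> c"
    using \<open>0 \<le> c\<close> by (rule power2_le_imp_le)
qed

lemma L2_dominated:
  assumes [measurable]: "f \<in> borel_measurable borel"
    and "integrable lborel (\<lambda>x. (w x)\<^sup>2)" and "AE x in lborel. cmod (f x) \<le> w x"
  shows "f \<in> L2"
proof -
  have "integrable lborel (\<lambda>x. (cmod (f x))\<^sup>2)"
    by (rule Bochner_Integration.integrable_bound[OF assms(2)])
       (use assms(3) in \<open>auto intro!: power_mono\<close>)
  then show ?thesis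
    by (simp add: L2_def)
qed

lemma L2_cong_AE:
  assumes "f \<in> L2" and [measurable]: "g \<in> borel_measurable borel" and "AE x in lborel. f x = g x"
  shows "g \<in> L2"
  by (rule L2_dominated[OF _ L2_integrable[OF assms(1)]]) (use assms in auto)

lemma L2_norm_cong_AE:
  assumes [measurable]: "f \<in> borel_measurable borel" "g \<in> borel_measurable borel"
    and "AE x in lborel. cmod (f x) = cmod (g x)"
  shows "L2_norm f = L2_norm g"
proof -
  have "(\<integral>x. (cmod (f x))\<^sup>2 \<partial>lborel) = (\<integral>x. (cmod (g x))\<^sup>2 \<partial>lborel)"
    by (rule integral_cong_AE) (use assms(3) in auto)
  then show ?thesis
    by (simp add: L2_norm_def)
qed

lemma L2_norm_zero_AE:
  assumes "f \<in> L2" "L2_norm f = 0"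
  shows "AE x in lborel. f x = 0"
proof -
  have [measurable]: "f \<in> borel_measurable borel"
    using assms(1) by (rule L2_measurable)
  have "(\<integral>\<^sup>+x. ennreal ((cmod (f x))\<^sup>2) \<partial>lborel) = 0"
    using L2_nn_integral[OF assms(1)] assms(2) by simp
  then show ?thesis
    by (subst (asm) nn_integral_0_iff_AE) (auto simp: ennreal_eq_0_iff)
qed

lemma L2_cmult:
  assumes "f \<in> L2"
  shows "(\<lambda>x. c * f x) \<in> L2"
  using assms by (auto simp: L2_def norm_mult power_mult_distrib)

lemma L2_norm_cmult: "L2_norm (\<lambda>x. c * f x) = cmod c * L2_norm f"
  by (simp add: L2_norm_def norm_mult power_mult_distrib real_sqrt_mult)

lemma L2_norm_add_nn:
  assumes "f \<in> L2" "g \<in> L2"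
  shows "(\<integral>\<^sup>+x. ennreal ((cmod (f x) + cmod (g x))\<^sup>2) \<partial>lborel) \<le> ennreal ((L2_norm f + L2_norm g)\<^sup>2)"
proof -
  have [measurable]: "f \<in> borel_measurable borel" "g \<in> borel_measurable borel"
    using assms by (auto dest: L2_measurable)
  let ?I = "\<integral>\<^sup>+x. ennreal (cmod (f x)) * ennreal (cmod (g x)) \<partial>lborel"
  have sq: "(ennreal (cmod z))\<^sup>2 = ennreal ((cmod z)\<^sup>2)" for z
    by (simp add: ennreal_power)
  have "?I\<^sup>2 \<le> (\<integral>\<^sup>+x. (ennreal (cmod (f x)))\<^sup>2 \<partial>lborel) * (\<integral>\<^sup>+x. (ennreal (cmod (g x)))\<^sup>2 \<partial>lborel)"
    by (rule Cauchy_Schwarz_nn_integral) auto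
  also have "\<dots> = (ennreal (L2_norm f * L2_norm g))\<^sup>2"
    unfolding sq L2_nn_integral[OF assms(1)] L2_nn_integral[OF assms(2)]
    by (simp add: ennreal_power ennreal_mult'[symmetric] power_mult_distrib)
  finally have *: "?I\<^sup>2 \<le> (ennreal (L2_norm f * L2_norm g))\<^sup>2" .
  have I: "?I \<le> ennreal (L2_norm f * L2_norm g)"
  proof (cases ?I)
    case (real r)
    with * have "r\<^sup>2 \<le> (L2_norm f * L2_norm g)\<^sup>2"
      by (simp add: ennreal_power)
    then have "r \<le> L2_norm f * L2_norm g"
      by (rule power2_le_imp_le) simp
    with real show ?thesis
      by (simp add: ennreal_leI)
  next
    case top
    with * show ?thesis
      by (simp add: ennreal_mult'[symmetric] power2_eq_square top_unique)
  qed
  have "(\<integral>\<^sup>+x. ennreal ((cmod (f x) + cmod (g x))\<^sup>2) \<partial>lborel) =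
     (\<integral>\<^sup>+x. ennreal ((cmod (f x))\<^sup>2) + (2 * (ennreal (cmod (f x)) * ennreal (cmod (g x)))
        + ennreal ((cmod (g x))\<^sup>2)) \<partial>lborel)"
    by (intro nn_integral_cong)
       (simp add: power2_sum ennreal_mult'[symmetric] ennreal_plus[symmetric] mult.assoc
         ennreal_numeral[symmetric] add_ac del: ennreal_plus ennreal_numeral)
  also have "\<dots> = ennreal ((L2_norm f)\<^sup>2) + (2 * ?I + ennreal ((L2_norm g)\<^sup>2))"
    by (simp add: nn_integral_add nn_integral_cmult L2_nn_integral assms)
  also have "\<dots> \<le> ennreal ((L2_norm f)\<^sup>2) + (2 * ennreal (L2_norm f * L2_norm g) + ennreal ((L2_norm g)\<^sup>2))"
    by (intro add_mono mult_left_mono I order_refl) auto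
  also have "\<dots> = ennreal ((L2_norm f + L2_norm g)\<^sup>2)"
    by (simp add: power2_sum ennreal_mult'[symmetric] ennreal_plus[symmetric] mult.assoc
         ennreal_numeral[symmetric] add_ac del: ennreal_plus ennreal_numeral)
  finally show ?thesis .
qed

lemma
  assumes "f \<in> L2" "g \<in> L2"
  shows L2_add: "(\<lambda>x. f x + g x) \<in> L2"
    and L2_norm_triangle: "L2_norm (\<lambda>x. f x + g x) \<le> L2_norm f + L2_norm g"
proof -
  have [measurable]: "f \<in> borel_measurable borel" "g \<in> borel_measurable borel"
    using assms by (auto dest: L2_measurable)
  have "(\<integral>\<^sup>+x. ennreal ((cmod (f x + g x))\<^sup>2) \<partial>lborel) \<le>
    (\<integral>\<^sup>+x. ennreal ((cmod (f x) + cmod (g x))\<^sup>2) \<partial>lborel)"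
    by (intro nn_integral_mono ennreal_leI power_mono norm_triangle_ineq) auto
  also note L2_norm_add_nn[OF assms]
  finally have le: "(\<integral>\<^sup>+x. ennreal ((cmod (f x + g x))\<^sup>2) \<partial>lborel) \<le> ennreal ((L2_norm f + L2_norm g)\<^sup>2)" .
  show "(\<lambda>x. f x + g x) \<in> L2" "L2_norm (\<lambda>x. f x + g x) \<le> L2_norm f + L2_norm g"
    by (rule L2_nn_integral_le[OF _ _ le]; simp)+
qed

lemma L2_diff:
  assumes "f \<in> L2" "g \<in> L2"
  shows "(\<lambda>x. f x - g x) \<in> L2"
  using L2_add[OF assms(1) L2_cmult[OF assms(2), of "-1"]] by simp

lemma L2_norm_triangle_diff:
  assumes "f \<in> L2" "g \<in> L2" "h \<in> L2"
  shows "L2_norm (\<lambda>x. f x - h x) \<le> L2_norm (\<lambda>x. f x - g x) + L2_norm (\<lambda>x. g x - h x)"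
  using L2_norm_triangle[OF L2_diff[OF assms(1,2)] L2_diff[OF assms(2,3)]] by simp

lemma L2_norm_diff_triangle:
  assumes "f \<in> L2" "g \<in> L2"
  shows "\<bar>L2_norm f - L2_norm g\<bar> \<le> L2_norm (\<lambda>x. f x - g x)"
  using L2_norm_triangle[OF L2_diff[OF assms] assms(2)]
    L2_norm_triangle[OF L2_diff[OF assms(2,1)] assms(1)] L2_norm_minus_commute[of f g]
  by simp

lemma L2_integrable_mult:
  assumes "f \<in> L2" "g \<in> L2"
  shows "integrable lborel (\<lambda>x. f x * g x)"
proof -
  have [measurable]: "f \<in> borel_measurable borel" "g \<in> borel_measurable borel"
    using assms by (auto dest: L2_measurable)
  show ?thesis
  proof (rule Bochner_Integration.integrable_bound)
    show "integrable lborel (\<lambda>x. (cmod (f x))\<^sup>2 + (cmod (g x))\<^sup>2)"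
      using assms by (auto intro: L2_integrable)
    show "AE x in lborel. norm (f x * g x) \<le> norm ((cmod (f x))\<^sup>2 + (cmod (g x))\<^sup>2)"
    proof (rule AE_I2)
      fix x
      have "0 \<le> (cmod (f x) - cmod (g x))\<^sup>2 + ((cmod (f x))\<^sup>2 + (cmod (g x))\<^sup>2)"
        by simp
      also have "\<dots> = 2 * (((cmod (f x))\<^sup>2 + (cmod (g x))\<^sup>2) - cmod (f x) * cmod (g x))"
        by (simp add: power2_diff)
      finally show "norm (f x * g x) \<le> norm ((cmod (f x))\<^sup>2 + (cmod (g x))\<^sup>2)"
        by (simp add: norm_mult)
    qed
  qed simp
qed

lemma L2_tendstoD:
  assumes "L2_tendsto F f net"
  shows "f \<in> L2" "\<forall>\<^sub>F i in net. F i \<in> L2" "((\<lambda>i. L2_norm (\<lambda>x. F i x - f x)) \<longlongrightarrow> 0) net"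
  using assms by (auto simp: L2_tendsto_def)

lemma L2_tendsto_norm:
  assumes "L2_tendsto F f net"
  shows "((\<lambda>i. L2_norm (F i)) \<longlongrightarrow> L2_norm f) net"
proof (rule Lim_transform2[OF tendsto_const])
  show "((\<lambda>i. L2_norm f - L2_norm (F i)) \<longlongrightarrow> 0) net"
    by (rule Lim_null_comparison[OF _ L2_tendstoD(3)[OF assms]])
      (use L2_tendstoD(2)[OF assms] in \<open>eventually_elim,
        metis L2_norm_diff_triangle[OF _ L2_tendstoD(1)[OF assms]] abs_minus_commute real_norm_def\<close>)
qed

lemma L2_tendsto_unique:
  assumes "L2_tendsto F f net" "L2_tendsto F g net" "net \<noteq> bot"
  shows "AE x in lborel. f x = g x"
proof -
  note f = L2_tendstoD[OF assms(1)] and g = L2_tendstoD[OF assms(2)]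
  have "((\<lambda>i. L2_norm (\<lambda>x. F i x - f x) + L2_norm (\<lambda>x. F i x - g x)) \<longlongrightarrow> 0 + 0) net"
    by (intro tendsto_add f g)
  moreover have "\<forall>\<^sub>F i in net. L2_norm (\<lambda>x. f x - g x) \<le>
      L2_norm (\<lambda>x. F i x - f x) + L2_norm (\<lambda>x. F i x - g x)"
    using f(2) by eventually_elim (use L2_norm_triangle_diff[OF f(1) _ g(1)]
      L2_norm_minus_commute in metis)
  ultimately have "L2_norm (\<lambda>x. f x - g x) \<le> 0 + 0"
    by (rule tendsto_lowerbound) (rule assms)
  then have "L2_norm (\<lambda>x. f x - g x) = 0"
    by (simp add: antisym)
  from L2_norm_zero_AE[OF L2_diff[OF f(1) g(1)] this] show ?thesis
    by simp
qed

lemma L2_tendsto_add: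
  assumes "L2_tendsto F f net" "L2_tendsto G g net"
  shows "L2_tendsto (\<lambda>i x. F i x + G i x) (\<lambda>x. f x + g x) net"
proof -
  note f = L2_tendstoD[OF assms(1)] and g = L2_tendstoD[OF assms(2)]
  have ev: "\<forall>\<^sub>F i in net. F i \<in> L2 \<and> G i \<in> L2"
    using f(2) g(2) by eventually_elim auto
  have *: "((\<lambda>i. L2_norm (\<lambda>x. F i x - f x) + L2_norm (\<lambda>x. G i x - g x)) \<longlongrightarrow> 0) net"
    using tendsto_add[OF f(3) g(3)] by simp
  have "((\<lambda>i. L2_norm (\<lambda>x. (F i x + G i x) - (f x + g x))) \<longlongrightarrow> 0) net"
  proof (rule Lim_null_comparison[OF _ *])
    show "\<forall>\<^sub>F i in net. norm (L2_norm (\<lambda>x. (F i x + G i x) - (f x + g x))) \<le>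
        L2_norm (\<lambda>x. F i x - f x) + L2_norm (\<lambda>x. G i x - g x)"
      using ev
    proof eventually_elim
      case (elim i)
      then show ?case
        using L2_norm_triangle[OF L2_diff[of "F i" f] L2_diff[of "G i" g]] f g
        by (simp add: algebra_simps)
    qed
  qed
  then show ?thesis
    using ev f g by (auto simp: L2_tendsto_def intro!: L2_add elim: eventually_mono)
qed

lemma L2_tendsto_cmult:
  assumes "L2_tendsto F f net"
  shows "L2_tendsto (\<lambda>i x. c * F i x) (\<lambda>x. c * f x) net"
proof -
  note f = L2_tendstoD[OF assms(1)]
  have "L2_norm (\<lambda>x. c * F i x - c * f x) = cmod c * L2_norm (\<lambda>x. F i x - f x)" for i
    by (simp add: L2_norm_cmult[symmetric] algebra_simps)
  then show ?thesis
    using f tendsto_mult_left[OF f(3), of "cmod c"]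
    by (auto simp: L2_tendsto_def intro!: L2_cmult elim: eventually_mono)
qed

text \<open>
  The square of the difference is dominated by \<open>4 w\<^sup>2\<close>, so this is dominated convergence for the
  squared differences.
\<close>

lemma L2_tendsto_dominated_sequence:
  fixes F :: "nat \<Rightarrow> 'a::euclidean_space \<Rightarrow> complex"
  assumes F [measurable]: "\<And>i. F i \<in> borel_measurable borel" and f [measurable]: "f \<in> borel_measurable borel"
    and w: "integrable lborel (\<lambda>x. (w x)\<^sup>2)"
    and bound: "\<And>i. AE x in lborel. cmod (F i x) \<le> w x"
    and lim: "AE x in lborel. (\<lambda>i. F i x) \<longlonglongrightarrow> f x"
  shows "L2_tendsto F f sequentially"
proof -
  have allb: "AE x in lborel. \<forall>i. cmod (F i x) \<le> w x"
    using bound by (simp add: AE_all_countable)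
  have "AE x in lborel. cmod (f x) \<le> w x"
    using allb lim
  proof eventually_elim
    case (elim x)
    show ?case
      by (rule tendsto_upperbound[OF tendsto_norm[OF elim(2)]]) (use elim in auto)
  qed
  note fw = this
  have fL: "f \<in> L2" and FL: "\<And>i. F i \<in> L2"
    using L2_dominated[OF f w fw] L2_dominated[OF F w bound] by auto
  have "(\<lambda>i. \<integral>x. (cmod (F i x - f x))\<^sup>2 \<partial>lborel) \<longlonglongrightarrow> (\<integral>x. 0 \<partial>(lborel :: 'a measure))"
  proof (rule integral_dominated_convergence[where w="\<lambda>x. 4 * (w x)\<^sup>2"])
    show "AE x in lborel. (\<lambda>i. (cmod (F i x - f x))\<^sup>2) \<longlonglongrightarrow> 0"
      using lim
    proof eventually_elim
      case (elim x)
      have "(\<lambda>i. (cmod (F i x - f x))\<^sup>2) \<longlonglongrightarrow> (cmod (f x - f x))\<^sup>2"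
        by (intro tendsto_intros elim)
      then show ?case by simp
    qed
    show "AE x in lborel. norm ((cmod (F i x - f x))\<^sup>2) \<le> 4 * (w x)\<^sup>2" for i
      using allb fw
    proof eventually_elim
      case (elim x)
      have "cmod (F i x - f x) \<le> 2 * w x"
        using norm_triangle_ineq4[of "F i x" "f x"] elim by (smt (verit))
      then have "(cmod (F i x - f x))\<^sup>2 \<le> (2 * w x)\<^sup>2"
        by (rule power_mono) simp
      then show ?case by (simp add: power_mult_distrib)
    qed
  qed (use w in auto)
  then have "(\<lambda>i. sqrt (\<integral>x. (cmod (F i x - f x))\<^sup>2 \<partial>lborel)) \<longlonglongrightarrow> sqrt 0"
    by (intro tendsto_real_sqrt) simp
  then show ?thesis
    using fL FL by (simp add: L2_tendsto_def L2_norm_def)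
qed

text \<open>
  Dominated convergence is a statement about sequences; the filter \<open>at a within S\<close> is countably
  generated, so it is enough to test it along sequences, once the domination is restricted to a
  neighbourhood on which it holds. The filter has to be proper because \<open>f \<in> L2\<close> is part
  of the conclusion.
\<close>

lemma L2_tendsto_dominated:
  fixes F :: "real \<Rightarrow> 'a::euclidean_space \<Rightarrow> complex"
  assumes f: "f \<in> borel_measurable borel"
    and w: "integrable lborel (\<lambda>x. (w x)\<^sup>2)"
    and bound: "\<forall>\<^sub>F h in at a within S. F h \<in> borel_measurable borel \<and> (AE x in lborel. cmod (F h x) \<le> w x)"
    and lim: "AE x in lborel. ((\<lambda>h. F h x) \<longlongrightarrow> f x) (at a within S)"
    and nontriv: "at a within S \<noteq> bot"
  shows "L2_tendsto F f (at a within S)"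
proof -
  have seq: "L2_tendsto (\<lambda>i. F (X i)) f sequentially"
    if X: "\<And>i. X i \<in> S - {a}" "X \<longlonglongrightarrow> a" 
      and F: "\<And>i. F (X i) \<in> borel_measurable borel"
      and bd: "\<And>i. AE x in lborel. cmod (F (X i) x) \<le> w x" for X
  proof (rule L2_tendsto_dominated_sequence[OF F f w bd])
    have "filterlim X (at a within S) sequentially"
      using X by (auto simp: filterlim_at)
    then show "AE x in lborel. (\<lambda>i. F (X i) x) \<longlonglongrightarrow> f x"
      using lim by (elim eventually_mono) (rule filterlim_compose)
  qed
  obtain T where T: "open T" "a \<in> T"
    "\<And>h. h \<in> T \<Longrightarrow> h \<noteq> a \<Longrightarrow> h \<in> S \<Longrightarrow>
      F h \<in> borel_measurable borel \<and> (AE x in lborel. cmod (F h x) \<le> w x)"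
    using bound unfolding eventually_at_topological by blast
  have eq: "at a within S = at a within (S \<inter> T)"
    by (rule at_within_nhd[OF T(2,1)]) auto
  have seq': "L2_tendsto (\<lambda>i. F (X i)) f sequentially"
    if "\<And>i. X i \<in> S \<inter> T - {a}" "X \<longlonglongrightarrow> a" for X
    by (rule seq) (use that T(3) in auto)
  have "((\<lambda>h. L2_norm (\<lambda>x. F h x - f x)) \<longlongrightarrow> 0) (at a within (S \<inter> T))"
    unfolding tendsto_at_iff_sequentially comp_def
    using seq' L2_tendstoD(3) by blast
  moreover have "\<forall>\<^sub>F h in at a within S. F h \<in> L2"
    using bound by eventually_elim (use L2_dominated[OF _ w] in blast)
  moreover have "f \<in> L2"
  proof -
    have "a islimpt (S \<inter> T)"
      using nontriv by (simp add: trivial_limit_within eq)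
    then obtain X where "\<And>i. X i \<in> S \<inter> T - {a}" "X \<longlonglongrightarrow> a"
      unfolding islimpt_sequential by blast
    then show ?thesis
      using seq' L2_tendstoD(1) by blast
  qed
  ultimately show ?thesis
    unfolding L2_tendsto_def eq by blast
qed

text \<open>
  Riesz--Fischer. A subsequence with increments of norm at most \<open>(1/2)^k\<close> converges almost everywhere,
  and Fatou's lemma turns the Cauchy property into convergence to the pointwise limit.
\<close>

theorem L2_complete:
  fixes F :: "nat \<Rightarrow> 'a::euclidean_space \<Rightarrow> complex"
  assumes F: "\<And>n. F n \<in> L2"
    and Cauchy: "\<And>e. e > 0 \<Longrightarrow> \<exists>N. \<forall>m\<ge>N. \<forall>n\<ge>N. L2_norm (\<lambda>x. F m x - F n x) \<le> e"
  obtains f where "L2_tendsto F f sequentially"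
proof -
  have [measurable]: "F n \<in> borel_measurable borel" for n
    using F by (rule L2_measurable)
  have "\<exists>N. \<forall>m\<ge>N. \<forall>n\<ge>N. L2_norm (\<lambda>x. F m x - F n x) \<le> (1/2)^k" for k :: nat
    by (rule Cauchy) simp
  then obtain N where N: "\<And>k m n. m \<ge> N k \<Longrightarrow> n \<ge> N k \<Longrightarrow> L2_norm (\<lambda>x. F m x - F n x) \<le> (1/2::real)^k"
    by metis
  define r where "r k = (\<Sum>i\<le>k. N i) + k" for k
  have r_ge: "r k \<ge> N k" "r k \<ge> k" "r (Suc k) \<ge> r k" for k
    using member_le_sum[of k "{..k}" N] by (auto simp: r_def)
  define D where "D k x = F (r (Suc k)) x - F (r k) x" for k x
  have [measurable]: "D k \<in> borel_measurable borel" for k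
    unfolding D_def by measurable
  have DL: "D k \<in> L2" for k
    unfolding D_def by (intro L2_diff F)
  have Dn: "L2_norm (D k) \<le> (1/2)^k" for k
    unfolding D_def by (rule N) (use r_ge(1,3)[of k] in auto)
  \<comment> \<open>The weights \<open>2 ^ k\<close> still leave a summable series, and they turn finiteness of the sum
    into geometric decay of the increments at almost every point.\<close>
  have "(\<integral>\<^sup>+x. (\<Sum>k. ennreal (2^k * (cmod (D k x))\<^sup>2)) \<partial>lborel) =
      (\<Sum>k. ennreal (2^k) * (\<integral>\<^sup>+x. ennreal ((cmod (D k x))\<^sup>2) \<partial>lborel))"
    by (subst nn_integral_suminf) (auto simp: ennreal_mult nn_integral_cmult)
  also have "\<dots> \<le> (\<Sum>k. ennreal ((1/2)^k))"
  proof (rule suminf_le)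
    fix k
    have "(L2_norm (D k))\<^sup>2 \<le> ((1/2)^k)\<^sup>2"
      by (intro power_mono Dn) simp
    then have "2^k * (L2_norm (D k))\<^sup>2 \<le> 2^k * ((1/2)^k)\<^sup>2"
      by (intro mult_left_mono) auto
    also have "\<dots> = (1/2)^k"
      by (simp add: power2_eq_square power_divide)
    finally show "ennreal (2^k) * (\<integral>\<^sup>+x. ennreal ((cmod (D k x))\<^sup>2) \<partial>lborel) \<le> ennreal ((1/2)^k)"
      unfolding L2_nn_integral[OF DL] by (simp add: ennreal_mult'[symmetric] ennreal_leI)
  qed auto
  also have "\<dots> < \<infinity>"
    by (subst suminf_ennreal2) (auto intro: summable_geometric)
  finally have "AE x in lborel. (\<Sum>k. ennreal (2^k * (cmod (D k x))\<^sup>2)) \<noteq> \<infinity>"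
    by (intro nn_integral_noteq_infinite) auto
  then have conv: "AE x in lborel. convergent (\<lambda>k. F (r k) x)"
  proof eventually_elim
    case (elim x)
    have "summable (\<lambda>k. 2^k * (cmod (D k x))\<^sup>2)"
      by (rule summable_suminf_not_top) (use elim in auto)
    then have "(\<lambda>k. 2^k * (cmod (D k x))\<^sup>2) \<longlonglongrightarrow> 0"
      by (rule summable_LIMSEQ_zero)
    then have "Bseq (\<lambda>k. 2^k * (cmod (D k x))\<^sup>2)"
      by (intro convergent_imp_Bseq) (auto simp: convergent_def)
    then obtain C where C: "C > 0" "\<And>k. 2^k * (cmod (D k x))\<^sup>2 \<le> C"
      by (auto simp: Bseq_def)
    have "norm (D k x) \<le> sqrt C * (sqrt (1/2))^k" for k
    proof -
      have "(cmod (D k x))\<^sup>2 \<le> C * (1/2)^k"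
        using C(2)[of k] by (simp add: field_simps)
      then have "cmod (D k x) \<le> sqrt (C * (1/2)^k)"
        by (rule real_le_rsqrt)
      then show ?thesis by (simp add: real_sqrt_mult real_sqrt_power real_sqrt_divide)
    qed
    note bd = this
    have "summable (\<lambda>k. sqrt C * (sqrt (1/2))^k)"
      by (intro summable_mult summable_geometric) (simp add: real_sqrt_divide)
    then have "summable (\<lambda>k. D k x)"
      by (rule summable_comparison_test'[where N=0]) (rule bd)
    then have "convergent (\<lambda>n. F (r 0) x + (\<Sum>k<n. D k x))"
      by (intro convergent_add convergent_const) (simp add: summable_iff_convergent)
    moreover have "F (r 0) x + (\<Sum>k<n. D k x) = F (r n) x" for n
      using sum_lessThan_telescope[of "\<lambda>k. F (r k) x" n] by (simp add: D_def)
    ultimately show ?case by simp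
  qed
  define f where "f x = lim (\<lambda>k. F (r k) x)" for x
  have [measurable]: "f \<in> borel_measurable borel"
    unfolding f_def by measurable
  have lim: "AE x in lborel. (\<lambda>k. F (r k) x) \<longlonglongrightarrow> f x"
    using conv by eventually_elim (simp add: f_def convergent_LIMSEQ_iff)
  have close: "(\<lambda>x. F m x - f x) \<in> L2 \<and> L2_norm (\<lambda>x. F m x - f x) \<le> e"
    if e: "e > 0" and mN: "\<forall>n\<ge>m. L2_norm (\<lambda>x. F m x - F n x) \<le> e" for e m
  proof -
    have "(\<integral>\<^sup>+x. ennreal ((cmod (F m x - f x))\<^sup>2) \<partial>lborel) =
        (\<integral>\<^sup>+x. liminf (\<lambda>k. ennreal ((cmod (F m x - F (r k) x))\<^sup>2)) \<partial>lborel)"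
    proof (rule nn_integral_cong_AE)
      show "AE x in lborel. ennreal ((cmod (F m x - f x))\<^sup>2) = 
          liminf (\<lambda>k. ennreal ((cmod (F m x - F (r k) x))\<^sup>2))"
        using lim
      proof eventually_elim
        case (elim x)
        have "(\<lambda>k. ennreal ((cmod (F m x - F (r k) x))\<^sup>2)) \<longlonglongrightarrow> ennreal ((cmod (F m x - f x))\<^sup>2)"
          by (intro tendsto_ennrealI tendsto_intros elim)
        then show ?case
          using lim_imp_Liminf[OF trivial_limit_sequentially] by fastforce
      qed
    qed
    also have "\<dots> \<le> liminf (\<lambda>k. \<integral>\<^sup>+x. ennreal ((cmod (F m x - F (r k) x))\<^sup>2) \<partial>lborel)"
      by (rule nn_integral_liminf) auto
    also have "\<dots> \<le> limsup (\<lambda>k. \<integral>\<^sup>+x. ennreal ((cmod (F m x - F (r k) x))\<^sup>2) \<partial>lborel)"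
      by (rule Liminf_le_Limsup) simp
    also have "\<dots> \<le> ennreal (e\<^sup>2)"
    proof (rule Limsup_bounded)
      show "\<forall>\<^sub>F k in sequentially. (\<integral>\<^sup>+x. ennreal ((cmod (F m x - F (r k) x))\<^sup>2) \<partial>lborel) \<le> ennreal (e\<^sup>2)"
        using eventually_ge_at_top[of m]
      proof eventually_elim
        case (elim k)
        then have "L2_norm (\<lambda>x. F m x - F (r k) x) \<le> e"
          using mN r_ge(2)[of k] by auto
        then show ?case
          by (subst L2_nn_integral) (auto intro!: L2_diff F ennreal_leI power_mono)
      qed
    qed
    finally show ?thesis
      using L2_nn_integral_le[of "\<lambda>x. F m x - f x" e] e by auto
  qed
  obtain m0 where m0: "\<forall>n\<ge>m0. L2_norm (\<lambda>x. F m0 x - F n x) \<le> 1"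
    using Cauchy[of 1] by (metis order_refl zero_less_one)
  have "(\<lambda>x. F m0 x - (F m0 x - f x)) \<in> L2"
    by (rule L2_diff[OF F]) (use close[OF _ m0] in simp)
  then have fL: "f \<in> L2" by simp
  have "(\<lambda>m. L2_norm (\<lambda>x. F m x - f x)) \<longlonglongrightarrow> 0"
  proof (rule LIMSEQ_I)
    fix e :: real assume "e > 0"
    then obtain M where M: "\<forall>m\<ge>M. \<forall>n\<ge>M. L2_norm (\<lambda>x. F m x - F n x) \<le> e/2"
      using Cauchy[of "e/2"] by auto
    have "L2_norm (\<lambda>x. F m x - f x) \<le> e/2" if "m \<ge> M" for m
      using close[of "e/2" m] M \<open>e > 0\<close> that by auto
    then show "\<exists>no. \<forall>n\<ge>no. norm (L2_norm (\<lambda>x. F n x - f x) - 0) < e"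
      using \<open>e > 0\<close> by (intro exI[of _ M]) fastforce
  qed
  then have "L2_tendsto F f sequentially"
    using F fL by (simp add: L2_tendsto_def)
  then show thesis by (rule that)
qed

section \<open>The Fourier integral and Gaussians\<close>

lemma borel_measurable_cis [measurable (raw)]:
  assumes "f \<in> borel_measurable M"
  shows "(\<lambda>x. cis (f x)) \<in> borel_measurable M"
  by (rule borel_measurable_continuous_on[OF _ assms]) (intro continuous_intros)

lemma borel_measurable_cnj [measurable (raw)]:
  assumes "f \<in> borel_measurable M"
  shows "(\<lambda>x. cnj (f x)) \<in> borel_measurable M"
  by (rule borel_measurable_continuous_on[OF _ assms]) (intro continuous_intros)

lemma lborel_integral_affine:
  fixes f :: "'a::euclidean_space \<Rightarrow> 'b::{banach, second_countable_topology}"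
  assumes [measurable]: "f \<in> borel_measurable borel" and c: "c > 0"
  shows "(\<integral>x. f x \<partial>lborel) = c ^ DIM('a) *\<^sub>R (\<integral>x. f (t + c *\<^sub>R x) \<partial>lborel)"
  by (subst lborel_affine[of c t])
     (use c in \<open>simp_all add: integral_density integral_distr ennreal_power\<close>)

lemma lborel_nn_integral_affine:
  fixes f :: "'a::euclidean_space \<Rightarrow> ennreal"
  assumes [measurable]: "f \<in> borel_measurable borel" and c: "c > 0"
  shows "(\<integral>\<^sup>+x. f x \<partial>lborel) = ennreal (c ^ DIM('a)) * (\<integral>\<^sup>+x. f (t + c *\<^sub>R x) \<partial>lborel)"
  by (subst lborel_affine[of c t])
     (use c in \<open>simp_all add: nn_integral_density nn_integral_distr nn_integral_cmult ennreal_power\<close>)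

lemma lborel_integrable_affine:
  fixes f :: "'a::euclidean_space \<Rightarrow> 'b::{banach, second_countable_topology}"
  assumes f: "integrable lborel f" and c: "c > 0"
  shows "integrable lborel (\<lambda>x. f (t + c *\<^sub>R x))"
proof -
  have [measurable]: "f \<in> borel_measurable borel"
    using f by (auto dest: borel_measurable_integrable)
  have "(\<integral>\<^sup>+x. ennreal (norm (f x)) \<partial>lborel) < \<infinity>"
    using f by (simp add: integrable_iff_bounded)
  then show ?thesis
    using c unfolding integrable_iff_bounded
    by (subst (asm) lborel_nn_integral_affine[where c=c and t=t]) (auto simp: ennreal_mult_less_top)
qed

text \<open>
  Lebesgue measure on a Euclidean space is the image of the product of one-dimensional Lebesgue
  measures, so functions that factor along the coordinates integrate coordinatewise. This
  reduces the transform of the Gaussian to the real line.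
\<close>

lemma
  fixes f :: "'a::euclidean_space \<Rightarrow> real \<Rightarrow> complex"
  assumes f: "\<And>b. b \<in> Basis \<Longrightarrow> integrable lborel (f b)"
  shows lborel_integrable_prod_Basis: "integrable lborel (\<lambda>x. \<Prod>b\<in>Basis. f b (x \<bullet> b))"
    and lborel_integral_prod_Basis:
      "(\<integral>x. (\<Prod>b\<in>Basis. f b (x \<bullet> b)) \<partial>lborel) = (\<Prod>b\<in>Basis. \<integral>x. f b x \<partial>lborel)"
proof -
  interpret product_sigma_finite "\<lambda>b::'a. lborel :: real measure"
    by standard
  have [measurable]: "\<And>b. b \<in> Basis \<Longrightarrow> f b \<in> borel_measurable borel"
    using f by (auto dest: borel_measurable_integrable)
  have meas: "(\<lambda>x. \<Prod>b\<in>Basis. f b (x \<bullet> b)) \<in> borel_measurable (borel :: 'a measure)"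
    by (intro borel_measurable_prod) measurable
  have T: "(\<lambda>f. \<Sum>b\<in>Basis. f b *\<^sub>R b) \<in> (\<Pi>\<^sub>M b\<in>Basis. lborel) \<rightarrow>\<^sub>M (borel :: 'a measure)"
    by measurable
  have eq: "(\<Prod>b\<in>Basis. f b ((\<Sum>c\<in>Basis. y c *\<^sub>R c) \<bullet> b)) = (\<Prod>b\<in>Basis. f b (y b))" for y :: "'a \<Rightarrow> real"
    by (intro prod.cong refl) simp
  show "integrable lborel (\<lambda>x. \<Prod>b\<in>Basis. f b (x \<bullet> b))"
    by (subst lborel_eq) (simp add: integrable_distr_eq[OF T meas] eq product_integrable_prod f
         del: inner_sum_left_Basis)
  show "(\<integral>x. (\<Prod>b\<in>Basis. f b (x \<bullet> b)) \<partial>lborel) = (\<Prod>b\<in>Basis. \<integral>x. f b x \<partial>lborel)"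
    by (subst lborel_eq) (simp add: integral_distr[OF T meas] eq product_integral_prod f
         del: inner_sum_left_Basis)
qed

text \<open>
  The Fourier integral for an arbitrary Euclidean space: on a product space the inner product is
  the sum of the inner products, so \<open>fourier_integral\<close> is the instance for \<open>(real^'d) \<times> real\<close>
  (see \<open>fourier_integral_eq_ft\<close>).
\<close>

definition ft :: "('a::euclidean_space \<Rightarrow> complex) \<Rightarrow> 'a \<Rightarrow> complex" where
  "ft f \<xi> = (\<integral>x. cis (- (2 * pi * (\<xi> \<bullet> x))) * f x \<partial>lborel)"

text \<open>
  Scaled so that it is its own Fourier transform and has integral 1.
\<close>

definition gauss :: "'a::euclidean_space \<Rightarrow> complex" where
  "gauss x = of_real (exp (- pi * (norm x)\<^sup>2))"

lemma gauss_measurable [measurable]: "gauss \<in> borel_measurable borel"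
  unfolding gauss_def by measurable

text \<open>
  The characteristic function of the standard normal distribution, after the substitution
  \<open>x \<mapsto> sqrt (2 * pi) * x\<close>.
\<close>

lemma gauss_real:
  fixes t :: real
  shows "integrable lborel (gauss :: real \<Rightarrow> complex)" and "ft gauss t = gauss t"
proof -
  let ?c = "sqrt (2 * pi)"
  have c: "?c > 0" "?c * ?c = 2 * pi" by auto
  have dens: "std_normal_density (?c * x) = exp (- pi * x\<^sup>2) / ?c" for x
    by (simp add: std_normal_density_def power_mult_distrib)
  have "integrable lborel (\<lambda>x. std_normal_density (0 + ?c * x))"
    by (rule lborel_integrable_real_affine) (use c in auto)
  then have "integrable lborel (\<lambda>x. complex_of_real (?c * std_normal_density (0 + ?c * x)))"
    by (intro integrable_of_real integrable_mult_right)
  then show "integrable lborel (gauss :: real \<Rightarrow> complex)"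
    using c by (simp add: dens gauss_def[abs_def])
  have "complex_of_real (exp (- ((- ?c * t)^2) / 2)) = char std_normal_distribution (- ?c * t)"
    by (simp add: char_std_normal_distribution)
  also have "\<dots> = (\<integral>x. std_normal_density x *\<^sub>R iexp (- ?c * t * x) \<partial>lborel)"
    unfolding char_def by (subst integral_density) auto
  also have "\<dots> = \<bar>?c\<bar> *\<^sub>R (\<integral>x. std_normal_density (0 + ?c * x) *\<^sub>R iexp (- ?c * t * (0 + ?c * x)) \<partial>lborel)"
    by (rule lborel_integral_real_affine) (use c in auto)
  also have "\<dots> = (\<integral>x. ?c *\<^sub>R (std_normal_density (0 + ?c * x) *\<^sub>R iexp (- ?c * t * (0 + ?c * x))) \<partial>lborel)"
    by (subst integral_scaleR_right) (simp only: abs_of_pos[OF c(1)])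
  also have "\<dots> = ft gauss t"
    unfolding ft_def
  proof (intro Bochner_Integration.integral_cong refl)
    fix x :: real
    have "- ?c * t * (0 + ?c * x) = - (2 * pi * (t \<bullet> x))"
      using c(2) by (simp add: algebra_simps)
    then have "iexp (- ?c * t * (0 + ?c * x)) = cis (- (2 * pi * (t \<bullet> x)))"
      by (simp only: cis_conv_exp)
    then show "?c *\<^sub>R (std_normal_density (0 + ?c * x) *\<^sub>R iexp (- ?c * t * (0 + ?c * x))) =
        cis (- (2 * pi * (t \<bullet> x))) * gauss x"
      using c by (simp only: dens add_0) (simp add: gauss_def scaleR_conv_of_real)
  qed
  finally show "ft gauss t = gauss t"
    by (simp add: gauss_def power_mult_distrib)
qed

lemma gauss_prod: "gauss x = (\<Prod>b\<in>Basis. gauss (x \<bullet> b))"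
  unfolding gauss_def of_real_prod[symmetric]
  by (subst exp_sum[symmetric]) (simp_all add: sum_distrib_left[symmetric] norm_eq_sqrt_inner
     euclidean_inner[of x x] power2_eq_square sum_negf sum_nonneg)

lemma cis_sum: "finite A \<Longrightarrow> cis (\<Sum>a\<in>A. f a) = (\<Prod>a\<in>A. cis (f a))"
  by (induction A rule: finite_induct) (auto simp: cis_mult[symmetric])

lemma gauss_integrable: "integrable lborel gauss"
  using lborel_integrable_prod_Basis[of "\<lambda>_. gauss"] gauss_real(1) by (simp add: gauss_prod[symmetric])

lemma ft_gauss: "ft gauss \<xi> = gauss \<xi>"
proof -
  define g :: "'a \<Rightarrow> real \<Rightarrow> complex" where "g b y = cis (- (2 * pi * ((\<xi> \<bullet> b) * y))) * gauss y" for b y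
  have gi: "integrable lborel (g b)" for b
    unfolding g_def
    by (rule Bochner_Integration.integrable_bound[OF gauss_real(1)]) (auto simp: norm_mult)
  have "ft gauss \<xi> = (\<integral>x. (\<Prod>b\<in>Basis. g b (x \<bullet> b)) \<partial>lborel)"
    unfolding ft_def
  proof (intro Bochner_Integration.integral_cong refl)
    fix x :: 'a
    have "- (2 * pi * (\<xi> \<bullet> x)) = (\<Sum>b\<in>Basis. - (2 * pi * ((\<xi> \<bullet> b) * (x \<bullet> b))))"
      by (subst euclidean_inner) (simp add: sum_distrib_left sum_negf)
    then show "cis (- (2 * pi * (\<xi> \<bullet> x))) * gauss x = (\<Prod>b\<in>Basis. g b (x \<bullet> b))"
      unfolding g_def by (simp add: cis_sum prod.distrib gauss_prod[symmetric])
  qed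
  also have "\<dots> = (\<Prod>b\<in>Basis. \<integral>y. g b y \<partial>lborel)"
    by (rule lborel_integral_prod_Basis) (rule gi)
  also have "\<dots> = (\<Prod>b\<in>Basis. gauss (\<xi> \<bullet> b))"
    using gauss_real(2) by (intro prod.cong refl) (simp add: g_def ft_def)
  finally show ?thesis by (simp add: gauss_prod[symmetric])
qed

lemma ft_measurable [measurable]:
  assumes [measurable]: "f \<in> borel_measurable borel"
  shows "ft f \<in> borel_measurable borel"
  unfolding ft_def by measurable

lemma ft_integrand_integrable:
  assumes "integrable lborel f"
  shows "integrable lborel (\<lambda>x. cis (- (2 * pi * (\<xi> \<bullet> x))) * f x)"
  by (rule Bochner_Integration.integrable_bound[OF assms]) 
    (use borel_measurable_integrable[OF assms] in \<open>auto simp: norm_mult\<close>)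

lemma ft_bound:
  assumes "integrable lborel f"
  shows "cmod (ft f \<xi>) \<le> (\<integral>x. cmod (f x) \<partial>lborel)"
  unfolding ft_def by (rule order_trans[OF integral_norm_bound]) (simp add: norm_mult)

lemma ft_diff:
  assumes "integrable lborel f" "integrable lborel g"
  shows "ft (\<lambda>x. f x - g x) \<xi> = ft f \<xi> - ft g \<xi>"
  unfolding ft_def right_diff_distrib
  by (rule Bochner_Integration.integral_diff) (intro ft_integrand_integrable assms)+

lemma ft_add:
  assumes "integrable lborel f" "integrable lborel g"
  shows "ft (\<lambda>x. f x + g x) \<xi> = ft f \<xi> + ft g \<xi>"
  unfolding ft_def distrib_left
  by (rule Bochner_Integration.integral_add) (intro ft_integrand_integrable assms)+

lemma ft_cmult: "ft (\<lambda>x. c * f x) \<xi> = c * ft f \<xi>"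
  unfolding ft_def by (subst integral_mult_right_zero[symmetric]) (simp add: algebra_simps)

text \<open>
  Both sides are the double integral of \<open>cis (- 2 pi \<xi> \<bullet> x) f(x) g(\<xi>)\<close>. Exchanging the order of
  integration once carries the rest of the Fourier theory: it gives Gaussian summability of the inverse
  transform, the energy identity behind Plancherel's theorem, and the adjoint relation from which
  surjectivity follows.
\<close>

theorem ft_multiplication:
  assumes f: "integrable lborel f" and g: "integrable lborel g"
  shows "(\<integral>\<xi>. ft f \<xi> * g \<xi> \<partial>lborel) = (\<integral>x. f x * ft g x \<partial>lborel)"
proof -
  have [measurable]: "f \<in> borel_measurable borel" "g \<in> borel_measurable borel"
    using f g by (auto dest: borel_measurable_integrable)
  let ?k = "\<lambda>\<xi> x. cis (- (2 * pi * (\<xi> \<bullet> x))) * f x * g \<xi>"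
  have "integrable (lborel \<Otimes>\<^sub>M lborel) (\<lambda>(\<xi>, x). ?k \<xi> x)"
  proof (rule lborel_pair.Fubini_integrable)
    show "(\<lambda>(\<xi>, x). ?k \<xi> x) \<in> borel_measurable (lborel \<Otimes>\<^sub>M lborel)" by measurable
    have "integrable lborel (\<lambda>\<xi>. (\<integral>x. cmod (f x) \<partial>lborel) * cmod (g \<xi>))"
      using g by auto
    then show "integrable lborel (\<lambda>\<xi>. \<integral>x. norm (case (\<xi>, x) of (\<xi>, x) \<Rightarrow> ?k \<xi> x) \<partial>lborel)"
      by (simp add: norm_mult)
    show "AE \<xi> in lborel. integrable lborel (\<lambda>x. case (\<xi>, x) of (\<xi>, x) \<Rightarrow> ?k \<xi> x)"
      using ft_integrand_integrable[OF f] by simp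
  qed
  then have swap: "(\<integral>x. (\<integral>\<xi>. ?k \<xi> x \<partial>lborel) \<partial>lborel) = (\<integral>\<xi>. (\<integral>x. ?k \<xi> x \<partial>lborel) \<partial>lborel)"
    by (rule lborel_pair.Fubini_integral)
  have L: "(\<integral>x. ?k \<xi> x \<partial>lborel) = ft f \<xi> * g \<xi>" for \<xi>
    unfolding ft_def by simp
  have R: "(\<integral>\<xi>. ?k \<xi> x \<partial>lborel) = f x * ft g x" for x
    unfolding ft_def by (subst integral_mult_right_zero[symmetric]) (simp add: inner_commute algebra_simps)
  show ?thesis
    using swap unfolding L R by (rule sym)
qed

lemma gauss_scaled_integrable: "e > 0 \<Longrightarrow> integrable lborel (\<lambda>x. gauss (e *\<^sub>R x))"
  using lborel_integrable_affine[OF gauss_integrable, of e 0] by simp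

text \<open>
  Multiplying \<open>ft f\<close> by a wide Gaussian makes the inversion integral absolutely convergent; by the
  multiplication formula its value is an average of \<open>f\<close> over a Gaussian of width \<open>e\<close> around \<open>y\<close>.
\<close>

lemma gauss_mean_inversion:
  fixes f :: "'a::euclidean_space \<Rightarrow> complex"
  assumes f: "integrable lborel f" and e: "e > 0"
  shows "(\<integral>\<xi>. ft f \<xi> * (cis (2 * pi * (\<xi> \<bullet> y)) * gauss (e *\<^sub>R \<xi>)) \<partial>lborel) =
     (\<integral>v. f (y + e *\<^sub>R v) * gauss v \<partial>lborel)"
proof -
  have [measurable]: "f \<in> borel_measurable borel"
    using f by (auto dest: borel_measurable_integrable)
  define g :: "'a \<Rightarrow> complex" where "g \<xi> = cis (2 * pi * (\<xi> \<bullet> y)) * gauss (e *\<^sub>R \<xi>)" for \<xi>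
  have [measurable]: "g \<in> borel_measurable borel"
    unfolding g_def by measurable
  have g: "integrable lborel g"
    by (rule Bochner_Integration.integrable_bound[OF gauss_scaled_integrable[OF e]])
      (auto simp: g_def norm_mult)
  have ftg: "of_real (e ^ DIM('a)) * ft g (y + e *\<^sub>R v) = gauss v" for v
  proof -
    have "gauss v = ft gauss v" by (simp add: ft_gauss)
    also have "\<dots> = e ^ DIM('a) *\<^sub>R (\<integral>\<xi>. cis (- (2 * pi * (v \<bullet> (0 + e *\<^sub>R \<xi>)))) * gauss (0 + e *\<^sub>R \<xi>) \<partial>lborel)"
      unfolding ft_def by (rule lborel_integral_affine) (use e in auto)
    also have "\<dots> = of_real (e ^ DIM('a)) * ft g (y + e *\<^sub>R v)"
    proof -
      have "cis (- (2 * pi * (v \<bullet> (0 + e *\<^sub>R \<xi>)))) =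
          cis (- (2 * pi * ((y + e *\<^sub>R v) \<bullet> \<xi>))) * cis (2 * pi * (\<xi> \<bullet> y))" for \<xi>
        unfolding cis_mult by (rule arg_cong[of _ _ cis])
          (simp add: inner_add_left inner_commute[of \<xi> y] algebra_simps)
      then show ?thesis
        unfolding ft_def g_def by (simp only: scaleR_conv_of_real mult.assoc add_0)
    qed
    finally show ?thesis by simp
  qed
  have "(\<integral>\<xi>. ft f \<xi> * g \<xi> \<partial>lborel) = (\<integral>x. f x * ft g x \<partial>lborel)"
    by (rule ft_multiplication[OF f g])
  also have "\<dots> = e ^ DIM('a) *\<^sub>R (\<integral>v. f (y + e *\<^sub>R v) * ft g (y + e *\<^sub>R v) \<partial>lborel)"
    by (rule lborel_integral_affine) (use e in auto)
  also have "\<dots> = (\<integral>v. f (y + e *\<^sub>R v) * (of_real (e ^ DIM('a)) * ft g (y + e *\<^sub>R v)) \<partial>lborel)"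
    unfolding scaleR_conv_of_real
    by (subst integral_mult_right_zero[symmetric]) (simp add: algebra_simps)
  finally show ?thesis
    by (simp only: ftg g_def)
qed

section \<open>Plancherel's identity for integrable functions\<close>

lemma L2_of_bounded:
  assumes f: "integrable lborel f" and bd: "\<And>x. cmod (f x) \<le> M"
  shows "f \<in> L2"
proof -
  have [measurable]: "f \<in> borel_measurable borel"
    using f by (auto dest: borel_measurable_integrable)
  have "integrable lborel (\<lambda>x. (cmod (f x))\<^sup>2)"
  proof (rule Bochner_Integration.integrable_bound)
    show "integrable lborel (\<lambda>x. M * cmod (f x))"
      using f by auto
    show "AE x in lborel. norm ((cmod (f x))\<^sup>2) \<le> norm (M * cmod (f x))"
      using mult_right_mono[OF bd norm_ge_zero] order_trans[OF norm_ge_zero bd]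
      by (intro AE_I2) (simp add: power2_eq_square abs_mult)
  qed simp
  then show ?thesis by (simp add: L2_def)
qed

text \<open>
  The multiplication formula with \<open>g = cnj (ft f) * gauss\<close>, whose transform is the conjugate of the
  Gaussian average above. As \<open>e\<close> tends to 0 the left side increases to the energy of \<open>ft f\<close> and the
  right side should tend to the energy of \<open>f\<close>.
\<close>

lemma gauss_mean_energy:
  fixes f :: "'a::euclidean_space \<Rightarrow> complex"
  assumes f: "integrable lborel f" and e: "e > 0"
  shows "(\<integral>\<xi>. of_real ((cmod (ft f \<xi>))\<^sup>2) * gauss (e *\<^sub>R \<xi>) \<partial>lborel) =
    (\<integral>x. f x * cnj (\<integral>v. f (x + e *\<^sub>R v) * gauss v \<partial>lborel) \<partial>lborel)"
proof -
  have [measurable]: "f \<in> borel_measurable borel"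
    using f by (auto dest: borel_measurable_integrable)
  define g where "g \<xi> = cnj (ft f \<xi>) * gauss (e *\<^sub>R \<xi>)" for \<xi>
  have [measurable]: "g \<in> borel_measurable borel"
    unfolding g_def by measurable
  have g: "integrable lborel g"
  proof (rule Bochner_Integration.integrable_bound)
    show "integrable lborel (\<lambda>\<xi>. (\<integral>x. cmod (f x) \<partial>lborel) * cmod (gauss (e *\<^sub>R \<xi>)))"
      using gauss_scaled_integrable[OF e] by auto
    show "AE \<xi> in lborel. norm (g \<xi>) \<le> norm ((\<integral>x. cmod (f x) \<partial>lborel) * cmod (gauss (e *\<^sub>R \<xi>)))"
      unfolding g_def norm_mult using ft_bound[OF f] by (intro AE_I2) (auto intro!: mult_right_mono
        order_trans[OF ft_bound[OF f]])
  qed simp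
  have ftg: "ft g x = cnj (\<integral>v. f (x + e *\<^sub>R v) * gauss v \<partial>lborel)" for x
    unfolding gauss_mean_inversion[OF f e, symmetric]
    by (subst Bochner_Integration.integral_cnj[symmetric])
       (simp add: ft_def g_def cis_cnj gauss_def inner_commute algebra_simps)
  have "(\<integral>\<xi>. of_real ((cmod (ft f \<xi>))\<^sup>2) * gauss (e *\<^sub>R \<xi>) \<partial>lborel) = (\<integral>\<xi>. ft f \<xi> * g \<xi> \<partial>lborel)"
    unfolding g_def complex_norm_square by (simp add: mult.assoc)
  also have "\<dots> = (\<integral>x. f x * ft g x \<partial>lborel)"
    by (rule ft_multiplication[OF f g])
  finally show ?thesis by (simp only: ftg)
qed

text \<open>
  For bounded continuous \<open>f\<close> the Gaussian averages converge pointwise and boundedly, so the limit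
  \<open>e \<rightarrow> 0\<close> in the energy identity is elementary.
\<close>

lemma ft_isometry_continuous:
  fixes f :: "'a::euclidean_space \<Rightarrow> complex"
  assumes f: "integrable lborel f" and cont: "continuous_on UNIV f" and bd: "\<And>x. cmod (f x) \<le> M"
  shows "ft f \<in> L2" and "L2_norm (ft f) = L2_norm f"
proof -
  have [measurable]: "f \<in> borel_measurable borel"
    using f by (auto dest: borel_measurable_integrable)
  have M: "M \<ge> 0" using order_trans[OF norm_ge_zero bd] .
  define e where "e n = 1 / real (Suc n)" for n
  have e: "e n > 0" "e (Suc n) \<le> e n" for n
    by (auto simp: e_def field_simps)
  have e0: "e \<longlonglongrightarrow> 0"
    unfolding e_def[abs_def] by (rule LIMSEQ_Suc[OF lim_1_over_n])
  let ?W = "\<lambda>n x. \<integral>v. f (x + e n *\<^sub>R v) * gauss v \<partial>lborel"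
  have intg: "(\<integral>v. gauss (v::'a) \<partial>lborel) = 1"
    using ft_gauss[of "0::'a"] by (simp add: ft_def gauss_def)
  have W: "(\<lambda>n. ?W n x) \<longlonglongrightarrow> f x" for x
  proof -
    have "(\<lambda>n. ?W n x) \<longlonglongrightarrow> (\<integral>v. f x * gauss (v::'a) \<partial>lborel)"
    proof (rule integral_dominated_convergence[where w="\<lambda>v. M * cmod (gauss (v::'a))"])
      show "integrable lborel (\<lambda>v. M * cmod (gauss (v::'a)))"
        using gauss_integrable by auto
      have "(\<lambda>n. f (x + e n *\<^sub>R v)) \<longlonglongrightarrow> f (x + 0 *\<^sub>R v)" for v
      proof (rule continuous_on_tendsto_compose[OF cont])
        show "(\<lambda>n. x + e n *\<^sub>R v) \<longlonglongrightarrow> x + 0 *\<^sub>R v"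
          by (intro tendsto_intros e0)
      qed auto
      then show "AE v in lborel. (\<lambda>n. f (x + e n *\<^sub>R v) * gauss v) \<longlonglongrightarrow> f x * gauss v"
        by (auto intro!: tendsto_intros)
      show "AE v in lborel. norm (f (x + e n *\<^sub>R v) * gauss v) \<le> M * cmod (gauss v)" for n
        by (auto simp: norm_mult intro!: mult_right_mono bd)
    qed measurable
    then show ?thesis using intg by simp
  qed
  have Wb: "cmod (?W n x) \<le> M * (\<integral>v. cmod (gauss (v::'a)) \<partial>lborel)" for n x
  proof -
    have "cmod (?W n x) \<le> (\<integral>v. cmod (f (x + e n *\<^sub>R v) * gauss v) \<partial>lborel)"
      by (rule integral_norm_bound)
    also have "\<dots> \<le> (\<integral>v. M * cmod (gauss (v::'a)) \<partial>lborel)"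
    proof (rule integral_mono)
      show "integrable lborel (\<lambda>v. M * cmod (gauss (v::'a)))"
        using gauss_integrable by auto
      then show "integrable lborel (\<lambda>v. cmod (f (x + e n *\<^sub>R v) * gauss v))"
        by (rule Bochner_Integration.integrable_bound)
          (use M in \<open>auto simp: norm_mult abs_mult intro!: mult_right_mono bd\<close>)
      show "cmod (f (x + e n *\<^sub>R v) * gauss v) \<le> M * cmod (gauss v)" for v
        by (auto simp: norm_mult intro!: mult_right_mono bd)
    qed
    finally show ?thesis by simp
  qed
  have [measurable]: "?W n \<in> borel_measurable borel" for n
    by measurable
  have "(\<lambda>n. \<integral>x. f x * cnj (?W n x) \<partial>lborel) \<longlonglongrightarrow> (\<integral>x. f x * cnj (f x) \<partial>lborel)"
  proof (rule integral_dominated_convergence)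
    let ?K = "M * (\<integral>v. cmod (gauss (v::'a)) \<partial>lborel)"
    show "integrable lborel (\<lambda>x. ?K * cmod (f x))"
      using f by auto
    show "AE x in lborel. norm (f x * cnj (?W n x)) \<le> ?K * cmod (f x)" for n
      using mult_right_mono[OF Wb norm_ge_zero] by (auto simp: norm_mult mult.commute)
    show "AE x in lborel. (\<lambda>n. f x * cnj (?W n x)) \<longlonglongrightarrow> f x * cnj (f x)"
      by (intro AE_I2 tendsto_intros W)
    show "(\<lambda>x. f x * cnj (?W n x)) \<in> borel_measurable lborel" for n
      by simp
    show "(\<lambda>x. f x * cnj (f x)) \<in> borel_measurable lborel"
      unfolding complex_norm_square[symmetric] by measurable
  qed
  then have lim1: "(\<lambda>n. \<integral>\<xi>. of_real ((cmod (ft f \<xi>))\<^sup>2) * gauss (e n *\<^sub>R \<xi>) \<partial>lborel) \<longlonglongrightarrow>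
      of_real ((L2_norm f)\<^sup>2)"
    unfolding gauss_mean_energy[OF f e(1)] L2_norm_power2 complex_norm_square[symmetric]
      integral_complex_of_real .
  define G where "G n \<xi> = (cmod (ft f \<xi>))\<^sup>2 * exp (- pi * (norm (e n *\<^sub>R \<xi>))\<^sup>2)" for n \<xi>
  have G0: "G n \<xi> \<ge> 0" for n \<xi> by (simp add: G_def)
  have [measurable]: "G n \<in> borel_measurable borel" for n
    unfolding G_def by measurable
  have Gi: "integrable lborel (G n)" for n
  proof (rule Bochner_Integration.integrable_bound)
    show "integrable lborel (\<lambda>\<xi>::'a. (\<integral>x. cmod (f x) \<partial>lborel)\<^sup>2 * cmod (gauss (e n *\<^sub>R \<xi>)))"
      by (intro integrable_mult_right integrable_norm gauss_scaled_integrable e)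
    show "AE \<xi> in lborel. norm (G n \<xi>) \<le> norm ((\<integral>x. cmod (f x) \<partial>lborel)\<^sup>2 * cmod (gauss (e n *\<^sub>R \<xi>)))"
      unfolding G_def gauss_def
      by (auto simp: abs_mult intro!: mult_right_mono power_mono ft_bound[OF f])
  qed simp
  have "(\<lambda>n. \<integral>\<xi>. complex_of_real (G n \<xi>) \<partial>lborel) \<longlonglongrightarrow> of_real ((L2_norm f)\<^sup>2)"
    using lim1 by (simp add: G_def gauss_def)
  then have lim2: "(\<lambda>n. \<integral>\<xi>. G n \<xi> \<partial>lborel) \<longlonglongrightarrow> (L2_norm f)\<^sup>2"
    unfolding integral_complex_of_real tendsto_of_real_iff .
  have "(\<lambda>n. \<integral>\<^sup>+\<xi>. ennreal (G n \<xi>) \<partial>lborel) \<longlonglongrightarrow> (\<integral>\<^sup>+\<xi>. ennreal ((cmod (ft f \<xi>))\<^sup>2) \<partial>lborel)"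
  proof (rule nn_integral_LIMSEQ)
    show "incseq (\<lambda>n \<xi>. ennreal (G n \<xi>))"
    proof (rule incseq_SucI, rule le_funI, rule ennreal_leI)
      fix n and \<xi> :: 'a
      have "norm (e (Suc n) *\<^sub>R \<xi>) \<le> norm (e n *\<^sub>R \<xi>)"
        using e[of n] e(1)[of "Suc n"] by (auto intro!: mult_right_mono)
      then have "(norm (e (Suc n) *\<^sub>R \<xi>))\<^sup>2 \<le> (norm (e n *\<^sub>R \<xi>))\<^sup>2"
        by (rule power_mono) simp
      then show "G n \<xi> \<le> G (Suc n) \<xi>"
        unfolding G_def by (intro mult_left_mono) auto
    qed
    show "(\<lambda>n. ennreal (G n \<xi>)) \<longlonglongrightarrow> ennreal ((cmod (ft f \<xi>))\<^sup>2)" for \<xi>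
    proof (rule tendsto_ennrealI)
      have "(\<lambda>n. G n \<xi>) \<longlonglongrightarrow> (cmod (ft f \<xi>))\<^sup>2 * exp (- pi * (norm (0 *\<^sub>R \<xi>))\<^sup>2)"
        unfolding G_def by (intro tendsto_intros e0)
      then show "(\<lambda>n. G n \<xi>) \<longlonglongrightarrow> (cmod (ft f \<xi>))\<^sup>2" by simp
    qed
  qed measurable
  moreover have "(\<lambda>n. \<integral>\<^sup>+\<xi>. ennreal (G n \<xi>) \<partial>lborel) \<longlonglongrightarrow> ennreal ((L2_norm f)\<^sup>2)"
    using tendsto_ennrealI[OF lim2] by (simp add: nn_integral_eq_integral[OF Gi] G0)
  ultimately have eq: "(\<integral>\<^sup>+\<xi>. ennreal ((cmod (ft f \<xi>))\<^sup>2) \<partial>lborel) = ennreal ((L2_norm f)\<^sup>2)"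
    by (rule LIMSEQ_unique)
  show L: "ft f \<in> L2"
    by (rule L2_nn_integral_le(1)[OF _ L2_norm_nonneg eq[THEN eq_refl]]) simp
  show "L2_norm (ft f) = L2_norm f"
    using eq unfolding L2_nn_integral[OF L] by simp
qed

text \<open>
  The continuous projection onto a square with half-side \<open>N\<close>: it bounds continuous approximants of
  a bounded function without moving the limit.
\<close>

definition clamp_box :: "real \<Rightarrow> complex \<Rightarrow> complex" where
  "clamp_box N z = of_real (min N (max (-N) (Re z))) + \<i> * of_real (min N (max (-N) (Im z)))"

lemma continuous_clamp_box [continuous_intros]: "continuous_on S f \<Longrightarrow> continuous_on S (\<lambda>x. clamp_box N (f x))"
  unfolding clamp_box_def by (intro continuous_intros)

lemma clamp_box_id: "cmod z \<le> N \<Longrightarrow> clamp_box N z = z"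
  using abs_Re_le_cmod[of z] abs_Im_le_cmod[of z] by (auto simp: clamp_box_def complex_eq_iff)

lemma clamp_box_bound:
  assumes "N \<ge> 0"
  shows "cmod (clamp_box N z) \<le> 2 * N"
proof -
  have "\<bar>Re (clamp_box N z)\<bar> \<le> N" "\<bar>Im (clamp_box N z)\<bar> \<le> N"
    using assms by (auto simp: clamp_box_def)
  then show ?thesis
    using cmod_le[of "clamp_box N z"] by linarith
qed

lemma dominated_L1_L2:
  fixes f :: "'a::euclidean_space \<Rightarrow> complex"
  assumes [measurable]: "\<And>n. g n \<in> borel_measurable borel" "f \<in> borel_measurable borel"
    and w: "integrable lborel w" "integrable lborel (\<lambda>x. (w x)\<^sup>2)"
    and lim: "AE x in lborel. (\<lambda>n. g n x) \<longlonglongrightarrow> f x" and bd: "\<And>n x. cmod (g n x) \<le> w x" and e: "e > 0"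
  shows "\<exists>n. integrable lborel (g n) \<and> (\<integral>x. cmod (g n x - f x) \<partial>lborel) < e \<and> L2_norm (\<lambda>x. g n x - f x) < e"
proof -
  have gi: "integrable lborel (g n)" for n
    by (rule Bochner_Integration.integrable_bound[OF w(1)])
      (auto intro!: AE_I2 order_trans[OF bd])
  have fb: "AE x in lborel. cmod (f x) \<le> w x"
    using lim by eventually_elim (rule tendsto_upperbound[OF tendsto_norm], auto simp: bd)
  have "L2_tendsto g f sequentially"
    by (rule L2_tendsto_dominated_sequence[OF _ _ w(2) _ lim]) (auto simp: bd)
  then have "(\<lambda>n. L2_norm (\<lambda>x. g n x - f x)) \<longlonglongrightarrow> 0"
    by (rule L2_tendstoD)
  then have ev: "\<forall>\<^sub>F n in sequentially. L2_norm (\<lambda>x. g n x - f x) < e"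
    using e by (rule order_tendstoD)
  have "(\<lambda>n. \<integral>x. cmod (g n x - f x) \<partial>lborel) \<longlonglongrightarrow> (\<integral>x. 0 \<partial>(lborel::'a measure))"
  proof (rule integral_dominated_convergence[where w="\<lambda>x. 2 * w x"])
    show "AE x in lborel. (\<lambda>n. cmod (g n x - f x)) \<longlonglongrightarrow> 0"
      using lim by eventually_elim (auto intro: tendsto_norm_zero simp: LIM_zero_iff)
    show "AE x in lborel. norm (cmod (g n x - f x)) \<le> 2 * w x" for n
      using fb by eventually_elim
        (use norm_triangle_ineq4 bd in \<open>smt (verit, best) real_norm_def norm_ge_zero\<close>)
  qed (use w in auto)
  then have "\<forall>\<^sub>F n in sequentially. (\<integral>x. cmod (g n x - f x) \<partial>lborel) < e"
    using e by (intro order_tendstoD) auto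
  with ev have "\<forall>\<^sub>F n in sequentially. integrable lborel (g n) \<and>
      (\<integral>x. cmod (g n x - f x) \<partial>lborel) < e \<and> L2_norm (\<lambda>x. g n x - f x) < e"
    by eventually_elim (use gi in auto)
  then show ?thesis
    by (rule eventually_happens'[OF sequentially_bot])
qed

text \<open>
  Cut \<open>f\<close> off in its values and its argument; a measurable function is the almost everywhere limit
  of continuous functions, which can be clamped to the same range and multiplied by a continuous
  cutoff. Both steps are dominated, hence converge in \<open>L1\<close> and \<open>L2\<close> at once.
\<close>

lemma dense_continuous:
  fixes f :: "'a::euclidean_space \<Rightarrow> complex"
  assumes f: "integrable lborel f" "f \<in> L2" and e: "e > 0"
  obtains g M where "integrable lborel g" "continuous_on UNIV g" "\<And>x. cmod (g x) \<le> M"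
    "(\<integral>x. cmod (g x - f x) \<partial>lborel) < e" "L2_norm (\<lambda>x. g x - f x) < e"
proof -
  have [measurable]: "f \<in> borel_measurable borel"
    using f by (auto dest: borel_measurable_integrable)
  define T where "T n x = (if norm x \<le> real n \<and> cmod (f x) \<le> real n then f x else 0)" for n x
  have [measurable]: "T n \<in> borel_measurable borel" for n
    unfolding T_def by measurable
  have "\<exists>n. integrable lborel (T n) \<and> (\<integral>x. cmod (T n x - f x) \<partial>lborel) < e/2 \<and>
      L2_norm (\<lambda>x. T n x - f x) < e/2"
  proof (rule dominated_L1_L2)
    show "integrable lborel (\<lambda>x. cmod (f x))" "integrable lborel (\<lambda>x. (cmod (f x))\<^sup>2)"
      using f by (auto simp: L2_def)
    show "AE x in lborel. (\<lambda>n. T n x) \<longlonglongrightarrow> f x"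
    proof (rule AE_I2, rule tendsto_eventually)
      fix x
      obtain n0 :: nat where n0: "max (norm x) (cmod (f x)) \<le> real n0"
        using real_arch_simple by blast
      show "\<forall>\<^sub>F n in sequentially. T n x = f x"
        using eventually_ge_at_top[of n0] by eventually_elim (use n0 in \<open>auto simp: T_def\<close>)
    qed
  qed (use e in \<open>auto simp: T_def\<close>)
  then obtain N where N: "integrable lborel (T N)" "(\<integral>x. cmod (T N x - f x) \<partial>lborel) < e/2"
      "L2_norm (\<lambda>x. T N x - f x) < e/2"
    by blast
  let ?N = "real N"
  have "T N \<in> borel_measurable lebesgue"
    by (rule measurable_completion) simp
  then have "T N measurable_on UNIV"
    by (simp add: lebesgue_measurable_imp_measurable_on)
  then obtain Z h where Z: "negligible Z" and h: "\<And>n. continuous_on UNIV (h n)"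
    and hlim: "\<And>x. x \<notin> Z \<Longrightarrow> (\<lambda>n. h n x) \<longlonglongrightarrow> T N x"
    by (auto simp: measurable_on_def)
  define c :: "'a \<Rightarrow> real" where "c x = max 0 (min 1 (?N + 1 - norm x))" for x
  define g where "g n x = of_real (c x) * clamp_box ?N (h n x)" for n x
  have gc: "continuous_on UNIV (g n)" for n
    unfolding g_def c_def by (intro continuous_intros h)
  have [measurable]: "g n \<in> borel_measurable borel" for n
    by (rule borel_measurable_continuous_onI[OF gc])
  define w :: "'a \<Rightarrow> real" where "w x = 2 * ?N * indicator (cball 0 (?N + 1)) x" for x
  have gw: "cmod (g n x) \<le> w x" for n x
  proof -
    have "cmod (g n x) = c x * cmod (clamp_box ?N (h n x))"
      by (simp add: g_def norm_mult c_def)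
    also have "\<dots> \<le> c x * (2 * ?N)"
      by (intro mult_left_mono clamp_box_bound) (auto simp: c_def)
    also have "\<dots> \<le> indicator (cball 0 (?N + 1)) x * (2 * ?N)"
      by (intro mult_right_mono) (auto simp: c_def indicator_def)
    finally show ?thesis by (simp add: w_def mult.commute)
  qed
  have "\<exists>n. integrable lborel (g n) \<and> (\<integral>x. cmod (g n x - T N x) \<partial>lborel) < e/2 \<and>
      L2_norm (\<lambda>x. g n x - T N x) < e/2"
  proof (rule dominated_L1_L2[where w=w])
    have 1: "integrable lborel (indicator (cball (0::'a) (?N + 1)) :: 'a \<Rightarrow> real)"
      by (intro integrable_real_indicator emeasure_lborel_cball_finite) simp
    then show "integrable lborel w"
      unfolding w_def by auto
    have "(\<lambda>x. (w x)\<^sup>2) = (\<lambda>x. (2 * ?N)\<^sup>2 * indicator (cball 0 (?N + 1)) x)"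
      by (auto simp: w_def power_mult_distrib indicator_def fun_eq_iff)
    then show "integrable lborel (\<lambda>x. (w x)\<^sup>2)"
      using 1 by auto
    have "AE x in lborel. x \<notin> Z"
      using AE_not_in[OF Z[unfolded negligible_iff_null_sets]] by (simp only: AE_completion_iff)
    then show "AE x in lborel. (\<lambda>n. g n x) \<longlonglongrightarrow> T N x"
    proof eventually_elim
      case (elim x)
      have cl: "clamp_box ?N (T N x) = T N x"
        by (rule clamp_box_id) (auto simp: T_def)
      have "(\<lambda>n. g n x) \<longlonglongrightarrow> of_real (c x) * clamp_box ?N (T N x)"
        unfolding g_def
        by (intro tendsto_intros isCont_tendsto_compose[OF _ hlim[OF elim], of "clamp_box ?N"])
          (use continuous_clamp_box[of UNIV "\<lambda>x. x" ?N] in \<open>simp add: continuous_on_eq_continuous_at\<close>)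
      moreover have "of_real (c x) * T N x = T N x"
        by (auto simp: T_def c_def)
      ultimately show ?case by (simp add: cl)
    qed
  qed (use e gw in auto)
  then obtain n where n: "integrable lborel (g n)" "(\<integral>x. cmod (g n x - T N x) \<partial>lborel) < e/2"
      "L2_norm (\<lambda>x. g n x - T N x) < e/2"
    by blast
  have TL: "T N \<in> L2"
    by (rule L2_of_bounded[OF N(1), of ?N]) (auto simp: T_def)
  have gb: "cmod (g n x) \<le> 2 * ?N" for x
    using gw[of n x] by (cases "x \<in> cball 0 (?N + 1)") (auto simp: w_def)
  have gL: "g n \<in> L2"
    by (rule L2_of_bounded[OF n(1) gb])
  have "(\<integral>x. cmod (g n x - f x) \<partial>lborel) \<le> (\<integral>x. cmod (g n x - T N x) + cmod (T N x - f x) \<partial>lborel)"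
    using n N f by (intro integral_mono) (auto intro: norm_diff_triangle_le)
  also have "\<dots> = (\<integral>x. cmod (g n x - T N x) \<partial>lborel) + (\<integral>x. cmod (T N x - f x) \<partial>lborel)"
    using n N f by (intro Bochner_Integration.integral_add) auto
  finally have "(\<integral>x. cmod (g n x - f x) \<partial>lborel) < e"
    using n(2) N(2) by simp
  moreover have "L2_norm (\<lambda>x. g n x - f x) < e"
    using L2_norm_triangle_diff[OF gL TL f(2)] n(3) N(3) by simp
  ultimately show thesis
    by (rule that[OF n(1) gc gb])
qed

text \<open>
  Approximation in \<open>L1\<close> gives pointwise convergence of the transforms, approximation in \<open>L2\<close>
  convergence of the norms, and Fatou's lemma leaves an inequality.
\<close>

lemma ft_contraction:
  fixes f :: "'a::euclidean_space \<Rightarrow> complex"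
  assumes f: "integrable lborel f" "f \<in> L2"
  shows "ft f \<in> L2" "L2_norm (ft f) \<le> L2_norm f"
proof -
  have [measurable]: "f \<in> borel_measurable borel"
    using f by (auto dest: borel_measurable_integrable)
  have "\<exists>g. integrable lborel g \<and> g \<in> L2 \<and> ft g \<in> L2 \<and> L2_norm (ft g) = L2_norm g \<and>
      (\<integral>x. cmod (g x - f x) \<partial>lborel) < 1 / Suc n \<and> L2_norm (\<lambda>x. g x - f x) < 1 / Suc n" for n
  proof -
    have "0 < 1 / real (Suc n)" by simp
    from dense_continuous[OF f this] obtain g M where g: "integrable lborel g" "continuous_on UNIV g" "\<And>x. cmod (g x) \<le> M"
      "(\<integral>x. cmod (g x - f x) \<partial>lborel) < 1 / Suc n" "L2_norm (\<lambda>x. g x - f x) < 1 / Suc n"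
      by blast
    then show ?thesis
      using ft_isometry_continuous[OF g(1-3)] L2_of_bounded[OF g(1,3)] by blast
  qed
  then obtain g where g: "\<And>n. integrable lborel (g n)" "\<And>n. g n \<in> L2" "\<And>n. ft (g n) \<in> L2"
      "\<And>n. L2_norm (ft (g n)) = L2_norm (g n)"
      "\<And>n. (\<integral>x. cmod (g n x - f x) \<partial>lborel) < 1 / Suc n" "\<And>n. L2_norm (\<lambda>x. g n x - f x) < 1 / Suc n"
    by (elim exE[OF choice[OF allI]]) blast
  have [measurable]: "g n \<in> borel_measurable borel" for n
    using g(2) by (rule L2_measurable)
  have inv: "(\<lambda>n. 1 / real (Suc n)) \<longlonglongrightarrow> 0"
    by (rule LIMSEQ_Suc[OF lim_1_over_n])
  have lim: "(\<lambda>n. ft (g n) \<xi>) \<longlonglongrightarrow> ft f \<xi>" for \<xi>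
  proof (rule LIM_zero_cancel, rule Lim_null_comparison[OF _ inv], rule always_eventually, rule allI)
    fix n
    have "norm (ft (g n) \<xi> - ft f \<xi>) \<le> (\<integral>x. cmod (g n x - f x) \<partial>lborel)"
      unfolding ft_diff[OF g(1) f(1), symmetric] using g(1) f(1) by (intro ft_bound) auto
    then show "norm (ft (g n) \<xi> - ft f \<xi>) \<le> 1 / real (Suc n)"
      using g(5)[of n] by simp
  qed
  have "(\<lambda>n. L2_norm (\<lambda>x. g n x - f x)) \<longlonglongrightarrow> 0"
  proof (rule Lim_null_comparison[OF _ inv], rule always_eventually, rule allI)
    show "norm (L2_norm (\<lambda>x. g n x - f x)) \<le> 1 / real (Suc n)" for n
      using less_imp_le[OF g(6)[of n]] by (simp only: real_norm_def abs_of_nonneg L2_norm_nonneg)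
  qed
  then have "L2_tendsto g f sequentially"
    unfolding L2_tendsto_def using g(2) f(2) by simp
  then have nlim: "(\<lambda>n. L2_norm (g n)) \<longlonglongrightarrow> L2_norm f"
    by (rule L2_tendsto_norm)
  have "(\<integral>\<^sup>+\<xi>. ennreal ((cmod (ft f \<xi>))\<^sup>2) \<partial>lborel) = (\<integral>\<^sup>+\<xi>. liminf (\<lambda>n. ennreal ((cmod (ft (g n) \<xi>))\<^sup>2)) \<partial>lborel)"
  proof (rule nn_integral_cong)
    fix \<xi>
    have "(\<lambda>n. ennreal ((cmod (ft (g n) \<xi>))\<^sup>2)) \<longlonglongrightarrow> ennreal ((cmod (ft f \<xi>))\<^sup>2)"
      by (intro tendsto_ennrealI tendsto_intros lim)
    then show "ennreal ((cmod (ft f \<xi>))\<^sup>2) = liminf (\<lambda>n. ennreal ((cmod (ft (g n) \<xi>))\<^sup>2))"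
      using lim_imp_Liminf[OF trivial_limit_sequentially] by fastforce
  qed
  also have "\<dots> \<le> liminf (\<lambda>n. \<integral>\<^sup>+\<xi>. ennreal ((cmod (ft (g n) \<xi>))\<^sup>2) \<partial>lborel)"
    by (rule nn_integral_liminf) measurable
  also have "\<dots> = liminf (\<lambda>n. ennreal ((L2_norm (g n))\<^sup>2))"
    by (simp add: L2_nn_integral g)
  also have "\<dots> = ennreal ((L2_norm f)\<^sup>2)"
    by (rule lim_imp_Liminf) (auto intro!: tendsto_ennrealI tendsto_intros nlim)
  finally have le: "(\<integral>\<^sup>+\<xi>. ennreal ((cmod (ft f \<xi>))\<^sup>2) \<partial>lborel) \<le> ennreal ((L2_norm f)\<^sup>2)" .
  show "ft f \<in> L2" "L2_norm (ft f) \<le> L2_norm f"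
    by (rule L2_nn_integral_le[OF _ L2_norm_nonneg le]; simp)+
qed

text \<open>
  The missing inequality follows from the contraction property applied to the difference between
  \<open>f\<close> and an approximant for which equality is known.
\<close>

theorem ft_isometry:
  fixes f :: "'a::euclidean_space \<Rightarrow> complex"
  assumes f: "integrable lborel f" "f \<in> L2"
  shows "L2_norm (ft f) = L2_norm f"
proof (rule antisym[OF ft_contraction(2)[OF f]], rule field_le_epsilon)
  fix e :: real assume "e > 0"
  then have "e / 2 > 0" by simp
  from dense_continuous[OF f this] obtain g M where g: "integrable lborel g" "continuous_on UNIV g" "\<And>x. cmod (g x) \<le> M"
    "L2_norm (\<lambda>x. g x - f x) < e/2"
    by blast
  have gL: "g \<in> L2" by (rule L2_of_bounded[OF g(1,3)])
  note gi = ft_isometry_continuous[OF g(1-3)]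
  have "L2_norm (\<lambda>\<xi>. ft g \<xi> - ft f \<xi>) \<le> L2_norm (\<lambda>x. g x - f x)"
    unfolding ft_diff[OF g(1) f(1), symmetric]
    by (rule ft_contraction) (use g(1) f gL in \<open>auto intro: L2_diff\<close>)
  then show "L2_norm f \<le> L2_norm (ft f) + e"
    using L2_norm_diff_triangle[OF gi(1) ft_contraction(1)[OF f]] L2_norm_diff_triangle[OF gL f(2)] gi(2) g(4)
    by linarith
qed

section \<open>The Fourier transform on square integrable functions\<close>

abbreviation trunc :: "nat \<Rightarrow> ('a::euclidean_space \<Rightarrow> complex) \<Rightarrow> 'a \<Rightarrow> complex" where
  "trunc n f \<equiv> (\<lambda>y. indicator (cball 0 (real n)) y * f y)"

text \<open>
  The limit in the definition of \<open>fourier\<close> as a relation, so that uniqueness almost everywhere,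
  linearity and isometry can be stated without a choice of representative.
\<close>

definition has_fourier :: "('a::euclidean_space \<Rightarrow> complex) \<Rightarrow> ('a \<Rightarrow> complex) \<Rightarrow> bool" where
  "has_fourier f g \<longleftrightarrow> L2_tendsto (\<lambda>n. ft (trunc n f)) g sequentially"

lemma indicator_cball_L2: "indicator (cball (0::'a::euclidean_space) r) \<in> L2"
proof -
  have "integrable lborel (indicator (cball (0::'a) r) :: 'a \<Rightarrow> real)"
    by (intro integrable_real_indicator emeasure_lborel_cball_finite) simp
  moreover have "(cmod (indicator (cball (0::'a) r) x))\<^sup>2 = indicator (cball 0 r) x" for x
    by (simp add: indicator_def)
  ultimately show ?thesis by (simp add: L2_def borel_measurable_indicator)
qed

lemma
  fixes f :: "'a::euclidean_space \<Rightarrow> complex"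
  assumes "f \<in> L2"
  shows trunc_integrable: "integrable lborel (trunc n f)"
    and trunc_tendsto: "L2_tendsto (\<lambda>n. trunc n f) f sequentially"
    and trunc_L2: "trunc n f \<in> L2"
proof -
  have [measurable]: "f \<in> borel_measurable borel"
    using assms by (rule L2_measurable)
  have [measurable]: "(indicator (cball 0 (real n)) :: 'a \<Rightarrow> complex) \<in> borel_measurable borel" for n
    by (rule L2_measurable[OF indicator_cball_L2])
  show "integrable lborel (trunc n f)"
    by (intro L2_integrable_mult indicator_cball_L2 assms)
  have bd: "cmod (trunc n f x) \<le> cmod (f x)" for n x
    by (simp add: norm_mult indicator_def)
  show "trunc n f \<in> L2"
    by (rule L2_dominated[OF _ L2_integrable[OF assms]]) (use bd in auto)
  show "L2_tendsto (\<lambda>n. trunc n f) f sequentially"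
  proof (rule L2_tendsto_dominated_sequence[OF _ _ L2_integrable[OF assms]])
    show "AE x in lborel. (\<lambda>i. trunc i f x) \<longlonglongrightarrow> f x"
    proof (rule AE_I2, rule tendsto_eventually)
      fix x :: 'a
      obtain n0 :: nat where n0: "norm x \<le> real n0"
        using real_arch_simple by blast
      show "\<forall>\<^sub>F n in sequentially. trunc n f x = f x"
        using eventually_ge_at_top[of n0] by eventually_elim (use n0 in auto)
    qed
  qed (use bd in auto)
qed

lemma L2_tendsto_Cauchy:
  assumes "L2_tendsto F f sequentially" "e > 0"
  shows "\<exists>N. \<forall>m\<ge>N. \<forall>n\<ge>N. L2_norm (\<lambda>x. F m x - F n x) \<le> e"
proof -
  note f = L2_tendstoD[OF assms(1)]
  have "\<forall>\<^sub>F n in sequentially. L2_norm (\<lambda>x. F n x - f x) < e / 2"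
    using order_tendstoD(2)[OF f(3), of "e/2"] assms(2) by simp
  with f(2) have "\<forall>\<^sub>F n in sequentially. F n \<in> L2 \<and> L2_norm (\<lambda>x. F n x - f x) < e / 2"
    by eventually_elim simp
  then obtain N where N: "\<And>n. n \<ge> N \<Longrightarrow> F n \<in> L2 \<and> L2_norm (\<lambda>x. F n x - f x) < e / 2"
    by (auto simp: eventually_sequentially)
  have "L2_norm (\<lambda>x. F m x - F n x) \<le> e" if "m \<ge> N" "n \<ge> N" for m n
    using L2_norm_triangle_diff[of "F m" f "F n"] N[OF that(1)] N[OF that(2)] f(1)
      L2_norm_minus_commute[of f "F n"] by simp
  then show ?thesis by blast
qed

lemma L2_tendsto_isometry:
  assumes "L2_tendsto F f sequentially"
    and "\<And>n. G n \<in> L2" "\<And>m n. L2_norm (\<lambda>x. G m x - G n x) = L2_norm (\<lambda>x. F m x - F n x)"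
  obtains g where "L2_tendsto G g sequentially"
proof (rule L2_complete[of G])
  show "\<exists>N. \<forall>m\<ge>N. \<forall>n\<ge>N. L2_norm (\<lambda>x. G m x - G n x) \<le> e" if "e > 0" for e
    unfolding assms(3) by (rule L2_tendsto_Cauchy[OF assms(1) that])
qed (rule assms(2), erule that)

lemma ft_trunc_isometry:
  assumes "f \<in> L2"
  shows "L2_norm (\<lambda>x. ft (trunc m f) x - ft (trunc n f) x) = L2_norm (\<lambda>x. trunc m f x - trunc n f x)"
  unfolding ft_diff[OF trunc_integrable trunc_integrable, OF assms assms, symmetric]
  by (intro ft_isometry Bochner_Integration.integrable_diff L2_diff trunc_integrable trunc_L2 assms)

lemma has_fourier_exists:
  assumes "f \<in> L2"
  obtains g where "has_fourier f g"
  by (rule L2_tendsto_isometry[OF trunc_tendsto[OF assms] ft_contraction(1)[OF trunc_integrable trunc_L2, OF assms assms]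
      ft_trunc_isometry[OF assms]], rule that, simp only: has_fourier_def)

lemma has_fourier_L2: "has_fourier f g \<Longrightarrow> g \<in> L2"
  by (simp add: has_fourier_def L2_tendsto_def)

lemma has_fourier_norm:
  assumes "has_fourier f g" "f \<in> L2"
  shows "L2_norm g = L2_norm f"
proof -
  have "(\<lambda>n. L2_norm (ft (trunc n f))) \<longlonglongrightarrow> L2_norm g"
    using L2_tendsto_norm assms(1) unfolding has_fourier_def by blast
  moreover have "L2_norm (ft (trunc n f)) = L2_norm (trunc n f)" for n
    by (intro ft_isometry trunc_integrable trunc_L2 assms)
  ultimately show ?thesis
    using L2_tendsto_norm[OF trunc_tendsto[OF assms(2)]] LIMSEQ_unique by simp
qed

lemma has_fourier_lincomb:
  assumes f1: "has_fourier f1 g1" "f1 \<in> L2" and f2: "has_fourier f2 g2" "f2 \<in> L2"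
  shows "has_fourier (\<lambda>x. a * f1 x + b * f2 x) (\<lambda>x. a * g1 x + b * g2 x)"
proof -
  have "ft (trunc n (\<lambda>x. a * f1 x + b * f2 x)) = (\<lambda>x. a * ft (trunc n f1) x + b * ft (trunc n f2) x)" for n
  proof
    fix x
    have "trunc n (\<lambda>x. a * f1 x + b * f2 x) = (\<lambda>x. a * trunc n f1 x + b * trunc n f2 x)"
      by (auto simp: algebra_simps)
    then show "ft (trunc n (\<lambda>x. a * f1 x + b * f2 x)) x = a * ft (trunc n f1) x + b * ft (trunc n f2) x"
      by (simp only: ft_add integrable_mult_right trunc_integrable f1 f2 ft_cmult)
  qed
  then show ?thesis
    using f1 f2 unfolding has_fourier_def by (auto intro: L2_tendsto_add L2_tendsto_cmult)
qed

lemma has_fourier_unique: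
  assumes "has_fourier f g" "has_fourier f h"
  shows "AE x in lborel. g x = h x"
  using L2_tendsto_unique assms sequentially_bot unfolding has_fourier_def by blast

lemma L2_norm_diff_power2:
  assumes "f \<in> L2" "g \<in> L2"
  shows "(L2_norm (\<lambda>x. f x - g x))\<^sup>2 = (L2_norm f)\<^sup>2 + (L2_norm g)\<^sup>2 - 2 * Re (\<integral>x. f x * cnj (g x) \<partial>lborel)"
proof -
  have cg: "(\<lambda>x. cnj (g x)) \<in> L2"
    using assms(2) by (auto simp: L2_def)
  note fg = L2_integrable_mult[OF assms(1) cg]
  define c where "c x = Re (f x * cnj (g x))" for x
  have pt: "(cmod (f x - g x))\<^sup>2 = (cmod (f x))\<^sup>2 + (cmod (g x))\<^sup>2 - 2 * c x" for x
    by (simp add: c_def cmod_power2) (simp add: power2_eq_square algebra_simps)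
  have c: "integrable lborel c" "(\<integral>x. c x \<partial>lborel) = Re (\<integral>x. f x * cnj (g x) \<partial>lborel)"
    unfolding c_def using integrable_Re[OF fg] integral_Re[OF fg] by auto
  show ?thesis
    unfolding L2_norm_power2 pt c(2)[symmetric]
    using L2_integrable[OF assms(1)] L2_integrable[OF assms(2)] c(1)
    by simp
qed

text \<open>
  Let \<open>f\<close> be the inverse transform of \<open>g\<close>. The adjoint relation gives
  \<open>\<langle>ft (trunc n f), g\<rangle> = \<parallel>trunc n f\<parallel>\<^sup>2\<close>, and since \<open>ft\<close> preserves norms the distance
  \<open>\<parallel>ft (trunc n f) - g\<parallel>\<^sup>2\<close> equals \<open>\<parallel>g\<parallel>\<^sup>2 - \<parallel>trunc n f\<parallel>\<^sup>2\<close>. This tends to 0 because the inverse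
  transform preserves norms as well: an isometry whose adjoint is an isometry is onto.
\<close>

lemma has_fourier_surj_integrable:
  assumes g: "integrable lborel g" "g \<in> L2"
  obtains f where "f \<in> L2" "has_fourier f g"
proof -
  have [measurable]: "g \<in> borel_measurable borel"
    using g by (auto dest: borel_measurable_integrable)
  have cg: "integrable lborel (\<lambda>x. cnj (g x))" "(\<lambda>x. cnj (g x)) \<in> L2"
    using g by (auto simp: L2_def)
  define f where "f x = cnj (ft (\<lambda>x. cnj (g x)) x)" for x
  have fL: "f \<in> L2" and fn: "L2_norm f = L2_norm g"
    using ft_contraction(1)[OF cg] ft_isometry[OF cg]
    unfolding f_def[abs_def] by (auto simp: L2_def L2_norm_def)
  have eq: "(L2_norm (\<lambda>\<xi>. ft (trunc n f) \<xi> - g \<xi>))\<^sup>2 = (L2_norm g)\<^sup>2 - (L2_norm (trunc n f))\<^sup>2" for n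
  proof -
    note ti = trunc_integrable[OF fL, of n] and tL = trunc_L2[OF fL, of n]
    have "(\<integral>\<xi>. ft (trunc n f) \<xi> * cnj (g \<xi>) \<partial>lborel) = (\<integral>x. trunc n f x * ft (\<lambda>\<xi>. cnj (g \<xi>)) x \<partial>lborel)"
      by (rule ft_multiplication[OF ti cg(1)])
    also have "\<dots> = (\<integral>x. complex_of_real ((cmod (trunc n f x))\<^sup>2) \<partial>lborel)"
      by (intro Bochner_Integration.integral_cong refl)
         (simp only: complex_norm_square, simp add: f_def indicator_def)
    also have "\<dots> = of_real ((L2_norm (trunc n f))\<^sup>2)"
      by (simp only: integral_complex_of_real L2_norm_power2)
    finally show ?thesis
      using L2_norm_diff_power2[OF ft_contraction(1)[OF ti tL] g(2)] ft_isometry[OF ti tL] by simp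
  qed
  have "(\<lambda>n. sqrt ((L2_norm g)\<^sup>2 - (L2_norm (trunc n f))\<^sup>2)) \<longlonglongrightarrow> sqrt ((L2_norm g)\<^sup>2 - (L2_norm f)\<^sup>2)"
    by (intro tendsto_intros L2_tendsto_norm trunc_tendsto fL)
  then have "(\<lambda>n. L2_norm (\<lambda>\<xi>. ft (trunc n f) \<xi> - g \<xi>)) \<longlonglongrightarrow> 0"
    unfolding eq[symmetric] by (simp add: fn)
  then have "has_fourier f g"
    unfolding has_fourier_def L2_tendsto_def
    using g ft_contraction(1)[OF trunc_integrable trunc_L2, OF fL fL] by simp
  then show thesis using fL by (rule that[rotated])
qed

lemma L2_tendsto_cong_AE:
  assumes "L2_tendsto F f net" and g: "g \<in> borel_measurable borel" and ae: "AE x in lborel. f x = g x"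
  shows "L2_tendsto F g net"
proof -
  note f = L2_tendstoD[OF assms(1)]
  have "\<forall>\<^sub>F i in net. L2_norm (\<lambda>x. F i x - f x) = L2_norm (\<lambda>x. F i x - g x)"
    using f(2)
  proof eventually_elim
    case (elim i)
    then show ?case
      by (intro L2_norm_cong_AE)
        (use L2_measurable[OF elim] L2_measurable[OF f(1)] g ae in auto)
  qed
  then show ?thesis
    using f g L2_cong_AE[OF f(1) g ae] tendsto_cong by (fastforce simp: L2_tendsto_def)
qed

text \<open>
  Preimages of the truncations of \<open>g\<close> form a Cauchy sequence by isometry; its limit is a preimage
  of \<open>g\<close>.
\<close>

theorem has_fourier_surj:
  assumes g: "g \<in> L2"
  obtains f where "f \<in> L2" "has_fourier f g"
proof -
  have "\<exists>f. f \<in> L2 \<and> has_fourier f (trunc n g)" for n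
    by (rule has_fourier_surj_integrable[OF trunc_integrable trunc_L2, OF g g]) blast
  then obtain F where F: "\<And>n. F n \<in> L2" "\<And>n. has_fourier (F n) (trunc n g)"
    by (elim exE[OF choice[OF allI]]) blast
  have iso: "L2_norm (\<lambda>x. F m x - F n x) = L2_norm (\<lambda>x. trunc m g x - trunc n g x)" for m n
    using has_fourier_norm[OF has_fourier_lincomb[OF F(2,1)[of m] F(2,1)[of n], of 1 "-1"]]
      L2_diff[OF F(1) F(1), of m n] by simp
  obtain f where f: "L2_tendsto F f sequentially"
    by (rule L2_tendsto_isometry[OF trunc_tendsto[OF g] F(1) iso])
  note fL = L2_tendstoD[OF f]
  obtain h where h: "has_fourier f h"
    using has_fourier_exists[OF fL(1)] .
  have "L2_norm (\<lambda>x. trunc n g x - h x) = L2_norm (\<lambda>x. F n x - f x)" for n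
    using has_fourier_norm[OF has_fourier_lincomb[OF F(2,1)[of n] h fL(1), of 1 "-1"]]
      L2_diff[OF F(1) fL(1), of n] by simp
  then have "L2_tendsto (\<lambda>n. trunc n g) h sequentially"
    using fL has_fourier_L2[OF h] trunc_L2[OF g] by (simp add: L2_tendsto_def)
  then have "AE x in lborel. h x = g x"
    using L2_tendsto_unique trunc_tendsto[OF g] sequentially_bot by blast
  then have "has_fourier f g"
    using L2_tendsto_cong_AE[OF _ L2_measurable[OF g]] h unfolding has_fourier_def by blast
  with fL(1) show thesis by (rule that)
qed

lemma fourier_integral_eq_ft:
  fixes f :: "(real^'d) \<times> real \<Rightarrow> complex"
  shows "fourier_integral f = ft f"
proof
  fix \<omega> :: "(real^'d) \<times> real"
  obtain \<xi> \<tau> where \<omega>: "\<omega> = (\<xi>, \<tau>)" by (cases \<omega>)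
  show "fourier_integral f \<omega> = ft f \<omega>"
    unfolding \<omega> fourier_integral_def ft_def prod.case
  proof (intro Bochner_Integration.integral_cong refl)
    fix y :: "(real^'d) \<times> real"
    obtain x t where y: "y = (x, t)" by (cases y)
    have "- (2 * of_real pi * \<i> * of_real (\<tau> * t + \<xi> \<bullet> x)) = \<i> * of_real (- (2 * pi * ((\<xi>, \<tau>) \<bullet> (x, t))))"
      by (simp add: algebra_simps)
    then show "(case y of (x, t) \<Rightarrow> exp (- (2 * of_real pi * \<i> * of_real (\<tau> * t + \<xi> \<bullet> x))) * f (x, t)) =
        cis (- (2 * pi * ((\<xi>, \<tau>) \<bullet> y))) * f y"
      unfolding y prod.case cis_conv_exp by (simp only:)
  qed
qed

lemma has_fourier_fourier:
  fixes u :: "(real^'d) \<times> real \<Rightarrow> complex"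
  assumes "u \<in> L2"
  shows "has_fourier u (fourier u)"
proof -
  have "\<exists>g. has_fourier u g"
    by (rule has_fourier_exists[OF assms]) blast
  then show ?thesis
    unfolding fourier_def has_fourier_def fourier_integral_eq_ft by (rule someI_ex)
qed

lemma fourier_L2: "u \<in> L2 \<Longrightarrow> fourier u \<in> L2"
  by (rule has_fourier_L2[OF has_fourier_fourier])

lemma inv_fourier:
  fixes g :: "(real^'d) \<times> real \<Rightarrow> complex"
  assumes "g \<in> L2"
  shows "inv_fourier g \<in> L2" and "has_fourier (inv_fourier g) g"
proof -
  obtain f where f: "f \<in> L2" "has_fourier f g"
    using has_fourier_surj[OF assms] .
  have "AE \<omega> in lborel. fourier f \<omega> = g \<omega>"
    by (rule has_fourier_unique[OF has_fourier_fourier[OF f(1)] f(2)])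
  with f(1) have "inv_fourier g \<in> L2 \<and> (AE \<omega> in lborel. fourier (inv_fourier g) \<omega> = g \<omega>)"
    unfolding inv_fourier_def by (intro someI[of "\<lambda>f. f \<in> L2 \<and> _ f"]) auto
  then show L: "inv_fourier g \<in> L2" and "has_fourier (inv_fourier g) g"
    using L2_tendsto_cong_AE[OF _ L2_measurable[OF assms]] has_fourier_fourier[of "inv_fourier g"]
    unfolding has_fourier_def by blast+
qed

text \<open>
  Plancherel in the form in which it is used: distances between the functions \<open>U z\<close>, their
  difference quotients and the limit are computed on the Fourier side.
\<close>

lemma inv_fourier_lincomb_norm:
  assumes "g1 \<in> L2" "g2 \<in> L2" "h \<in> L2"
  shows "L2_norm (\<lambda>x. a * inv_fourier g1 x + b * inv_fourier g2 x - inv_fourier h x) =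
    L2_norm (\<lambda>x. a * g1 x + b * g2 x - h x)"
proof -
  let ?f = "\<lambda>x. a * inv_fourier g1 x + b * inv_fourier g2 x"
  let ?g = "\<lambda>x. a * g1 x + b * g2 x"
  have f: "has_fourier ?f ?g" "?f \<in> L2"
    by (intro has_fourier_lincomb L2_add L2_cmult inv_fourier assms)+
  have "has_fourier (\<lambda>x. 1 * ?f x + (-1) * inv_fourier h x) (\<lambda>x. 1 * ?g x + (-1) * h x)"
    by (intro has_fourier_lincomb f inv_fourier assms)
  then have "L2_norm (\<lambda>x. 1 * ?f x + (-1) * inv_fourier h x) = L2_norm (\<lambda>x. 1 * ?g x + (-1) * h x)"
    by (rule has_fourier_norm[symmetric]) (intro L2_add L2_cmult f inv_fourier assms)
  then show ?thesis
    by simp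
qed

section \<open>Power series of the Bessel functions\<close>

text \<open>
  The entire function with \<open>bessel_I \<nu> w = (w / 2) powr \<nu> * bessel_series \<nu> (w\<^sup>2 / 4)\<close>. The argument
  \<open>w\<^sup>2 / 4\<close> is real on both rays that occur, positive on the real axis and negative on the imaginary
  axis, so one real power series serves both.
\<close>

definition bessel_series :: "real \<Rightarrow> real \<Rightarrow> real" where
  "bessel_series \<nu> x = (\<Sum>k. rGamma (\<nu> + real k + 1) / fact k * x ^ k)"

text \<open>
  By the functional equation the values decrease in \<open>k\<close> from \<open>k = 1\<close> on, when the factors
  \<open>\<nu> + k + 1\<close> exceed 1.
\<close>

lemma rGamma_bounded:
  assumes "\<nu> > -1"
  shows "\<exists>C>0::real. \<forall>k. \<bar>rGamma (\<nu> + real k + 1)\<bar> \<le> C"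
proof -
  define a where "a k = \<bar>rGamma (\<nu> + real k + 1)\<bar>" for k
  have step: "a (Suc k) \<le> a k" if "k \<ge> 1" for k
  proof -
    have "rGamma (\<nu> + real k + 1) = (\<nu> + real k + 1) * rGamma (\<nu> + real (Suc k) + 1)"
      using rGamma_plus1[of "\<nu> + real k + 1"] by (simp add: algebra_simps)
    then have "a k = (\<nu> + real k + 1) * a (Suc k)"
      using assms by (simp add: a_def abs_mult)
    moreover have "1 * a (Suc k) \<le> (\<nu> + real k + 1) * a (Suc k)"
      using assms that by (intro mult_right_mono) (auto simp: a_def)
    ultimately show ?thesis by simp
  qed
  have "a (Suc k) \<le> a 1" for k
    by (induction k) (use step in \<open>auto intro: order_trans\<close>)
  then have "a k \<le> 1 + a 0 + a 1" for k
    by (cases k) (auto simp: a_def intro: order_trans add_increasing)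
  moreover have "0 < 1 + a 0 + a 1"
    by (simp add: a_def add_pos_nonneg)
  ultimately show ?thesis
    by (intro exI[of _ "1 + a 0 + a 1"]) (auto simp: a_def)
qed

lemma summable_bessel_series:
  assumes "\<nu> > -1"
  shows "summable (\<lambda>k. rGamma (\<nu> + real k + 1) / fact k * x ^ k)"
proof -
  obtain C where C: "C > 0" "\<And>k. \<bar>rGamma (\<nu> + real k + 1)\<bar> \<le> C"
    using rGamma_bounded[OF assms] by blast
  have le: "norm (rGamma (\<nu> + real k + 1) / fact k * x ^ k) \<le> C * (inverse (fact k) * \<bar>x\<bar> ^ k)" for k
    using mult_right_mono[OF C(2)[of k], of "inverse (fact k) * \<bar>x\<bar> ^ k"]
    by (simp add: abs_mult power_abs divide_inverse mult.assoc)
  have "summable (\<lambda>k. C * (inverse (fact k) * \<bar>x\<bar> ^ k))"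
    by (intro summable_mult summable_exp)
  then show ?thesis
    by (rule summable_comparison_test'[where N=0]) (rule le)
qed

lemma bessel_series_deriv:
  assumes "\<nu> > -1"
  shows "(bessel_series \<nu> has_real_derivative bessel_series (\<nu> + 1) x) (at x)"
proof -
  let ?c = "\<lambda>k. rGamma (\<nu> + real k + 1) / fact k :: real"
  have "((\<lambda>x. \<Sum>k. ?c k * x ^ k) has_real_derivative (\<Sum>k. diffs ?c k * x ^ k)) (at x)"
    by (rule termdiffs_strong_converges_everywhere) (rule summable_bessel_series[OF assms])
  moreover have "diffs ?c k = rGamma (\<nu> + 1 + real k + 1) / fact k" for k
  proof -
    have "diffs ?c k = (1 + real k) / fact (Suc k) * rGamma (\<nu> + 1 + real k + 1)"
      by (simp add: diffs_def add_ac)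
    moreover have "(1 + real k) / fact (Suc k) = 1 / fact k"
      unfolding fact_Suc of_nat_Suc by (rule nonzero_divide_mult_cancel_left) simp
    ultimately show ?thesis by simp
  qed
  ultimately show ?thesis
    by (simp add: bessel_series_def[abs_def])
qed

text \<open>
  The contiguous relation. Its role here is to show that \<open>\<rho> powr \<nu> * bessel_series \<nu>\<close>
  has derivative \<open>\<rho> powr (\<nu> - 1) * bessel_series (\<nu> - 1)\<close>.
\<close>

lemma bessel_series_recurrence:
  assumes "\<nu> > 0"
  shows "bessel_series (\<nu> - 1) x = \<nu> * bessel_series \<nu> x + x * bessel_series (\<nu> + 1) x"
proof -
  have s: "summable (\<lambda>k. rGamma (\<nu> + real k + 1) / fact k * x ^ k)"
     "summable (\<lambda>k. rGamma (\<nu> + 1 + real k + 1) / fact k * x ^ k)"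
    by (rule summable_bessel_series; use assms in simp)+
  define b where "b k = real k * (rGamma (\<nu> + real k + 1) / fact k) * x ^ k" for k
  have bS: "b (Suc k) = x * (rGamma (\<nu> + 1 + real k + 1) / fact k * x ^ k)" for k
  proof -
    have "b (Suc k) = (1 + real k) / fact (Suc k) * rGamma (\<nu> + 1 + real k + 1) * (x * x ^ k)"
      by (simp add: b_def add_ac)
    moreover have "(1 + real k) / fact (Suc k) = 1 / fact k"
      unfolding fact_Suc of_nat_Suc by (rule nonzero_divide_mult_cancel_left) simp
    ultimately show ?thesis by simp
  qed
  have "(\<lambda>k. x * (rGamma (\<nu> + 1 + real k + 1) / fact k * x ^ k)) sums (x * bessel_series (\<nu> + 1) x)"
    unfolding bessel_series_def by (intro sums_mult summable_sums s)
  then have "(\<lambda>k. b (Suc k)) sums (x * bessel_series (\<nu> + 1) x)"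
    by (simp only: bS)
  then have "b sums (x * bessel_series (\<nu> + 1) x)"
    by (subst (asm) sums_Suc_iff) (simp add: b_def)
  moreover have "(\<lambda>k. \<nu> * (rGamma (\<nu> + real k + 1) / fact k * x ^ k)) sums (\<nu> * bessel_series \<nu> x)"
    unfolding bessel_series_def by (intro sums_mult summable_sums s)
  ultimately have "(\<lambda>k. \<nu> * (rGamma (\<nu> + real k + 1) / fact k * x ^ k) + b k) sums
      (\<nu> * bessel_series \<nu> x + x * bessel_series (\<nu> + 1) x)"
    by (intro sums_add)
  moreover have "\<nu> * (rGamma (\<nu> + real k + 1) / fact k * x ^ k) + b k =
      rGamma (\<nu> - 1 + real k + 1) / fact k * x ^ k" for k
  proof -
    have "rGamma (\<nu> - 1 + real k + 1) = (\<nu> + real k) * rGamma (\<nu> + real k + 1)"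
      using rGamma_plus1[of "\<nu> + real k"] by simp
    then show ?thesis
      by (simp only: b_def distrib_right times_divide_eq_right times_divide_eq_left add_divide_distrib mult.assoc)
  qed
  ultimately show ?thesis
    unfolding bessel_series_def[of "\<nu> - 1"] by (simp add: sums_iff)
qed

lemma continuous_bessel_series: "\<nu> > -1 \<Longrightarrow> continuous_on A (bessel_series \<nu>)"
  using bessel_series_deriv DERIV_isCont by (blast intro: continuous_at_imp_continuous_on)

lemma bessel_series_measurable: "\<nu> > -1 \<Longrightarrow> bessel_series \<nu> \<in> borel_measurable borel"
  by (intro borel_measurable_continuous_onI continuous_bessel_series)

lemma bessel_series_0: "bessel_series \<nu> 0 = rGamma (\<nu> + 1)"
  unfolding bessel_series_def by (subst suminf_finite[of "{0}"]) auto

text \<open>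
  The solution with exponent \<open>s\<close> at 0 of \<open>\<rho> y'' + (1 - s) y' = \<sigma> y\<close>; the solution with exponent 0 is
  \<open>bessel_series (- s) (\<sigma> * \<rho>)\<close>.
\<close>

definition frobenius :: "real \<Rightarrow> real \<Rightarrow> real \<Rightarrow> real" where
  "frobenius \<sigma> s \<rho> = \<rho> powr s * bessel_series s (\<sigma> * \<rho>)"

text \<open>
  Differentiation exchanges the two kinds of solutions and replaces \<open>s\<close> by \<open>1 - s\<close>. This and the
  next lemma are the duality on which everything below rests.
\<close>

lemma regular_solution_deriv:
  assumes "0 < s" "s < 1" "\<rho> > 0"
  shows "((\<lambda>\<rho>. bessel_series (- s) (\<sigma> * \<rho>)) has_real_derivative
    \<sigma> * \<rho> powr (s - 1) * frobenius \<sigma> (1 - s) \<rho>) (at \<rho>)"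
proof -
  have d: "((\<lambda>\<rho>. bessel_series (- s) (\<sigma> * \<rho>)) has_real_derivative
      bessel_series (- s + 1) (\<sigma> * \<rho>) * (\<sigma> * 1)) (at \<rho>)"
    by (intro DERIV_chain2[of "bessel_series (- s)"] bessel_series_deriv DERIV_cmult DERIV_ident)
      (use assms in auto)
  have "\<rho> powr (s - 1) * \<rho> powr (1 - s) = 1"
    using assms by (simp add: powr_add[symmetric])
  then have eq: "bessel_series (- s + 1) (\<sigma> * \<rho>) * (\<sigma> * 1) = \<sigma> * \<rho> powr (s - 1) * frobenius \<sigma> (1 - s) \<rho>"
    unfolding frobenius_def by (simp add: mult.assoc[symmetric])
  show ?thesis using d unfolding eq .
qed

lemma frobenius_deriv:
  assumes "0 < s" "\<rho> > 0"
  shows "(frobenius \<sigma> s has_real_derivative \<rho> powr (s - 1) * bessel_series (s - 1) (\<sigma> * \<rho>)) (at \<rho>)"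
proof -
  have "((\<lambda>\<rho>. \<rho> powr s * bessel_series s (\<sigma> * \<rho>)) has_real_derivative
      (s * \<rho> powr (s - 1)) * bessel_series s (\<sigma> * \<rho>) +
      (bessel_series (s + 1) (\<sigma> * \<rho>) * (\<sigma> * 1)) * \<rho> powr s) (at \<rho>)"
    by (intro DERIV_mult DERIV_chain2[of "bessel_series s"] bessel_series_deriv DERIV_cmult DERIV_ident
       has_real_derivative_powr) (use assms in auto)
  moreover have "\<rho> powr s = \<rho> powr (s - 1) * \<rho>"
    using assms by (simp add: powr_diff)
  then have "(s * \<rho> powr (s - 1)) * bessel_series s (\<sigma> * \<rho>) +
      (bessel_series (s + 1) (\<sigma> * \<rho>) * (\<sigma> * 1)) * \<rho> powr s =
      \<rho> powr (s - 1) * bessel_series (s - 1) (\<sigma> * \<rho>)"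
    unfolding bessel_series_recurrence[OF assms(1)] by (simp add: algebra_simps)
  ultimately show ?thesis by (simp add: frobenius_def[abs_def])
qed

section \<open>The elliptic side: a Laplace integral\<close>

text \<open>
  An energy argument that starts at the singular point 0: the coefficients \<open>\<rho> powr (s - 1)\<close> and
  \<open>\<rho> powr (- s)\<close> are integrable there, so \<open>F\<^sup>2 + G\<^sup>2\<close> times the exponential of minus their primitive
  is decreasing with limit 0.
\<close>

lemma dual_system_unique:
  fixes F G :: "real \<Rightarrow> real"
  assumes s: "0 < s" "s < 1"
    and F: "\<And>\<rho>. \<rho> > 0 \<Longrightarrow> (F has_real_derivative - (\<rho> powr (s - 1)) * G \<rho>) (at \<rho>)"
    and G: "\<And>\<rho>. \<rho> > 0 \<Longrightarrow> (G has_real_derivative - (\<rho> powr (- s)) * F \<rho>) (at \<rho>)"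
    and F0: "(F \<longlongrightarrow> 0) (at_right 0)" and G0: "(G \<longlongrightarrow> 0) (at_right 0)"
    and \<rho>: "\<rho> > 0"
  shows "F \<rho> = 0"
proof -
  define A where "A \<rho> = \<rho> powr s / s + \<rho> powr (1 - s) / (1 - s)" for \<rho>
  define N where "N \<rho> = ((F \<rho>)\<^sup>2 + (G \<rho>)\<^sup>2) * exp (- A \<rho>)" for \<rho>
  have dA: "(A has_real_derivative (\<rho> powr (s - 1) + \<rho> powr (- s))) (at \<rho>)" if "\<rho> > 0" for \<rho>
    unfolding A_def[abs_def] using that s
    by (auto intro!: derivative_eq_intros has_real_derivative_powr)
  have dN: "\<exists>D. (N has_real_derivative D) (at \<rho>) \<and> D \<le> 0" if "\<rho> > 0" for \<rho>
  proof -
    let ?f = "F \<rho>" and ?g = "G \<rho>" and ?k = "\<rho> powr (s - 1) + \<rho> powr (- s)"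
    have "(N has_real_derivative - ?k * (?f + ?g)\<^sup>2 * exp (- A \<rho>)) (at \<rho>)"
      unfolding N_def[abs_def]
      by (rule derivative_eq_intros F G dA that refl)+
        (simp add: power2_eq_square algebra_simps)
    moreover have "- ?k * (?f + ?g)\<^sup>2 * exp (- A \<rho>) \<le> 0"
      using powr_ge_zero[of \<rho> "s - 1"] powr_ge_zero[of \<rho> "- s"]
      by (intro mult_nonpos_nonneg zero_le_power2 exp_ge_zero) linarith
    ultimately show ?thesis by blast
  qed
  have mono: "N \<rho> \<le> N \<delta>" if "0 < \<delta>" "\<delta> \<le> \<rho>" for \<delta>
    by (rule DERIV_nonpos_imp_nonincreasing[OF that(2)]) (use dN that in auto)
  have "((\<lambda>\<delta>. (F \<delta>)\<^sup>2 + (G \<delta>)\<^sup>2) \<longlongrightarrow> 0\<^sup>2 + 0\<^sup>2) (at_right 0)"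
    by (intro tendsto_intros F0 G0)
  then have lim: "((\<lambda>\<delta>. (F \<delta>)\<^sup>2 + (G \<delta>)\<^sup>2) \<longlongrightarrow> 0) (at_right 0)" by simp
  have "\<forall>\<^sub>F \<delta> in at_right 0. N \<rho> \<le> (F \<delta>)\<^sup>2 + (G \<delta>)\<^sup>2"
    unfolding eventually_at_right_field
  proof (intro exI[of _ \<rho>] conjI allI impI \<rho>)
    fix \<delta> assume \<delta>: "0 < \<delta>" "\<delta> < \<rho>"
    have "A \<delta> \<ge> 0" using s by (simp add: A_def)
    then have "N \<delta> \<le> ((F \<delta>)\<^sup>2 + (G \<delta>)\<^sup>2) * 1"
      unfolding N_def by (intro mult_left_mono) auto
    then show "N \<rho> \<le> (F \<delta>)\<^sup>2 + (G \<delta>)\<^sup>2"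
      using mono[of \<delta>] \<delta> by simp
  qed
  then have "N \<rho> \<le> 0"
    by (intro tendsto_lowerbound[OF lim]) auto
  then have "(F \<rho>)\<^sup>2 + (G \<rho>)\<^sup>2 \<le> 0"
    by (simp add: N_def mult_le_0_iff)
  then show ?thesis
    by (simp add: sum_power2_le_zero_iff)
qed

text \<open>
  With \<open>t = exp x\<close> this is the integral of \<open>t powr (s - 1) * exp (- t - \<rho> / t)\<close> over \<open>t > 0\<close>, that is
  \<open>2 * \<rho> powr (s / 2) * K\<^sub>s (2 * sqrt \<rho>)\<close>. On the logarithmic scale the substitution
  \<open>t \<mapsto> \<rho> / t\<close> is a reflection of the line.
\<close>

definition laplace_K :: "real \<Rightarrow> real \<Rightarrow> real" where
  "laplace_K s \<rho> = (\<integral>x. exp (s * x - exp x - \<rho> * exp (- x)) \<partial>lborel)"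

lemma Gamma_log_integral:
  fixes s :: real
  assumes "s > 0"
  shows "integrable lborel (\<lambda>x. exp (s * x - exp x))" "(\<integral>x. exp (s * x - exp x) \<partial>lborel) = Gamma s"
proof -
  let ?f = "\<lambda>t. t powr (s - 1) / exp t :: real"
  have I: "(?f has_integral Gamma s) {0..}"
    by (rule Gamma_integral_real[OF assms])
  have I2: "(?f has_integral Gamma s) {0<..}"
    by (rule has_integral_spike_set_eq[THEN iffD1, OF _ _ I])
      (rule negligible_subset[of "{0}"], auto)+
  have ai: "?f absolutely_integrable_on {0<..}"
    by (rule nonnegative_absolutely_integrable_1) (use I2 in auto)
  have im: "range exp = {0::real<..}"
    by (auto simp: image_iff) (metis exp_ln)
  have "(\<lambda>x. \<bar>exp x\<bar> * ?f (exp x)) absolutely_integrable_on UNIV \<and>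
        integral UNIV (\<lambda>x. \<bar>exp x\<bar> * ?f (exp x)) = Gamma s"
  proof (rule has_absolute_integral_change_of_variables_1'
      [where S = UNIV and g = exp and g' = exp and f = ?f, THEN iffD2])
    show "?f absolutely_integrable_on range exp \<and> integral (range exp) ?f = Gamma s"
      unfolding im using ai integral_unique[OF I2] by blast
    show "(exp has_real_derivative exp x) (at x within UNIV)" for x :: real
      by (rule DERIV_exp)
  qed (auto simp: inj_on_def)
  moreover have "\<bar>exp x\<bar> * ?f (exp x) = exp (s * x - exp x)" for x
    by (simp add: powr_def exp_diff exp_minus field_simps left_diff_distrib exp_add)
  ultimately have *: "(\<lambda>x. exp (s * x - exp x)) absolutely_integrable_on UNIV"
      "integral UNIV (\<lambda>x. exp (s * x - exp x)) = Gamma s"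
    by auto
  have m: "(\<lambda>x. exp (s * x - exp x)) \<in> borel_measurable lborel" by measurable
  have "integrable lebesgue (\<lambda>x. exp (s * x - exp x))"
    using *(1) by (simp add: set_integrable_def)
  then show i: "integrable lborel (\<lambda>x. exp (s * x - exp x))"
    using integrable_completion[OF m] by simp
  show "(\<integral>x. exp (s * x - exp x) \<partial>lborel) = Gamma s"
    using integral_lborel[OF i] *(2) by simp
qed

lemma laplace_K_dominated:
  fixes s \<rho> :: real
  assumes "s > 0" "\<rho> \<ge> 0"
  shows "integrable lborel (\<lambda>x. exp (s * x - exp x - \<rho> * exp (- x)))"
  by (rule Bochner_Integration.integrable_bound[OF Gamma_log_integral(1)[OF assms(1)]])
    (use assms in auto)

lemma laplace_K_bound:
  assumes "s > 0" "\<rho> \<ge> 0"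
  shows "0 \<le> laplace_K s \<rho>" "laplace_K s \<rho> \<le> Gamma s"
  unfolding laplace_K_def Gamma_log_integral(2)[OF assms(1), symmetric]
  by (auto intro!: integral_nonneg integral_mono laplace_K_dominated Gamma_log_integral(1) assms
    simp: assms)

lemma laplace_K_tendsto:
  assumes s: "s > 0"
  shows "(laplace_K s \<longlongrightarrow> Gamma s) (at_right 0)"
  unfolding tendsto_at_iff_sequentially comp_def
proof (intro allI impI)
  fix X :: "nat \<Rightarrow> real" assume X: "\<forall>i. X i \<in> {0<..} - {0}" "X \<longlonglongrightarrow> 0"
  have "(\<lambda>i. \<integral>x. exp (s * x - exp x - X i * exp (- x)) \<partial>lborel) \<longlonglongrightarrow> (\<integral>x. exp (s * x - exp x) \<partial>lborel)"
  proof (rule integral_dominated_convergence[OF _ _ Gamma_log_integral(1)[OF s]])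
    have "(\<lambda>i. exp (s * x - exp x - X i * exp (- x))) \<longlonglongrightarrow> exp (s * x - exp x - 0 * exp (- x))" for x
      by (intro tendsto_intros X)
    then show "AE x in lborel. (\<lambda>i. exp (s * x - exp x - X i * exp (- x))) \<longlonglongrightarrow> exp (s * x - exp x)"
      by simp
    show "AE x in lborel. norm (exp (s * x - exp x - X i * exp (- x))) \<le> exp (s * x - exp x)" for i
      using X(1)[rule_format, of i] by simp
  qed measurable
  then show "(\<lambda>i. laplace_K s (X i)) \<longlonglongrightarrow> Gamma s"
    by (simp add: laplace_K_def Gamma_log_integral(2)[OF s])
qed

text \<open>
  The derivative of \<open>exp (- y * b)\<close> in \<open>y\<close> is bounded for \<open>y \<ge> \<rho> / 2\<close> uniformly in \<open>b\<close>, because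
  \<open>t * exp (- t) \<le> 1\<close>. It dominates the difference quotients in the next lemma.
\<close>

lemma exp_decay_difference:
  fixes b :: real
  assumes "b > 0" "\<rho> > 0" "\<bar>h\<bar> \<le> \<rho> / 2"
  shows "\<bar>exp (- (\<rho> + h) * b) - exp (- \<rho> * b)\<bar> \<le> \<bar>h\<bar> * (2 / \<rho>)"
proof -
  have b1: "b * exp (- (y * b)) \<le> 2 / \<rho>" if "y \<ge> \<rho> / 2" for y
  proof -
    have "(\<rho> / 2) * b \<le> y * b"
      using that assms by (intro mult_right_mono) auto
    then have "(\<rho> / 2) * b \<le> exp (y * b)"
      using exp_ge_add_one_self[of "y * b"] by linarith
    then have "(\<rho> / 2) * b * exp (- (y * b)) \<le> 1"
      by (simp add: exp_minus divide_inverse[symmetric] pos_divide_le_eq)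
    then show ?thesis using assms by (simp add: field_simps)
  qed
  have "norm (exp (- (\<rho> + h) * b) - exp (- \<rho> * b)) \<le> (2 / \<rho>) * norm ((\<rho> + h) - \<rho>)"
  proof (rule field_differentiable_bound[of "{\<rho>/2..}" "\<lambda>y. exp (- y * b)" "\<lambda>y. - b * exp (- y * b)"])
    show "((\<lambda>y. exp (- y * b)) has_field_derivative - b * exp (- y * b)) (at y within {\<rho>/2..})" for y
      by (auto intro!: derivative_eq_intros)
    show "norm (- b * exp (- y * b)) \<le> 2 / \<rho>" if "y \<in> {\<rho>/2..}" for y
      using b1[of y] that assms by (simp add: abs_mult)
  qed (use assms in auto)
  then show ?thesis by (simp add: mult.commute)
qed

text \<open>
  Differentiation under the integral lowers the exponent \<open>s\<close> by 1, and the reflection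
  \<open>x \<mapsto> ln \<rho> - x\<close> turns \<open>s - 1\<close> into \<open>1 - s\<close>.
\<close>

lemma laplace_K_deriv:
  assumes s: "0 < s" "s < 1" and \<rho>: "\<rho> > 0"
  shows "(laplace_K s has_real_derivative - (\<rho> powr (s - 1)) * laplace_K (1 - s) \<rho>) (at \<rho>)"
proof -
  define I where "I = (\<integral>x. - exp (- x) * exp (s * x - exp x - \<rho> * exp (- x)) \<partial>lborel)"
  have "I = - (\<integral>x. exp ((s - 1) * x - exp x - \<rho> * exp (- x)) \<partial>lborel)"
    unfolding I_def by (subst integral_minus[symmetric])
      (intro Bochner_Integration.integral_cong refl, simp add: exp_add[symmetric] algebra_simps)
  also have "(\<integral>x. exp ((s - 1) * x - exp x - \<rho> * exp (- x)) \<partial>lborel) =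
     \<bar>-1\<bar> *\<^sub>R (\<integral>x. exp ((s - 1) * (ln \<rho> + (-1) * x) - exp (ln \<rho> + (-1) * x) - \<rho> * exp (- (ln \<rho> + (-1) * x))) \<partial>lborel)"
    by (rule lborel_integral_real_affine) simp
  also have "\<dots> = (\<integral>x. \<rho> powr (s - 1) * exp ((1 - s) * x - exp x - \<rho> * exp (- x)) \<partial>lborel)"
  proof -
    have "exp ((s - 1) * (ln \<rho> + (-1) * x) - exp (ln \<rho> + (-1) * x) - \<rho> * exp (- (ln \<rho> + (-1) * x))) =
       \<rho> powr (s - 1) * exp ((1 - s) * x - exp x - \<rho> * exp (- x))" for x
    proof -
      have "exp (ln \<rho> + (-1) * x) = \<rho> * exp (- x)" "\<rho> * exp (- (ln \<rho> + (-1) * x)) = exp x"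
        using \<rho> by (simp_all add: exp_add exp_diff exp_minus field_simps)
      then have "(s - 1) * (ln \<rho> + (-1) * x) - exp (ln \<rho> + (-1) * x) - \<rho> * exp (- (ln \<rho> + (-1) * x)) =
         (s - 1) * ln \<rho> + ((1 - s) * x - exp x - \<rho> * exp (- x))"
        by (simp add: algebra_simps)
      then show ?thesis
        using \<rho> by (simp only: exp_add powr_def) simp
    qed
    then show ?thesis by simp
  qed
  also have "\<dots> = \<rho> powr (s - 1) * laplace_K (1 - s) \<rho>"
    by (simp add: laplace_K_def)
  finally have I: "I = - (\<rho> powr (s - 1)) * laplace_K (1 - s) \<rho>"
    by simp
  have "((\<lambda>h. (laplace_K s (\<rho> + h) - laplace_K s \<rho>) / h) \<longlongrightarrow> I) (at 0)"
  proof -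
    have "((\<lambda>h. (laplace_K s (\<rho> + h) - laplace_K s \<rho>) / h) \<longlongrightarrow> I) (at 0 within {- \<rho>/2<..<\<rho>/2})"
      unfolding tendsto_at_iff_sequentially comp_def
    proof (intro allI impI)
      fix X :: "nat \<Rightarrow> real" assume X: "\<forall>i. X i \<in> {- \<rho>/2<..<\<rho>/2} - {0}" "X \<longlonglongrightarrow> 0"
      have Xi: "\<bar>X i\<bar> \<le> \<rho> / 2" "X i \<noteq> 0" for i
        using X(1)[rule_format, of i] by auto
      define q where "q i x = exp (s * x - exp x) * ((exp (- (\<rho> + X i) * exp (- x)) - exp (- \<rho> * exp (- x))) / X i)" for i x
      have "(\<lambda>i. \<integral>x. q i x \<partial>lborel) \<longlonglongrightarrow> I"
        unfolding I_def
      proof (rule integral_dominated_convergence)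
        show "integrable lborel (\<lambda>x. (2 / \<rho>) * exp (s * x - exp x))"
          using Gamma_log_integral(1)[OF s(1)] by simp
        show "AE x in lborel. norm (q i x) \<le> (2 / \<rho>) * exp (s * x - exp x)" for i
        proof (rule AE_I2)
          fix x
          have "\<bar>(exp (- (\<rho> + X i) * exp (- x)) - exp (- \<rho> * exp (- x))) / X i\<bar> \<le> 2 / \<rho>"
            using exp_decay_difference[of "exp (- x)" \<rho> "X i"] Xi[of i] \<rho>
            by (simp add: abs_divide pos_divide_le_eq mult.commute)
          then have "exp (s * x - exp x) * \<bar>(exp (- (\<rho> + X i) * exp (- x)) - exp (- \<rho> * exp (- x))) / X i\<bar> \<le>
              exp (s * x - exp x) * (2 / \<rho>)"
            by (rule mult_left_mono) simp
          then show "norm (q i x) \<le> (2 / \<rho>) * exp (s * x - exp x)"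
            unfolding q_def real_norm_def abs_mult abs_exp_cancel mult.commute[of "2 / \<rho>"] .
        qed
        show "AE x in lborel. (\<lambda>i. q i x) \<longlonglongrightarrow> - exp (- x) * exp (s * x - exp x - \<rho> * exp (- x))"
        proof (rule AE_I2)
          fix x
          have "((\<lambda>y. exp (- y * exp (- x))) has_real_derivative - exp (- x) * exp (- \<rho> * exp (- x))) (at \<rho>)"
            by (auto intro!: derivative_eq_intros)
          then have "((\<lambda>h. (exp (- (\<rho> + h) * exp (- x)) - exp (- \<rho> * exp (- x))) / h) \<longlongrightarrow> - exp (- x) * exp (- \<rho> * exp (- x))) (at 0)"
            by (simp only: DERIV_def)
          moreover have "filterlim X (at 0) sequentially"
            using X(2) Xi(2) by (auto simp: filterlim_at)
          ultimately have "(\<lambda>i. (exp (- (\<rho> + X i) * exp (- x)) - exp (- \<rho> * exp (- x))) / X i) \<longlonglongrightarrow> - exp (- x) * exp (- \<rho> * exp (- x))"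
            by (rule filterlim_compose)
          then have "(\<lambda>i. q i x) \<longlonglongrightarrow> exp (s * x - exp x) * (- exp (- x) * exp (- \<rho> * exp (- x)))"
            unfolding q_def by (intro tendsto_mult tendsto_const)
          moreover have "exp (s * x - exp x) * (- exp (- x) * exp (- \<rho> * exp (- x))) =
              - exp (- x) * exp (s * x - exp x - \<rho> * exp (- x))"
          proof -
            have "exp (s * x - exp x - \<rho> * exp (- x)) = exp (s * x - exp x) * exp (- \<rho> * exp (- x))"
              by (simp add: exp_add[symmetric])
            then show ?thesis by (simp only: mult_ac)
          qed
          ultimately show "(\<lambda>i. q i x) \<longlonglongrightarrow> - exp (- x) * exp (s * x - exp x - \<rho> * exp (- x))"
            by (simp only:)
        qed
        show "q i \<in> borel_measurable lborel" for i
          unfolding q_def by measurable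
      qed measurable
      moreover have "(\<integral>x. q i x \<partial>lborel) = (laplace_K s (\<rho> + X i) - laplace_K s \<rho>) / X i" for i
      proof -
        have "\<rho> + X i \<ge> 0" using Xi(1)[of i] \<rho> by (auto simp: abs_le_iff)
        then have "laplace_K s (\<rho> + X i) - laplace_K s \<rho> =
          (\<integral>x. exp (s * x - exp x - (\<rho> + X i) * exp (- x)) - exp (s * x - exp x - \<rho> * exp (- x)) \<partial>lborel)"
          unfolding laplace_K_def using \<rho> s
          by (intro Bochner_Integration.integral_diff[symmetric] laplace_K_dominated) auto
        also have "\<dots> = (\<integral>x. X i * q i x \<partial>lborel)"
        proof (intro Bochner_Integration.integral_cong refl)
          fix x
          have e: "exp (s * x - exp x - y * exp (- x)) = exp (s * x - exp x) * exp (- y * exp (- x))" for y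
            by (simp add: exp_add[symmetric])
          show "exp (s * x - exp x - (\<rho> + X i) * exp (- x)) - exp (s * x - exp x - \<rho> * exp (- x)) = X i * q i x"
            unfolding e q_def right_diff_distrib[symmetric] using Xi(2)[of i] by simp
        qed
        finally show ?thesis using Xi(2)[of i] by simp
      qed
      ultimately show "(\<lambda>i. (laplace_K s (\<rho> + X i) - laplace_K s \<rho>) / X i) \<longlonglongrightarrow> I"
        by simp
    qed
    then show ?thesis
      using \<rho> by (subst (asm) at_within_open) auto
  qed
  then show ?thesis
    by (simp add: DERIV_def I)
qed

text \<open>
  For \<open>p > 0\<close> both series grow exponentially and only their difference is bounded. The
  cancellation is not visible in the power series; it is read off from the integral, which satisfies
  the same first order system with the same values at 0.
\<close>

theorem bessel_difference_eq:
  assumes s: "0 < s" "s < 1" and \<rho>: "\<rho> > 0"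
  shows "bessel_series (- s) \<rho> - frobenius 1 s \<rho> = laplace_K s \<rho> / (Gamma s * Gamma (1 - s))"
proof -
  let ?c = "Gamma s * Gamma (1 - s)"
  \<comment> \<open>The constant is symmetric in \<open>s\<close> and \<open>1 - s\<close>, so the two differences satisfy the dual system.\<close>
  define D where "D s \<rho> = bessel_series (- s) (1 * \<rho>) - frobenius 1 s \<rho> - laplace_K s \<rho> / ?c" for s \<rho>
  have c: "?c > 0" using s by (simp add: Gamma_real_pos)
  have deriv: "(D r has_real_derivative - (\<rho> powr (r - 1)) * D (1 - r) \<rho>) (at \<rho>)"
    if "0 < r" "r < 1" "\<rho> > 0" for r \<rho>
  proof -
    have "(D r has_real_derivative 1 * \<rho> powr (r - 1) * frobenius 1 (1 - r) \<rho> -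
        \<rho> powr (r - 1) * bessel_series (r - 1) (1 * \<rho>) -
        - (\<rho> powr (r - 1)) * laplace_K (1 - r) \<rho> / ?c) (at \<rho>)"
      unfolding D_def[abs_def]
      by (intro DERIV_diff DERIV_cdivide regular_solution_deriv frobenius_deriv laplace_K_deriv that)
    then show ?thesis
      by (simp add: D_def algebra_simps)
  qed
  have lim: "(D r \<longlongrightarrow> 0) (at_right 0)" if r: "0 < r" "r < 1" and rc: "Gamma r * Gamma (1 - r) = ?c" for r
  proof -
    have cont: "((\<lambda>\<rho>. bessel_series \<nu> (1 * \<rho>)) \<longlongrightarrow> rGamma (\<nu> + 1)) (at_right 0)" if "\<nu> > -1" for \<nu>
    proof -
      have "isCont (bessel_series \<nu>) 0"
        using bessel_series_deriv[OF that] by (rule DERIV_isCont)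
      then have "(bessel_series \<nu> \<longlongrightarrow> bessel_series \<nu> 0) (at_right 0)"
        by (rule isContD[THEN tendsto_mono[rotated]]) (simp add: at_within_le_at)
      then show ?thesis by (simp add: bessel_series_0)
    qed
    have p0: "((\<lambda>\<rho>. \<rho> powr r) \<longlongrightarrow> 0) (at_right 0)"
    proof -
      have "\<forall>\<^sub>F \<rho> in at_right (0::real). 0 \<le> \<rho>"
        using eventually_at_right_less[of "0::real"] by eventually_elim simp
      then have "((\<lambda>\<rho>. \<rho> powr r) \<longlongrightarrow> 0 powr r) (at_right 0)"
        using r by (intro tendsto_powr2 tendsto_ident_at tendsto_const) auto
      then show ?thesis using r by simp
    qed
    have "(D r \<longlongrightarrow> rGamma (- r + 1) - 0 * rGamma (r + 1) - Gamma r / ?c) (at_right 0)"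
      unfolding D_def[abs_def] frobenius_def
      by (intro tendsto_intros cont p0 laplace_K_tendsto) (use r c in auto)
    moreover have "rGamma (- r + 1) = Gamma r / ?c"
      unfolding rc[symmetric] using Gamma_real_pos[of r, OF r(1)] Gamma_real_pos[of "1 - r"] r(2) by (simp add: rGamma_inverse_Gamma field_simps)
    ultimately show ?thesis by simp
  qed
  have "D s \<rho> = 0"
  proof (rule dual_system_unique[OF s _ _ _ _ \<rho>])
    show "(D s has_real_derivative - (\<rho> powr (s - 1)) * D (1 - s) \<rho>) (at \<rho>)" if "\<rho> > 0" for \<rho>
      by (rule deriv[OF s that])
    show "(D (1 - s) has_real_derivative - (\<rho> powr (- s)) * D s \<rho>) (at \<rho>)" if "\<rho> > 0" for \<rho>
      using deriv[of "1 - s", OF _ _ that] s by simp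
    show "(D s \<longlongrightarrow> 0) (at_right 0)" "(D (1 - s) \<longlongrightarrow> 0) (at_right 0)"
      using s by (auto intro!: lim)
  qed
  then show ?thesis by (simp add: D_def)
qed

section \<open>The oscillating side: an energy estimate\<close>

text \<open>
  After removing the expected amplitude, \<open>f = \<rho> powr (- k) * F\<close> and \<open>g = \<rho> powr k * G\<close> with \<open>k = s/2 - 1/4\<close>, the system is a
  rotation with angular speed \<open>\<rho> powr (- 1/2)\<close> up to terms of size \<open>1 / \<rho>\<close>. Those are not
  integrable, but in \<open>(f\<^sup>2 + g\<^sup>2)' = - 2 k (f\<^sup>2 - g\<^sup>2) / \<rho>\<close> the right side is, to leading order, the
  derivative of \<open>- 2 k \<rho> powr (- 1/2) * f * g\<close>. The corrected energy changes only at the integrable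
  rate \<open>\<rho> powr (- 3/2)\<close>.
\<close>

lemma oscillating_system_bound:
  fixes F G :: "real \<Rightarrow> real"
  assumes s: "0 < s" "s < 1"
    and F: "\<And>\<rho>. \<rho> > 0 \<Longrightarrow> (F has_real_derivative - (\<rho> powr (s - 1)) * G \<rho>) (at \<rho>)"
    and G: "\<And>\<rho>. \<rho> > 0 \<Longrightarrow> (G has_real_derivative \<rho> powr (- s) * F \<rho>) (at \<rho>)"
  shows "\<exists>C. \<forall>\<rho>\<ge>1. \<bar>F \<rho>\<bar> \<le> C * \<rho> powr (s / 2 - 1 / 4) \<and>
    \<bar>G \<rho>\<bar> \<le> C * \<rho> powr (1 / 4 - s / 2)"
proof -
  define k where "k = s / 2 - 1 / 4"
  have k: "\<bar>k\<bar> \<le> 1 / 4" unfolding k_def abs_le_iff using s by simp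
  define f where "f \<rho> = \<rho> powr (- k) * F \<rho>" for \<rho>
  define g where "g \<rho> = \<rho> powr k * G \<rho>" for \<rho>
  have df: "(f has_real_derivative - k / \<rho> * f \<rho> - \<rho> powr (- 1 / 2) * g \<rho>) (at \<rho>)" if "\<rho> > 0" for \<rho>
  proof -
    have "(f has_real_derivative (- k * \<rho> powr (- k - 1)) * F \<rho> + - (\<rho> powr (s - 1)) * G \<rho> * \<rho> powr (- k)) (at \<rho>)"
      unfolding f_def[abs_def] by (intro DERIV_mult has_real_derivative_powr F that)
    moreover have "\<rho> powr (- k - 1) = \<rho> powr (- k) / \<rho>"
      using that by (simp add: powr_diff)
    moreover have "\<rho> powr (s - 1) * \<rho> powr (- k) = \<rho> powr (- 1 / 2) * \<rho> powr k"
    proof -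
      have "s - 1 + - k = - 1 / 2 + k" by (simp add: k_def)
      then show ?thesis by (simp only: powr_add[symmetric])
    qed
    ultimately show ?thesis
      by (simp add: f_def g_def algebra_simps)
  qed
  have dg: "(g has_real_derivative k / \<rho> * g \<rho> + \<rho> powr (- 1 / 2) * f \<rho>) (at \<rho>)" if "\<rho> > 0" for \<rho>
  proof -
    have "(g has_real_derivative (k * \<rho> powr (k - 1)) * G \<rho> + (\<rho> powr (- s)) * F \<rho> * \<rho> powr k) (at \<rho>)"
      unfolding g_def[abs_def] by (intro DERIV_mult has_real_derivative_powr G that)
    moreover have "\<rho> powr (k - 1) = \<rho> powr k / \<rho>"
      using that by (simp add: powr_diff)
    moreover have "\<rho> powr (- s) * \<rho> powr k = \<rho> powr (- 1 / 2) * \<rho> powr (- k)"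
    proof -
      have "- s + k = - 1 / 2 + - k" by (simp add: k_def)
      then show ?thesis by (simp only: powr_add[symmetric])
    qed
    ultimately show ?thesis
      by (simp add: f_def g_def algebra_simps)
  qed
  define En where "En \<rho> = (f \<rho>)\<^sup>2 + (g \<rho>)\<^sup>2 + 2 * k * \<rho> powr (- 1 / 2) * (f \<rho> * g \<rho>)" for \<rho>
  \<comment> \<open>The exponent \<open>2 * \<rho> powr (- 1/2)\<close> has derivative \<open>- (\<rho> powr (- 3/2))\<close>, so the factor absorbs the growth of \<open>En\<close>.\<close>
  define N where "N \<rho> = En \<rho> * exp (2 * \<rho> powr (- 1 / 2))" for \<rho>
  have dEn: "(En has_real_derivative - k * \<rho> powr (- 3 / 2) * (f \<rho> * g \<rho>)) (at \<rho>)" if "\<rho> > 0" for \<rho>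
  proof -
    let ?r = "\<rho> powr (- 1 / 2)"
    have r2: "?r * ?r = 1 / \<rho>" using that by (simp add: powr_add[symmetric] powr_minus_divide)
    have r3: "\<rho> powr (- 3 / 2) = ?r / \<rho>" using powr_diff[of \<rho> "-1/2" 1] that by simp
    have dr: "((\<lambda>\<rho>. \<rho> powr (- 1 / 2)) has_real_derivative - 1 / 2 * (?r / \<rho>)) (at \<rho>)"
    proof -
      have "- 1 / 2 - 1 = (- 3 / 2 :: real)" by simp
      then show ?thesis
        using has_real_derivative_powr[OF that, of "- 1 / 2"] by (simp only: r3)
    qed
    define i where "i = 1 / \<rho>"
    have df': "(f has_real_derivative - (k * i * f \<rho>) - ?r * g \<rho>) (at \<rho>)"
      and dg': "(g has_real_derivative k * i * g \<rho> + ?r * f \<rho>) (at \<rho>)"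
      using df[OF that] dg[OF that] by (simp_all add: i_def)
    have dr': "((\<lambda>\<rho>. \<rho> powr (- 1 / 2)) has_real_derivative - 1 / 2 * (?r * i)) (at \<rho>)"
      using dr by (simp add: i_def)
    have "((\<lambda>\<rho>. (f \<rho>)\<^sup>2 + (g \<rho>)\<^sup>2 + 2 * k * (\<rho> powr (- 1 / 2) * (f \<rho> * g \<rho>))) has_real_derivative
        (2 * (f \<rho> * (- (k * i * f \<rho>) - ?r * g \<rho>)) + 2 * (g \<rho> * (k * i * g \<rho> + ?r * f \<rho>))
        + 2 * k * (- 1 / 2 * (?r * i) * (f \<rho> * g \<rho>)
           + ((- (k * i * f \<rho>) - ?r * g \<rho>) * g \<rho> + (k * i * g \<rho> + ?r * f \<rho>) * f \<rho>) * ?r))) (at \<rho>)"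
      using DERIV_power[OF df', of 2] DERIV_power[OF dg', of 2]
      by (intro DERIV_add DERIV_cmult DERIV_mult dr' df' dg') (simp_all add: mult_ac)
    also have "2 * (f \<rho> * (- (k * i * f \<rho>) - ?r * g \<rho>)) + 2 * (g \<rho> * (k * i * g \<rho> + ?r * f \<rho>))
        + 2 * k * (- 1 / 2 * (?r * i) * (f \<rho> * g \<rho>)
           + ((- (k * i * f \<rho>) - ?r * g \<rho>) * g \<rho> + (k * i * g \<rho> + ?r * f \<rho>) * f \<rho>) * ?r) =
       2 * k * (?r * ?r - i) * (f \<rho> * f \<rho> - g \<rho> * g \<rho>) - k * (?r * i) * (f \<rho> * g \<rho>)"
      unfolding left_diff_distrib right_diff_distrib distrib_left distrib_right
      by (simp add: mult_ac)
    also have "\<dots> = - k * \<rho> powr (- 3 / 2) * (f \<rho> * g \<rho>)"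
      unfolding r2 r3 by (simp add: i_def)
    also have "(\<lambda>\<rho>. (f \<rho>)\<^sup>2 + (g \<rho>)\<^sup>2 + 2 * k * (\<rho> powr (- 1 / 2) * (f \<rho> * g \<rho>))) = En"
      by (simp add: En_def[abs_def] mult.assoc)
    finally show ?thesis .
  qed
  have cross: "\<bar>f \<rho> * g \<rho>\<bar> \<le> ((f \<rho>)\<^sup>2 + (g \<rho>)\<^sup>2) / 2" for \<rho>
    using sum_squares_bound[of "\<bar>f \<rho>\<bar>" "\<bar>g \<rho>\<bar>"] by (simp add: abs_mult)
  have coerc: "3 / 4 * ((f \<rho>)\<^sup>2 + (g \<rho>)\<^sup>2) \<le> En \<rho>" if "\<rho> \<ge> 1" for \<rho>
  proof -
    have "\<rho> powr (- 1 / 2) \<le> 1"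
      using that powr_mono[of "-1/2" 0 \<rho>] by simp
    then have "\<bar>k\<bar> * \<rho> powr (- 1 / 2) \<le> 1 / 4 * 1"
      using k by (intro mult_mono) auto
    then have "(\<bar>k\<bar> * \<rho> powr (- 1 / 2)) * \<bar>f \<rho> * g \<rho>\<bar> \<le> 1 / 4 * (((f \<rho>)\<^sup>2 + (g \<rho>)\<^sup>2) / 2)"
      using cross[of \<rho>] by (intro mult_mono) auto
    moreover have "\<bar>k * \<rho> powr (- 1 / 2) * (f \<rho> * g \<rho>)\<bar> = (\<bar>k\<bar> * \<rho> powr (- 1 / 2)) * \<bar>f \<rho> * g \<rho>\<bar>"
      by (simp add: abs_mult)
    ultimately have "- (k * \<rho> powr (- 1 / 2) * (f \<rho> * g \<rho>)) \<le> ((f \<rho>)\<^sup>2 + (g \<rho>)\<^sup>2) / 8"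
      by (simp add: abs_le_iff)
    moreover have "En \<rho> = ((f \<rho>)\<^sup>2 + (g \<rho>)\<^sup>2) + 2 * (k * \<rho> powr (- 1 / 2) * (f \<rho> * g \<rho>))"
      by (simp add: En_def algebra_simps)
    moreover have "3 / 4 * S \<le> S + 2 * t" if "- t \<le> S / 8" for S t :: real
      using that by simp
    ultimately show ?thesis by metis
  qed
  have dN: "\<exists>D. (N has_real_derivative D) (at \<rho>) \<and> D \<le> 0" if "\<rho> \<ge> 1" for \<rho>
  proof -
    let ?q = "\<rho> powr (- 3 / 2)"
    have p: "\<rho> > 0" using that by simp
    have dr: "((\<lambda>\<rho>. \<rho> powr (- 1 / 2)) has_real_derivative - 1 / 2 * ?q) (at \<rho>)"
      using has_real_derivative_powr[OF p, of "-1/2"] by simp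
    have "(N has_real_derivative (- k * ?q * (f \<rho> * g \<rho>) - ?q * En \<rho>) * exp (2 * \<rho> powr (- 1 / 2))) (at \<rho>)"
      unfolding N_def[abs_def]
      by (rule derivative_eq_intros dEn[OF p] dr refl)+ (simp add: algebra_simps)
    moreover have "- k * (f \<rho> * g \<rho>) \<le> En \<rho>"
    proof -
      have "\<bar>k\<bar> * \<bar>f \<rho> * g \<rho>\<bar> \<le> 1 / 4 * (((f \<rho>)\<^sup>2 + (g \<rho>)\<^sup>2) / 2)"
        using cross[of \<rho>] k by (intro mult_mono) auto
      then have "- (k * (f \<rho> * g \<rho>)) \<le> ((f \<rho>)\<^sup>2 + (g \<rho>)\<^sup>2) / 8"
        unfolding abs_mult[symmetric] by (simp add: abs_le_iff)
      moreover have "- x \<le> E" if "- x \<le> S / 8" "3 / 4 * S \<le> E" "0 \<le> S" for x E S :: real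
        using that by simp
      ultimately have "- (k * (f \<rho> * g \<rho>)) \<le> En \<rho>"
        using coerc[OF that] sum_power2_ge_zero[of "f \<rho>" "g \<rho>"] by metis
      then show ?thesis by simp
    qed
    then have "?q * (- k * (f \<rho> * g \<rho>) - En \<rho>) \<le> 0"
      by (intro mult_nonneg_nonpos) auto
    then have "(- k * ?q * (f \<rho> * g \<rho>) - ?q * En \<rho>) * exp (2 * \<rho> powr (- 1 / 2)) \<le> 0"
      by (intro mult_nonpos_nonneg) (auto simp: algebra_simps)
    ultimately show ?thesis by blast
  qed
  have bound: "(f \<rho>)\<^sup>2 + (g \<rho>)\<^sup>2 \<le> 4 / 3 * \<bar>N 1\<bar>" if "\<rho> \<ge> 1" for \<rho>
  proof -
    have "N \<rho> \<le> N 1"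
      by (rule DERIV_nonpos_imp_nonincreasing[OF that]) (use dN in auto)
    moreover have En0: "En \<rho> \<ge> 0"
      by (rule order_trans[OF _ coerc[OF that]]) simp
    then have "En \<rho> * 1 \<le> N \<rho>"
      unfolding N_def by (intro mult_left_mono) auto
    moreover have "S \<le> 4 / 3 * \<bar>n1\<bar>" if "n \<le> n1" "E * 1 \<le> n" "3 / 4 * S \<le> E" for S E n n1 :: real
      using that by simp
    ultimately show ?thesis using coerc[OF that] by metis
  qed
  define C where "C = sqrt (4 / 3 * \<bar>N 1\<bar>)"
  show ?thesis
  proof (intro exI[of _ C] allI impI)
    fix \<rho> :: real assume \<rho>: "\<rho> \<ge> 1"
    have "(f \<rho>)\<^sup>2 \<le> 4 / 3 * \<bar>N 1\<bar>" "(g \<rho>)\<^sup>2 \<le> 4 / 3 * \<bar>N 1\<bar>"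
      using bound[OF \<rho>] zero_le_power2[of "f \<rho>"] zero_le_power2[of "g \<rho>"] by linarith+
    then have fg: "\<bar>f \<rho>\<bar> \<le> C" "\<bar>g \<rho>\<bar> \<le> C"
      unfolding C_def by (auto intro!: real_le_rsqrt)
    have "F \<rho> = f \<rho> * \<rho> powr k" "G \<rho> = g \<rho> * \<rho> powr (- k)"
      using \<rho> by (simp_all add: f_def g_def powr_minus field_simps)
    then show "\<bar>F \<rho>\<bar> \<le> C * \<rho> powr (s / 2 - 1 / 4) \<and> \<bar>G \<rho>\<bar> \<le> C * \<rho> powr (1 / 4 - s / 2)"
      using fg mult_right_mono[of _ C "\<rho> powr k"] mult_right_mono[of _ C "\<rho> powr (- k)"]
      by (auto simp: abs_mult k_def)
  qed
qed

text \<open>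
  The system for \<open>s\<close> bounds the regular solution, the system for \<open>1 - s\<close> the other one.
\<close>

lemma oscillating_bound:
  assumes s: "0 < s" "s < 1"
  shows "\<exists>C. \<forall>\<rho>\<ge>1. \<bar>bessel_series (- s) (- \<rho>)\<bar> \<le> C * \<rho> powr (s / 2 - 1 / 4) \<and>
    \<bar>frobenius (- 1) s \<rho>\<bar> \<le> C * \<rho> powr (s / 2 - 1 / 4)"
proof -
  have F: "((\<lambda>\<rho>. bessel_series (- r) (- \<rho>)) has_real_derivative - (\<rho> powr (r - 1)) * frobenius (- 1) (1 - r) \<rho>) (at \<rho>)"
    if "0 < r" "r < 1" "\<rho> > 0" for r \<rho>
    using regular_solution_deriv[OF that, of "- 1"] by simp
  have G: "(frobenius (- 1) (1 - r) has_real_derivative (\<rho> powr (- r)) * bessel_series (- r) (- \<rho>)) (at \<rho>)"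
    if "0 < r" "r < 1" "\<rho> > 0" for r \<rho>
    using frobenius_deriv[of "1 - r" \<rho> "- 1"] that by simp
  obtain C1 where C1: "\<forall>\<rho>\<ge>1. \<bar>bessel_series (- s) (- \<rho>)\<bar> \<le> C1 * \<rho> powr (s / 2 - 1 / 4) \<and>
      \<bar>frobenius (- 1) (1 - s) \<rho>\<bar> \<le> C1 * \<rho> powr (1 / 4 - s / 2)"
    using oscillating_system_bound[OF s F[OF s] G[OF s]] ..
  have s': "0 < 1 - s" "1 - s < 1" using s by auto
  obtain C2 where C2: "\<forall>\<rho>\<ge>1. \<bar>bessel_series (- (1 - s)) (- \<rho>)\<bar> \<le> C2 * \<rho> powr ((1 - s) / 2 - 1 / 4) \<and>
      \<bar>frobenius (- 1) (1 - (1 - s)) \<rho>\<bar> \<le> C2 * \<rho> powr (1 / 4 - (1 - s) / 2)"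
    using oscillating_system_bound[OF s' F[OF s'] G[OF s']] ..
  have e: "1 / 4 - (1 - s) / 2 = s / 2 - 1 / 4" by (simp add: field_simps)
  have m: "C1 * \<rho> powr t \<le> max C1 C2 * \<rho> powr t" "C2 * \<rho> powr t \<le> max C1 C2 * \<rho> powr t" for \<rho> t :: real
    by (intro mult_right_mono; simp)+
  show ?thesis
  proof (intro exI[of _ "max C1 C2"] allI impI conjI)
    fix \<rho> :: real assume \<rho>: "\<rho> \<ge> 1"
    show "\<bar>bessel_series (- s) (- \<rho>)\<bar> \<le> max C1 C2 * \<rho> powr (s / 2 - 1 / 4)"
      using C1 \<rho> m(1) by (blast intro: order_trans)
    have "\<bar>frobenius (- 1) s \<rho>\<bar> \<le> C2 * \<rho> powr (s / 2 - 1 / 4)"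
      using C2[rule_format, OF \<rho>] by (simp add: e)
    then show "\<bar>frobenius (- 1) s \<rho>\<bar> \<le> max C1 C2 * \<rho> powr (s / 2 - 1 / 4)"
      by (rule order_trans[OF _ m(2)])
  qed
qed

section \<open>The multiplier as a function of one real variable\<close>

text \<open>
  The square of \<open>theta powr s\<close>, as a function of the sign \<open>\<sigma>\<close> of the symbol.
\<close>

definition phase :: "real \<Rightarrow> real \<Rightarrow> complex" where
  "phase \<sigma> s = (if \<sigma> > 0 then 1 else cis (- (pi * s)))"

text \<open>
  With \<open>\<sigma> = sgn p\<close> and \<open>\<rho> = z\<^sup>2 \<bar>p\<bar> / 4\<close> this is \<open>m_mult s z\<close> divided by \<open>Gamma (1 - s)\<close>,
  for \<open>p \<noteq> 0\<close> and \<open>z > 0\<close> (see \<open>m_mult_eq_bessel_profile\<close>).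
\<close>

definition bessel_profile :: "real \<Rightarrow> real \<Rightarrow> real \<Rightarrow> complex" where
  "bessel_profile \<sigma> s \<rho> = of_real (bessel_series (- s) (\<sigma> * \<rho>)) - phase \<sigma> s * of_real (frobenius \<sigma> s \<rho>)"

lemma norm_phase [simp]: "cmod (phase \<sigma> s) = 1"
  by (simp add: phase_def)

lemma phase_dual:
  assumes "\<sigma> \<in> {1, -1}"
  shows "phase \<sigma> s * phase \<sigma> (1 - s) = of_real \<sigma>"
  using assms by (auto simp: phase_def cis_mult algebra_simps complex_eq_iff)

text \<open>
  The phases for \<open>s\<close> and \<open>1 - s\<close> multiply to \<open>\<sigma>\<close>, so the duality between the two kinds of solutions
  becomes a relation between the profiles: the derivative of the multiplier for \<open>s\<close> is the
  multiplier for \<open>1 - s\<close> up to an explicit factor.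
\<close>

lemma bessel_profile_deriv:
  assumes s: "0 < s" "s < 1" and \<rho>: "\<rho> > 0" and \<sigma>: "\<sigma> \<in> {1, -1}"
  shows "(bessel_profile \<sigma> s has_vector_derivative
    - (phase \<sigma> s * of_real (\<rho> powr (s - 1)) * bessel_profile \<sigma> (1 - s) \<rho>)) (at \<rho>)"
proof -
  have "(bessel_profile \<sigma> s has_vector_derivative
     of_real (\<sigma> * \<rho> powr (s - 1) * frobenius \<sigma> (1 - s) \<rho>) -
     phase \<sigma> s * of_real (\<rho> powr (s - 1) * bessel_series (s - 1) (\<sigma> * \<rho>))) (at \<rho>)"
    unfolding bessel_profile_def[abs_def]
    by (intro has_vector_derivative_diff has_vector_derivative_mult_right has_vector_derivative_of_real
      regular_solution_deriv frobenius_deriv s \<rho>)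
  moreover have "of_real (\<sigma> * \<rho> powr (s - 1) * frobenius \<sigma> (1 - s) \<rho>) -
      phase \<sigma> s * of_real (\<rho> powr (s - 1) * bessel_series (s - 1) (\<sigma> * \<rho>)) =
      - (phase \<sigma> s * of_real (\<rho> powr (s - 1)) * bessel_profile \<sigma> (1 - s) \<rho>)"
    unfolding bessel_profile_def of_real_mult phase_dual[OF \<sigma>, of s, symmetric]
    by (simp add: algebra_simps)
  ultimately show ?thesis by simp
qed

lemma frobenius_tendsto_0:
  assumes "0 < s"
  shows "(frobenius \<sigma> s \<longlongrightarrow> 0) (at_right 0)"
proof -
  have "\<forall>\<^sub>F \<rho> in at_right (0::real). 0 \<le> \<rho>"
    using eventually_at_right_less[of "0::real"] by eventually_elim simp
  then have p: "((\<lambda>\<rho>. \<rho> powr s) \<longlongrightarrow> 0 powr s) (at_right 0)"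
    using assms by (intro tendsto_powr2 tendsto_ident_at tendsto_const) auto
  have "isCont (\<lambda>\<rho>. bessel_series s (\<sigma> * \<rho>)) 0"
    by (rule isCont_o2[of _ _ "bessel_series s"])
       (use assms in \<open>auto intro!: continuous_intros DERIV_isCont[OF bessel_series_deriv]\<close>)
  then have "((\<lambda>\<rho>. bessel_series s (\<sigma> * \<rho>)) \<longlongrightarrow> bessel_series s (\<sigma> * 0)) (at_right 0)"
    by (auto simp: isCont_def intro: Lim_at_imp_Lim_at_within)
  from tendsto_mult[OF p this] show ?thesis
    using assms by (simp add: frobenius_def[abs_def])
qed

lemma bessel_profile_tendsto:
  assumes s: "0 < s" "s < 1"
  shows "(bessel_profile \<sigma> s \<longlongrightarrow> of_real (rGamma (1 - s))) (at_right 0)"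
proof -
  have "isCont (\<lambda>\<rho>. bessel_series (- s) (\<sigma> * \<rho>)) 0"
    by (rule isCont_o2[of _ _ "bessel_series (- s)"])
       (use s in \<open>auto intro!: continuous_intros DERIV_isCont[OF bessel_series_deriv]\<close>)
  then have "((\<lambda>\<rho>. bessel_series (- s) (\<sigma> * \<rho>)) \<longlongrightarrow> bessel_series (- s) (\<sigma> * 0)) (at_right 0)"
    by (auto simp: isCont_def intro: Lim_at_imp_Lim_at_within)
  then have "(bessel_profile \<sigma> s \<longlongrightarrow> of_real (bessel_series (- s) (\<sigma> * 0)) - phase \<sigma> s * of_real 0) (at_right 0)"
    unfolding bessel_profile_def[abs_def] by (intro tendsto_intros frobenius_tendsto_0 s)
  then show ?thesis by (simp add: bessel_series_0)
qed

lemma bessel_profile_measurable [measurable (raw)]: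
  assumes s: "0 < s" "s < 1" and [measurable]: "f \<in> borel_measurable M"
  shows "(\<lambda>x. bessel_profile \<sigma> s (f x)) \<in> borel_measurable M"
proof -
  have [measurable]: "bessel_series s \<in> borel_measurable borel" "bessel_series (- s) \<in> borel_measurable borel"
    by (rule bessel_series_measurable; use s in simp)+
  show ?thesis
    unfolding bessel_profile_def frobenius_def by measurable
qed

text \<open>
  Bounded on the elliptic side. On the oscillating side the amplitude at infinity is of order
  \<open>\<rho> powr (s / 2 - 1 / 4)\<close>; the exponent \<open>\<beta>\<close> is raised to be nonnegative so that one bound also
  covers small \<open>\<rho>\<close>.
\<close>

lemma bessel_profile_bound:
  assumes s: "0 < s" "s < 1" and \<beta>: "0 \<le> \<beta>" "s / 2 - 1 / 4 \<le> \<beta>"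
  shows "\<exists>C\<ge>0. \<forall>\<sigma>\<in>{1, -1}. \<forall>\<rho>>0. cmod (bessel_profile \<sigma> s \<rho>) \<le> C * (1 + \<rho> powr \<beta>)"
proof -
  define C1 where "C1 = Gamma s / (Gamma s * Gamma (1 - s))"
  have G: "Gamma s > 0" "Gamma (1 - s) > 0"
    using s by (auto intro: Gamma_real_pos)
  have C1: "cmod (bessel_profile 1 s \<rho>) \<le> C1" if "\<rho> > 0" for \<rho>
  proof -
    have "bessel_profile 1 s \<rho> = of_real (laplace_K s \<rho> / (Gamma s * Gamma (1 - s)))"
      unfolding bessel_difference_eq[OF s that, symmetric] by (simp add: bessel_profile_def phase_def)
    moreover have "0 \<le> laplace_K s \<rho>" "laplace_K s \<rho> \<le> Gamma s"
      using laplace_K_bound[of s \<rho>] s that by auto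
    moreover from this(1) have "0 \<le> laplace_K s \<rho> / (Gamma s * Gamma (1 - s))"
      by (rule divide_nonneg_pos) (use G in simp)
    moreover from calculation(3) have "laplace_K s \<rho> / (Gamma s * Gamma (1 - s)) \<le> C1"
      unfolding C1_def by (rule divide_right_mono) (use G in simp)
    ultimately show ?thesis
      by (simp only: norm_of_real abs_of_nonneg)
  qed
  obtain C2 where C2: "\<forall>\<rho>\<ge>1. \<bar>bessel_series (- s) (- \<rho>)\<bar> \<le> C2 * \<rho> powr (s / 2 - 1 / 4) \<and>
      \<bar>frobenius (- 1) s \<rho>\<bar> \<le> C2 * \<rho> powr (s / 2 - 1 / 4)"
    using oscillating_bound[OF s] ..
  have bdd: "\<exists>B. \<forall>x\<in>{-1..0}. \<bar>bessel_series \<nu> x\<bar> \<le> B" if "\<nu> > -1" for \<nu>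
  proof -
    have "compact (bessel_series \<nu> ` {-1..0})"
      by (intro compact_continuous_image continuous_bessel_series that compact_Icc)
    then have "bounded (bessel_series \<nu> ` {-1..0})"
      by (rule compact_imp_bounded)
    then show ?thesis by (auto simp: bounded_iff)
  qed
  obtain B1 where B1: "\<forall>x\<in>{-1..0}. \<bar>bessel_series (- s) x\<bar> \<le> B1"
    using bdd[of "- s"] s by auto
  obtain B2 where B2: "\<forall>x\<in>{-1..0}. \<bar>bessel_series s x\<bar> \<le> B2"
    using bdd[of s] s by auto
  have tri: "cmod (bessel_profile (- 1) s \<rho>) \<le> \<bar>bessel_series (- s) (- \<rho>)\<bar> + \<bar>frobenius (- 1) s \<rho>\<bar>" for \<rho>
    unfolding bessel_profile_def by (rule order_trans[OF norm_triangle_ineq4]) (simp add: norm_mult)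
  define C where "C = max C1 (max (B1 + B2) (2 * C2))"
  have C0: "C \<ge> 0" "C1 \<le> C" "B1 + B2 \<le> C" "2 * C2 \<le> C"
    using G by (auto simp: C_def C1_def le_max_iff_disj)
  have "cmod (bessel_profile \<sigma> s \<rho>) \<le> C * (1 + \<rho> powr \<beta>)" if \<sigma>: "\<sigma> \<in> {1, -1}" and \<rho>: "\<rho> > 0" for \<sigma> \<rho>
  proof -
    have le: "C \<le> C * (1 + \<rho> powr \<beta>)"
      using mult_left_mono[of 1 "1 + \<rho> powr \<beta>" C] C0 by simp
    consider "\<sigma> = 1" | "\<sigma> = -1" "\<rho> \<le> 1" | "\<sigma> = -1" "\<rho> \<ge> 1"
      using \<sigma> linear[of \<rho> 1] by auto
    then show ?thesis
    proof cases
      case 1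
      then show ?thesis using C1[OF \<rho>] C0 le by simp
    next
      case 2
      have "\<rho> powr s \<le> 1"
        using 2 \<rho> s powr_mono2[of s \<rho> 1] by simp
      then have "\<bar>frobenius (- 1) s \<rho>\<bar> \<le> 1 * \<bar>bessel_series s (- \<rho>)\<bar>"
        unfolding frobenius_def abs_mult by (intro mult_mono) auto
      moreover have "\<bar>bessel_series s (- \<rho>)\<bar> \<le> B2" "\<bar>bessel_series (- s) (- \<rho>)\<bar> \<le> B1"
        using B1 B2 2 \<rho> by auto
      ultimately show ?thesis
        using tri[of \<rho>] C0 le 2 by simp
    next
      case 3
      have "cmod (bessel_profile \<sigma> s \<rho>) \<le> (2 * C2) * \<rho> powr (s / 2 - 1 / 4)"
        using tri[of \<rho>] C2 3 by fastforce
      also have "\<dots> \<le> C * \<rho> powr (s / 2 - 1 / 4)"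
        using C0 by (intro mult_right_mono) auto
      also have "\<dots> \<le> C * (1 + \<rho> powr \<beta>)"
        using powr_mono[OF \<beta>(2), of \<rho>] 3 C0 by (intro mult_left_mono) auto
      finally show ?thesis .
    qed
  qed
  then show ?thesis using C0(1) by blast
qed

text \<open>
  Uniformity in \<open>z\<close> comes from \<open>\<beta> \<ge> 0\<close>, and a power of \<open>P\<close> between 0 and \<open>\<alpha>\<close> is at most
  \<open>1 + P powr \<alpha>\<close>, the weight under which the transform of \<open>u\<close> is square
  integrable.
\<close>

lemma weighted_bessel_profile_bound:
  assumes s: "0 < s" "s < 1" and \<beta>: "0 \<le> \<beta>" "s / 2 - 1 / 4 \<le> \<beta>"
    and \<gamma>: "0 \<le> \<gamma>" "\<gamma> + \<beta> \<le> \<alpha>"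
  shows "\<exists>C\<ge>0. \<forall>\<sigma>\<in>{1, -1}. \<forall>z P. 0 < z \<and> z \<le> Z \<and> 0 < P \<longrightarrow>
    P powr \<gamma> * cmod (bessel_profile \<sigma> s (z\<^sup>2 * P / 4)) \<le> C * (1 + P powr \<alpha>)"
proof -
  obtain C where C: "C \<ge> 0" "\<And>\<sigma> \<rho>. \<sigma> \<in> {1, -1} \<Longrightarrow> \<rho> > 0 \<Longrightarrow> cmod (bessel_profile \<sigma> s \<rho>) \<le> C * (1 + \<rho> powr \<beta>)"
    using bessel_profile_bound[OF s \<beta>] by blast
  have pw: "P powr t \<le> 1 + P powr \<alpha>" if "0 < P" "0 \<le> t" "t \<le> \<alpha>" for P t
  proof (cases "P \<ge> 1")
    case True
    then have "P powr t \<le> P powr \<alpha>" using that by (intro powr_mono) auto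
    then show ?thesis by simp
  next
    case False
    then have "P powr t \<le> 1" using that powr_mono2[of t P 1] by simp
    then show ?thesis by (simp add: add_increasing2)
  qed
  define K where "K = C * (1 + (Z\<^sup>2 / 4) powr \<beta>)"
  have "P powr \<gamma> * cmod (bessel_profile \<sigma> s (z\<^sup>2 * P / 4)) \<le> K * (1 + P powr \<alpha>)"
    if \<sigma>: "\<sigma> \<in> {1, -1}" and z: "0 < z" "z \<le> Z" and P: "0 < P" for \<sigma> z P
  proof -
    have split: "(z\<^sup>2 * P / 4) powr \<beta> = (z\<^sup>2 / 4) powr \<beta> * P powr \<beta>"
      using powr_mult[of "z\<^sup>2 / 4" P \<beta>] z P by simp
    have "P powr \<gamma> * cmod (bessel_profile \<sigma> s (z\<^sup>2 * P / 4)) \<le> P powr \<gamma> * (C * (1 + (z\<^sup>2 * P / 4) powr \<beta>))"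
      using z P by (intro mult_left_mono C \<sigma>) auto
    also have "\<dots> = C * (P powr \<gamma> + (z\<^sup>2 / 4) powr \<beta> * P powr (\<gamma> + \<beta>))"
      unfolding split powr_add by (simp add: algebra_simps)
    also have "\<dots> \<le> C * ((1 + P powr \<alpha>) + (Z\<^sup>2 / 4) powr \<beta> * (1 + P powr \<alpha>))"
    proof (intro mult_left_mono add_mono mult_mono C(1))
      show "P powr \<gamma> \<le> 1 + P powr \<alpha>" "P powr (\<gamma> + \<beta>) \<le> 1 + P powr \<alpha>"
        using \<beta> \<gamma> by (auto intro!: pw P)
      show "(z\<^sup>2 / 4) powr \<beta> \<le> (Z\<^sup>2 / 4) powr \<beta>"
        using \<beta> z by (intro powr_mono2 divide_right_mono power_mono) auto
    qed auto
    also have "\<dots> = K * (1 + P powr \<alpha>)"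
      by (simp add: K_def algebra_simps)
    finally show ?thesis .
  qed
  moreover have "K \<ge> 0" using C(1) by (simp add: K_def)
  ultimately show ?thesis by blast
qed

lemma bessel_I_series:
  assumes "\<nu> > -1" and w: "w\<^sup>2 / 4 = of_real x"
  shows "bessel_I \<nu> w = (w / 2) powr of_real \<nu> * of_real (bessel_series \<nu> x)"
proof -
  have "(w\<^sup>2 / 4) ^ k / (fact k * Gamma (of_real \<nu> + of_nat k + 1)) =
      complex_of_real (rGamma (\<nu> + real k + 1) / fact k * x ^ k)" for k
  proof -
    have "Gamma (of_real \<nu> + of_nat k + 1 :: complex) = Gamma (of_real (\<nu> + real k + 1))"
      by simp
    also have "\<dots> = inverse (of_real (rGamma (\<nu> + real k + 1)))"
      unfolding Gamma_def rGamma_complex_of_real by simp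
    finally show ?thesis
      unfolding w by (simp add: divide_inverse mult_ac)
  qed
  then show ?thesis
    unfolding bessel_I_def bessel_series_def
    by (simp only: suminf_of_real[OF summable_bessel_series[OF assms(1)]])
qed

lemma theta_powr: "theta \<omega> powr of_real a = (if p_symbol \<omega> > 0 then 1 else cis (- (pi * a / 2)))"
  by (auto simp: theta_def powr_def cis_conv_exp algebra_simps)

lemma theta_power2: "p_symbol \<omega> \<noteq> 0 \<Longrightarrow> (theta \<omega>)\<^sup>2 = of_real (sgn (p_symbol \<omega>))"
  by (auto simp: theta_def sgn_if)

lemma sgn_cases: "(p::real) \<noteq> 0 \<Longrightarrow> sgn p \<in> {1, -1}"
  by (auto simp: sgn_if)

text \<open>
  On both rays \<open>w\<^sup>2 = z\<^sup>2 * p\<close>. The prefactors of the two terms of \<open>K\<^sub>s\<close> combine by the reflection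
  formula for the Gamma function.
\<close>

lemma m_mult_eq_bessel_profile:
  fixes \<omega> :: "(real^'d) \<times> real"
  assumes s: "0 < s" "s < 1" and z: "z > 0" and p: "p_symbol \<omega> \<noteq> 0"
  shows "m_mult s z \<omega> = of_real (Gamma (1 - s)) *
    bessel_profile (sgn (p_symbol \<omega>)) s (z\<^sup>2 * \<bar>p_symbol \<omega>\<bar> / 4)"
proof -
  let ?\<sigma> = "sgn (p_symbol \<omega>)" and ?P = "\<bar>p_symbol \<omega>\<bar>"
  define r where "r = z * ?P powr (1/2) / 2"
  define \<rho> where "\<rho> = z\<^sup>2 * ?P / 4"
  define w where "w = of_real z * theta \<omega> * of_real (?P powr (1/2))"
  define e where "e = theta \<omega> powr of_real s"
  have r: "r > 0" using z p by (simp add: r_def)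
  have P2: "?P powr (1/2) * ?P powr (1/2) = ?P"
    by (simp add: powr_add[symmetric])
  have r2: "r * r = \<rho>"
    using P2 by (simp add: r_def \<rho>_def power2_eq_square)
  have w1: "w = of_real (2 * r) * theta \<omega>" and w2: "w / 2 = of_real r * theta \<omega>"
    by (simp_all add: w_def r_def)
  have "w\<^sup>2 / 4 = of_real (r * r) * (theta \<omega>)\<^sup>2"
    unfolding w1 by (simp add: power2_eq_square)
  then have wq: "w\<^sup>2 / 4 = of_real (?\<sigma> * \<rho>)"
    unfolding r2 theta_power2[OF p] by simp
  have pw: "(of_real x * theta \<omega>) powr of_real a = of_real (x powr a) * theta \<omega> powr of_real a"
    if "x > 0" for x a
    using that by (subst powr_times_real_left) (auto simp: powr_of_real)
  have em: "theta \<omega> powr of_real (- s) = inverse e"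
    unfolding e_def theta_powr by simp
  have e0: "e \<noteq> 0" and e2: "e * e = phase ?\<sigma> s"
    using p by (auto simp: e_def theta_powr phase_def cis_mult sgn_if)
  have sZ: "s \<notin> \<int>"
    using s by (auto elim!: Ints_cases)
  let ?A = "complex_of_real (bessel_series (- s) (?\<sigma> * \<rho>))"
  let ?B = "complex_of_real (bessel_series s (?\<sigma> * \<rho>))"
  define R where "R = complex_of_real (r powr s)"
  have R0: "R \<noteq> 0" using r by (simp add: R_def)
  have K: "bessel_K s w = of_real (pi / 2) * (inverse R * inverse e * ?A - R * e * ?B) / of_real (sin (s * pi))"
  proof -
    have "bessel_I (- s) w = inverse R * inverse e * ?A"
      using s r by (subst bessel_I_series[OF _ wq]) (auto simp only: w2 pw em R_def powr_minus of_real_inverse)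
    moreover have "bessel_I s w = R * e * ?B"
      using s r by (subst bessel_I_series[OF _ wq]) (auto simp only: w2 pw e_def R_def)
    ultimately show ?thesis
      using sZ by (simp add: bessel_K_def)
  qed
  have ws: "w powr of_real s = of_real (2 powr s) * R * e"
    unfolding w1 R_def e_def using r by (subst pw) (auto simp: powr_mult)
  have QT: "complex_of_real (2 powr (1 - s)) * of_real (2 powr s) = 2"
    by (simp add: of_real_mult[symmetric] powr_add[symmetric] del: of_real_mult)
  have refl: "of_real pi / of_real (sin (s * pi)) = complex_of_real (Gamma s) * of_real (Gamma (1 - s))"
    using Gamma_reflection_complex[of "of_real s"]
    by (simp add: Gamma_complex_of_real[symmetric] sin_of_real[symmetric] mult.commute)
  have G: "complex_of_real (Gamma s) \<noteq> 0"
    using Gamma_real_pos[OF s(1)] by simp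
  have "m_mult s z \<omega> = of_real (2 powr (1 - s) / Gamma s) * w powr of_real s * bessel_K s w"
    by (simp add: m_mult_def w_def Let_def)
  also have "\<dots> = (of_real (2 powr (1 - s)) * of_real (2 powr s)) / of_real (Gamma s) * (R * e) *
      ((of_real pi / of_real (sin (s * pi))) / 2 * (inverse R * inverse e * ?A - R * e * ?B))"
    unfolding ws K by (simp add: mult_ac)
  also have "\<dots> = of_real (Gamma (1 - s)) * ((R * e) * (inverse R * inverse e * ?A - R * e * ?B))"
    unfolding QT refl using G by simp
  also have "(R * e) * (inverse R * inverse e * ?A - R * e * ?B) = ?A - (e * e) * ((R * R) * ?B)"
  proof -
    have "(R * e) * (inverse R * inverse e) = 1"
      using R0 e0 by (simp add: field_simps)
    moreover have "(R * e) * (inverse R * inverse e * ?A - R * e * ?B) =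
        ((R * e) * (inverse R * inverse e)) * ?A - (e * e) * ((R * R) * ?B)"
      by (simp only: right_diff_distrib mult_ac)
    ultimately show ?thesis by simp
  qed
  also have "R * R = of_real (\<rho> powr s)"
    unfolding R_def r2[symmetric] using r by (simp add: powr_mult)
  also have "?A - (e * e) * (of_real (\<rho> powr s) * ?B) = bessel_profile ?\<sigma> s \<rho>"
    by (simp add: bessel_profile_def frobenius_def e2)
  finally show ?thesis by (simp only: \<rho>_def)
qed

text \<open>
  The principal power of 0 is 0; hence the pointwise statements below hold on the null set
  \<open>p = 0\<close> as well.
\<close>

lemma m_mult_degenerate: "p_symbol \<omega> = 0 \<Longrightarrow> m_mult s z \<omega> = 0"
  by (simp add: m_mult_def Let_def)

text \<open>
  The derivative of \<open>m_mult s z\<close> in \<open>z\<close>, by the chain rule with \<open>\<rho> = z\<^sup>2 \<bar>p\<bar> / 4\<close>.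
\<close>

definition m_mult_dz :: "real \<Rightarrow> real \<Rightarrow> (real^'d) \<times> real \<Rightarrow> complex" where
  "m_mult_dz s z \<omega> = - (of_real (Gamma (1 - s) * 2 powr (1 - 2 * s) * z powr (2 * s - 1)) *
     (phase (sgn (p_symbol \<omega>)) s * of_real (\<bar>p_symbol \<omega>\<bar> powr s) *
      bessel_profile (sgn (p_symbol \<omega>)) (1 - s) (z\<^sup>2 * \<bar>p_symbol \<omega>\<bar> / 4)))"

lemma m_mult_has_derivative:
  assumes s: "0 < s" "s < 1" and z: "z > 0"
  shows "((\<lambda>z. m_mult s z \<omega>) has_vector_derivative m_mult_dz s z \<omega>) (at z)"
proof (cases "p_symbol \<omega> = 0")
  case True
  then have "(\<lambda>z. m_mult s z \<omega>) = (\<lambda>z. 0)" "m_mult_dz s z \<omega> = 0"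
    by (auto simp: m_mult_degenerate m_mult_dz_def)
  then show ?thesis by simp
next
  case False
  let ?\<sigma> = "sgn (p_symbol \<omega>)" and ?P = "\<bar>p_symbol \<omega>\<bar>"
  have P: "?P > 0" using False by simp
  have d\<rho>: "((\<lambda>z. z\<^sup>2 * ?P / 4) has_vector_derivative z * ?P / 2) (at z)"
    unfolding has_real_derivative_iff_has_vector_derivative[symmetric]
    by (auto intro!: derivative_eq_intros)
  have \<rho>: "z\<^sup>2 * ?P / 4 > 0" using z P by simp
  have "((bessel_profile ?\<sigma> s \<circ> (\<lambda>z. z\<^sup>2 * ?P / 4)) has_vector_derivative (z * ?P / 2) *\<^sub>R
      (- (phase ?\<sigma> s * of_real ((z\<^sup>2 * ?P / 4) powr (s - 1)) * bessel_profile ?\<sigma> (1 - s) (z\<^sup>2 * ?P / 4)))) (at z)"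
    by (rule vector_diff_chain_at[OF d\<rho> bessel_profile_deriv[OF s \<rho> sgn_cases[OF False]]])
  then have "((\<lambda>z. of_real (Gamma (1 - s)) * bessel_profile ?\<sigma> s (z\<^sup>2 * ?P / 4)) has_vector_derivative
      of_real (Gamma (1 - s)) * ((z * ?P / 2) *\<^sub>R
      (- (phase ?\<sigma> s * of_real ((z\<^sup>2 * ?P / 4) powr (s - 1)) * bessel_profile ?\<sigma> (1 - s) (z\<^sup>2 * ?P / 4))))) (at z)"
    by (intro has_vector_derivative_mult_right) (simp add: o_def)
  moreover have "(z * ?P / 2) * (z\<^sup>2 * ?P / 4) powr (s - 1) = 2 powr (1 - 2 * s) * z powr (2 * s - 1) * ?P powr s"
  proof -
    have pos: "x powr a = exp (a * ln x)" if "x > 0" for x a :: real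
      using that by (simp add: powr_def)
    have l: "ln (z\<^sup>2 * ?P / 4) = 2 * ln z + ln ?P - 2 * ln 2"
      using z P ln_realpow[of "2::real" 2] by (simp add: ln_mult ln_div ln_realpow)
    have x: "z * ?P / 2 = exp (ln z + ln ?P - ln 2)"
      using z P by (simp add: exp_add exp_diff)
    have "(z * ?P / 2) * (z\<^sup>2 * ?P / 4) powr (s - 1) =
        exp ((ln z + ln ?P - ln 2) + (s - 1) * (2 * ln z + ln ?P - 2 * ln 2))"
    proof -
      have "(z\<^sup>2 * ?P / 4) powr (s - 1) = exp ((s - 1) * ln (z\<^sup>2 * ?P / 4))"
        using pos[OF \<rho>] .
      then show ?thesis unfolding x l by (simp only: exp_add)
    qed
    also have "(ln z + ln ?P - ln 2) + (s - 1) * (2 * ln z + ln ?P - 2 * ln 2) =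
        (1 - 2 * s) * ln 2 + (2 * s - 1) * ln z + s * ln ?P"
      by (simp add: algebra_simps)
    finally show ?thesis
      using z P by (simp add: powr_def exp_add)
  qed
  then have "of_real (Gamma (1 - s)) * ((z * ?P / 2) *\<^sub>R
      (- (phase ?\<sigma> s * of_real ((z\<^sup>2 * ?P / 4) powr (s - 1)) * bessel_profile ?\<sigma> (1 - s) (z\<^sup>2 * ?P / 4)))) = m_mult_dz s z \<omega>"
  proof -
    assume eq: "(z * ?P / 2) * (z\<^sup>2 * ?P / 4) powr (s - 1) = 2 powr (1 - 2 * s) * z powr (2 * s - 1) * ?P powr s"
    have "complex_of_real (z * ?P / 2) * of_real ((z\<^sup>2 * ?P / 4) powr (s - 1)) =
      of_real (2 powr (1 - 2 * s)) * of_real (z powr (2 * s - 1)) * of_real (?P powr s)"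
      unfolding of_real_mult[symmetric] eq ..
    then have "(complex_of_real (z * ?P / 2) * of_real ((z\<^sup>2 * ?P / 4) powr (s - 1))) * (of_real (Gamma (1 - s)) * phase ?\<sigma> s * bessel_profile ?\<sigma> (1 - s) (z\<^sup>2 * ?P / 4)) =
      (of_real (2 powr (1 - 2 * s)) * of_real (z powr (2 * s - 1)) * of_real (?P powr s)) * (of_real (Gamma (1 - s)) * phase ?\<sigma> s * bessel_profile ?\<sigma> (1 - s) (z\<^sup>2 * ?P / 4))"
      by (simp only:)
    then show ?thesis
      unfolding m_mult_dz_def scaleR_conv_of_real of_real_mult[of "Gamma (1 - s) * _"] of_real_mult[of "Gamma (1 - s)"]
      by (simp only: mult_minus_right mult_ac)
  qed
  ultimately have "((\<lambda>z. of_real (Gamma (1 - s)) * bessel_profile ?\<sigma> s (z\<^sup>2 * ?P / 4)) has_vector_derivative m_mult_dz s z \<omega>) (at z)"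
    by (simp only:)
  then show ?thesis
    by (rule has_vector_derivative_transform_within_open[where S = "{0<..}"])
       (use z m_mult_eq_bessel_profile[OF s _ False] in auto)
qed

text \<open>
  The phase of the multiplier, turned by \<open>pi * s / 2\<close>, is the phase of the principal power on both
  sides of the characteristic surface.
\<close>

lemma heat_symbol_powr:
  "(\<i> * of_real (p_symbol \<omega>)) powr of_real s =
    exp (\<i> * of_real (pi * s / 2)) * (phase (sgn (p_symbol \<omega>)) s * of_real (\<bar>p_symbol \<omega>\<bar> powr s))"
proof -
  consider "p_symbol \<omega> = 0" | "p_symbol \<omega> > 0" | "p_symbol \<omega> < 0" by linarith
  then show ?thesis
  proof cases
    case 1
    then show ?thesis by simp
  next
    case 2
    then have "(of_real (p_symbol \<omega>) * \<i>) powr of_real s = of_real (p_symbol \<omega> powr s) * \<i> powr of_real s"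
      by (subst powr_times_real_left) (auto simp: powr_of_real)
    with 2 show ?thesis
      by (simp add: phase_def powr_def[of \<i>] mult_ac)
  next
    case 3
    then have "(of_real (- p_symbol \<omega>) * (- \<i>)) powr of_real s = of_real ((- p_symbol \<omega>) powr s) * (- \<i>) powr of_real s"
      by (subst powr_times_real_left) (auto simp: powr_of_real[symmetric])
    moreover have "(- \<i>) powr of_real s = exp (\<i> * of_real (pi * s / 2)) * cis (- (pi * s))"
      unfolding cis_conv_exp exp_add[symmetric] by (simp add: powr_def algebra_simps)
    ultimately show ?thesis
      using 3 by (simp add: phase_def mult_ac)
  qed
qed

text \<open>
  Where \<open>p\<close> does not vanish, the second factor on the right is \<open>m_mult (1 - s) z\<close>, which tends to 1 as \<open>z\<close> tends to 0.
\<close>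

lemma normalized_m_mult_dz:
  assumes s: "0 < s" "s < 1" and z: "z > 0"
  shows "- (of_real (Gamma s) * exp (\<i> * of_real (pi * s / 2)) / of_real (2 powr (1 - 2 * s) * Gamma (1 - s))
       * of_real (z powr (1 - 2 * s))) * m_mult_dz s z \<omega> =
    (\<i> * of_real (p_symbol \<omega>)) powr of_real s *
     (of_real (Gamma s) * bessel_profile (sgn (p_symbol \<omega>)) (1 - s) (z\<^sup>2 * \<bar>p_symbol \<omega>\<bar> / 4))"
proof -
  define E where "E = exp (\<i> * of_real (pi * s / 2))"
  define q where "q = complex_of_real (2 powr (1 - 2 * s) * Gamma (1 - s))"
  define y where "y = complex_of_real (z powr (1 - 2 * s))"
  have "Gamma (1 - s) > 0"
    using s by (intro Gamma_real_pos) simp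
  then have q: "q \<noteq> 0" and y: "y \<noteq> 0"
    using z by (auto simp: q_def y_def)
  have "z powr (2 * s - 1) = inverse (z powr (1 - 2 * s))"
    using powr_minus[of z "1 - 2 * s"] by simp
  then have "complex_of_real (Gamma (1 - s) * 2 powr (1 - 2 * s) * z powr (2 * s - 1)) = q * inverse y"
    by (simp add: q_def y_def)
  then show ?thesis
    unfolding heat_symbol_powr m_mult_dz_def E_def[symmetric] q_def[symmetric] y_def[symmetric]
    using q y by simp
qed

section \<open>Convergence of the weighted derivative\<close>

lemma p_symbol_measurable [measurable]: "p_symbol \<in> borel_measurable borel"
  unfolding p_symbol_def by (intro borel_measurable_continuous_onI)
    (auto simp: case_prod_beta intro!: continuous_intros)

lemma sgn_bessel_profile_measurable:
  fixes z :: real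
  assumes s: "0 < s" "s < 1"
  shows "(\<lambda>\<omega> :: (real^'d) \<times> real. if p_symbol \<omega> = 0 then 0
     else bessel_profile (sgn (p_symbol \<omega>)) s (z\<^sup>2 * \<bar>p_symbol \<omega>\<bar> / 4)) \<in> borel_measurable borel"
proof -
  have "(\<lambda>\<omega> :: (real^'d) \<times> real. if p_symbol \<omega> = 0 then 0
     else bessel_profile (sgn (p_symbol \<omega>)) s (z\<^sup>2 * \<bar>p_symbol \<omega>\<bar> / 4)) =
    (\<lambda>\<omega>. if p_symbol \<omega> = 0 then 0 else if p_symbol \<omega> > 0
      then bessel_profile 1 s (z\<^sup>2 * \<bar>p_symbol \<omega>\<bar> / 4) else bessel_profile (-1) s (z\<^sup>2 * \<bar>p_symbol \<omega>\<bar> / 4))"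
    by (auto simp: fun_eq_iff)
  moreover have "\<dots> \<in> borel_measurable borel"
    using s by measurable
  ultimately show ?thesis by simp
qed

lemma m_mult_measurable:
  assumes s: "0 < s" "s < 1" and z: "z > 0"
  shows "(m_mult s z :: (real^'d) \<times> real \<Rightarrow> complex) \<in> borel_measurable borel"
proof -
  have eq: "m_mult s z = (\<lambda>\<omega> :: (real^'d) \<times> real. of_real (Gamma (1 - s)) * (if p_symbol \<omega> = 0 then 0
     else bessel_profile (sgn (p_symbol \<omega>)) s (z\<^sup>2 * \<bar>p_symbol \<omega>\<bar> / 4)))"
    by (rule ext) (simp add: m_mult_degenerate m_mult_eq_bessel_profile[OF s z])
  show ?thesis
    unfolding eq by (intro borel_measurable_times borel_measurable_const sgn_bessel_profile_measurable s)
qed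

lemma phase_measurable [measurable]:
  "(\<lambda>\<omega> :: (real^'d) \<times> real. phase (sgn (p_symbol \<omega>)) s) \<in> borel_measurable borel"
  unfolding phase_def by measurable

lemma m_mult_dz_measurable:
  assumes s: "0 < s" "s < 1"
  shows "(m_mult_dz s z :: (real^'d) \<times> real \<Rightarrow> complex) \<in> borel_measurable borel"
proof -
  define F :: "(real^'d) \<times> real \<Rightarrow> complex" where "F \<omega> = (if p_symbol \<omega> = 0 then 0
     else bessel_profile (sgn (p_symbol \<omega>)) (1 - s) (z\<^sup>2 * \<bar>p_symbol \<omega>\<bar> / 4))" for \<omega>
  have [measurable]: "F \<in> borel_measurable borel"
    unfolding F_def by (rule sgn_bessel_profile_measurable) (use s in auto)
  have "m_mult_dz s z = (\<lambda>\<omega> :: (real^'d) \<times> real. - (of_real (Gamma (1 - s) * 2 powr (1 - 2 * s) * z powr (2 * s - 1)) *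
     (phase (sgn (p_symbol \<omega>)) s * of_real (\<bar>p_symbol \<omega>\<bar> powr s) * F \<omega>)))"
    by (rule ext) (simp add: m_mult_dz_def F_def)
  then show ?thesis by simp
qed

lemma heat_symbol_measurable:
  "(\<lambda>\<omega> :: (real^'d) \<times> real. (\<i> * of_real (p_symbol \<omega>)) powr of_real s) \<in> borel_measurable borel"
  unfolding heat_symbol_powr by measurable

text \<open>
  The profile for \<open>s\<close> is bounded if \<open>s \<le> 1/2\<close>, and otherwise grows at most like the power
  \<open>s/2 - 1/4\<close> of \<open>\<bar>p\<bar>\<close>, which is less than \<open>s\<close>.
\<close>

lemma m_mult_bound:
  assumes s: "0 < s" "s < 1" and \<alpha>: "\<alpha> = s + max 0 (1 / 4 - s / 2)"
  shows "\<exists>C\<ge>0. \<forall>z. \<forall>\<omega> :: (real^'d) \<times> real. 0 < z \<and> z \<le> Z \<longrightarrow> cmod (m_mult s z \<omega>) \<le> C * (1 + \<bar>p_symbol \<omega>\<bar> powr \<alpha>)"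
proof -
  have "0 + max 0 (s / 2 - 1 / 4) \<le> \<alpha>"
    unfolding \<alpha> using s by (auto simp: max_def)
  then obtain C where C: "C \<ge> 0" "\<forall>\<sigma>\<in>{1, -1}. \<forall>z P. 0 < z \<and> z \<le> Z \<and> 0 < P \<longrightarrow>
      P powr 0 * cmod (bessel_profile \<sigma> s (z\<^sup>2 * P / 4)) \<le> C * (1 + P powr \<alpha>)"
    using weighted_bessel_profile_bound[OF s, of "max 0 (s / 2 - 1 / 4)" 0 \<alpha> Z] by auto
  have G: "Gamma (1 - s) > 0" using s by (intro Gamma_real_pos) simp
  have "cmod (m_mult s z \<omega>) \<le> (Gamma (1 - s) * C) * (1 + \<bar>p_symbol \<omega>\<bar> powr \<alpha>)"
    if z: "0 < z" "z \<le> Z" for z and \<omega> :: "(real^'d) \<times> real"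
  proof (cases "p_symbol \<omega> = 0")
    case True
    then show ?thesis using C(1) G by (simp add: m_mult_degenerate)
  next
    case False
    then have "cmod (bessel_profile (sgn (p_symbol \<omega>)) s (z\<^sup>2 * \<bar>p_symbol \<omega>\<bar> / 4)) \<le> C * (1 + \<bar>p_symbol \<omega>\<bar> powr \<alpha>)"
      using C(2)[rule_format, OF sgn_cases[OF False], of z "\<bar>p_symbol \<omega>\<bar>"] z by simp
    then have "Gamma (1 - s) * cmod (bessel_profile (sgn (p_symbol \<omega>)) s (z\<^sup>2 * \<bar>p_symbol \<omega>\<bar> / 4)) \<le>
        Gamma (1 - s) * (C * (1 + \<bar>p_symbol \<omega>\<bar> powr \<alpha>))"
      using G by (intro mult_left_mono) auto
    then show ?thesis
      unfolding m_mult_eq_bessel_profile[OF s z(1) False] norm_mult using G by (simp add: mult.assoc)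
  qed
  moreover have "Gamma (1 - s) * C \<ge> 0" using G C by simp
  ultimately show ?thesis by blast
qed

text \<open>
  The profile for \<open>1 - s\<close> is of order at most \<open>1 + \<rho> powr max 0 (1/4 - s/2)\<close>. Together with the factor
  \<open>\<bar>p\<bar> powr s\<close> the largest power that occurs is the power \<open>\<alpha>\<close> of \<open>\<bar>p\<bar>\<close>, which explains the two hypotheses on \<open>u\<close>.
\<close>

lemma dual_bessel_profile_bound:
  assumes s: "0 < s" "s < 1" and \<alpha>: "\<alpha> = s + max 0 (1 / 4 - s / 2)"
  shows "\<exists>C\<ge>0. \<forall>z. \<forall>\<omega> :: (real^'d) \<times> real. 0 < z \<and> z \<le> Z \<longrightarrow> \<bar>p_symbol \<omega>\<bar> powr s *
    cmod (bessel_profile (sgn (p_symbol \<omega>)) (1 - s) (z\<^sup>2 * \<bar>p_symbol \<omega>\<bar> / 4)) \<le> C * (1 + \<bar>p_symbol \<omega>\<bar> powr \<alpha>)"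
proof -
  have "(1 - s) / 2 - 1 / 4 \<le> max 0 (1 / 4 - s / 2)"
    by (auto simp: max_def field_simps)
  then obtain C where C: "C \<ge> 0" "\<forall>\<sigma>\<in>{1, -1}. \<forall>z P. 0 < z \<and> z \<le> Z \<and> 0 < P \<longrightarrow>
      P powr s * cmod (bessel_profile \<sigma> (1 - s) (z\<^sup>2 * P / 4)) \<le> C * (1 + P powr \<alpha>)"
    using weighted_bessel_profile_bound[of "1 - s" "max 0 (1 / 4 - s / 2)" s \<alpha> Z] s \<alpha> by auto
  have "\<bar>p_symbol \<omega>\<bar> powr s * cmod (bessel_profile (sgn (p_symbol \<omega>)) (1 - s) (z\<^sup>2 * \<bar>p_symbol \<omega>\<bar> / 4)) \<le>
      C * (1 + \<bar>p_symbol \<omega>\<bar> powr \<alpha>)" if z: "0 < z" "z \<le> Z" for z and \<omega> :: "(real^'d) \<times> real"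
  proof (cases "p_symbol \<omega> = 0")
    case True
    then show ?thesis using C(1) by simp
  next
    case False
    show ?thesis
      using C(2)[rule_format, OF sgn_cases[OF False], of z "\<bar>p_symbol \<omega>\<bar>"] z False by simp
  qed
  then show ?thesis using C(1) by blast
qed

lemma vector_derivative_quotient:
  fixes f :: "real \<Rightarrow> complex"
  assumes "(f has_vector_derivative D) (at x)"
  shows "((\<lambda>h. (f (x + h) - f x) / of_real h) \<longlongrightarrow> D) (at 0)"
proof (rule LIM_zero_cancel, rule tendsto_norm_zero_cancel)
  have A: "((\<lambda>h. norm (f (x + h) - f x - h *\<^sub>R D) / norm h) \<longlongrightarrow> 0) (at 0)"
    using assms by (simp add: has_vector_derivative_def has_derivative_at)
  have B: "norm (f (x + h) - f x - h *\<^sub>R D) / norm h = norm ((f (x + h) - f x) / of_real h - D)"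
    if "h \<noteq> 0" for h
  proof -
    have "(f (x + h) - f x) / of_real h - D = (f (x + h) - f x - h *\<^sub>R D) / of_real h"
      using that by (simp add: diff_divide_distrib scaleR_conv_of_real)
    then show ?thesis by (simp only: norm_divide norm_of_real real_norm_def)
  qed
  show "((\<lambda>h. norm ((f (x + h) - f x) / of_real h - D)) \<longlongrightarrow> 0) (at 0)"
    by (rule Lim_transform_eventually[OF A]) (unfold eventually_at_filter, rule always_eventually, use B in blast)
qed

lemma vector_derivative_lipschitz:
  fixes f :: "real \<Rightarrow> complex"
  assumes "\<And>y. y \<in> {a..b} \<Longrightarrow> (f has_vector_derivative f' y) (at y)"
    and "\<And>y. y \<in> {a..b} \<Longrightarrow> cmod (f' y) \<le> B" and "x \<in> {a..b}" "y \<in> {a..b}"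
  shows "cmod (f x - f y) \<le> B * \<bar>x - y\<bar>"
proof -
  have "norm (f x - f y) \<le> B * norm (x - y)"
  proof (rule differentiable_bound[where S = "{a..b}" and f' = "\<lambda>y h. h *\<^sub>R f' y"])
    show "(f has_derivative (\<lambda>h. h *\<^sub>R f' y)) (at y within {a..b})" if "y \<in> {a..b}" for y
      using has_vector_derivative_at_within[OF assms(1)[OF that]] by (simp add: has_vector_derivative_def)
    show "onorm (\<lambda>h. h *\<^sub>R f' y) \<le> B" if "y \<in> {a..b}" for y
    proof (rule onorm_le)
      show "norm (h *\<^sub>R f' y) \<le> B * norm h" for h
        using mult_right_mono[OF assms(2)[OF that] norm_ge_zero[of h]] by (simp add: mult.commute)
    qed
  qed (use assms in auto)
  then show ?thesis by simp
qed

lemma m_mult_dz_bound: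
  assumes s: "0 < s" "s < 1" and \<alpha>: "\<alpha> = s + max 0 (1 / 4 - s / 2)" and a: "0 < a"
  shows "\<exists>C\<ge>0. \<forall>z. \<forall>\<omega> :: (real^'d) \<times> real. a \<le> z \<and> z \<le> b \<longrightarrow>
    cmod (m_mult_dz s z \<omega>) \<le> C * (1 + \<bar>p_symbol \<omega>\<bar> powr \<alpha>)"
proof -
  obtain C where C: "C \<ge> 0" "\<forall>z. \<forall>\<omega> :: (real^'d) \<times> real. 0 < z \<and> z \<le> b \<longrightarrow> \<bar>p_symbol \<omega>\<bar> powr s *
    cmod (bessel_profile (sgn (p_symbol \<omega>)) (1 - s) (z\<^sup>2 * \<bar>p_symbol \<omega>\<bar> / 4)) \<le> C * (1 + \<bar>p_symbol \<omega>\<bar> powr \<alpha>)"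
    using dual_bessel_profile_bound[OF s \<alpha>] by blast
  define G where "G = Gamma (1 - s) * 2 powr (1 - 2 * s)"
  have G: "G > 0" unfolding G_def using s by (intro mult_pos_pos Gamma_real_pos) auto
  define K where "K = a powr (2 * s - 1) + b powr (2 * s - 1)"
  have "cmod (m_mult_dz s z \<omega>) \<le> (G * K * C) * (1 + \<bar>p_symbol \<omega>\<bar> powr \<alpha>)"
    if z: "a \<le> z" "z \<le> b" for z and \<omega> :: "(real^'d) \<times> real"
  proof -
    have zK: "z powr (2 * s - 1) \<le> K"
    proof (cases "2 * s - 1 \<ge> 0")
      case True
      then have "z powr (2 * s - 1) \<le> b powr (2 * s - 1)"
        using z a by (intro powr_mono2) auto
      then show ?thesis by (simp add: K_def add_increasing)
    next
      case False
      then have "z powr (2 * s - 1) \<le> a powr (2 * s - 1)"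
        using z a by (intro powr_mono2') auto
      then show ?thesis by (simp add: K_def add_increasing2)
    qed
    have "cmod (m_mult_dz s z \<omega>) = G * z powr (2 * s - 1) * (\<bar>p_symbol \<omega>\<bar> powr s *
       cmod (bessel_profile (sgn (p_symbol \<omega>)) (1 - s) (z\<^sup>2 * \<bar>p_symbol \<omega>\<bar> / 4)))"
      unfolding m_mult_dz_def G_def[symmetric] using G by (simp add: norm_mult abs_mult)
    also have "\<dots> \<le> (G * K) * (C * (1 + \<bar>p_symbol \<omega>\<bar> powr \<alpha>))"
    proof (rule mult_mono)
      show "G * z powr (2 * s - 1) \<le> G * K"
        using zK G by (intro mult_left_mono) auto
      show "\<bar>p_symbol \<omega>\<bar> powr s * cmod (bessel_profile (sgn (p_symbol \<omega>)) (1 - s) (z\<^sup>2 * \<bar>p_symbol \<omega>\<bar> / 4)) \<le>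
          C * (1 + \<bar>p_symbol \<omega>\<bar> powr \<alpha>)"
        using C(2)[rule_format, of z \<omega>] z a by simp
    qed (use G in \<open>auto simp: K_def\<close>)
    finally show ?thesis by (simp only: mult.assoc)
  qed
  moreover have "G * K * C \<ge> 0" using G C by (simp add: K_def)
  ultimately show ?thesis by blast
qed

theorem theorem6p3:
  fixes s a :: real
    and u :: "(real^'d) \<times> real \<Rightarrow> complex"
    and U :: "real \<Rightarrow> (real^'d) \<times> real \<Rightarrow> complex"
  assumes "0 < s" and "s < 1" and "a = 1 - 2 * s"
    and "(1/2 \<le> s \<and> u \<in> heat_pow_dom s) \<or> (s < 1/2 \<and> u \<in> heat_pow_dom (1/4 + s/2))"
    and "\<And>z. z > 0 \<Longrightarrow> U z = inv_fourier (\<lambda>\<omega>. m_mult s z \<omega> * fourier u \<omega>)"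
  shows "\<exists>dU. (\<forall>z>0. L2_has_deriv U (dU z) z) \<and>
    L2_tendsto
      (\<lambda>z y. - (of_real (Gamma s) * exp (\<i> * of_real (pi * s / 2))
                 / of_real (2 powr (1 - 2 * s) * Gamma (1 - s))
               * of_real (z powr a) * dU z y))
      (heat_pow s u) (at_right 0)"
proof -
  note s = assms(1,2)
  \<comment> \<open>Both alternatives of the hypothesis say that \<open>u\<close> lies in the domain with this exponent.\<close>
  define \<alpha> where "\<alpha> = s + max 0 (1 / 4 - s / 2)"
  have "u \<in> heat_pow_dom \<alpha>"
  proof (cases "1 / 2 \<le> s")
    case True
    then have "\<alpha> = s" by (simp add: \<alpha>_def)
    with True assms(4) show ?thesis by auto
  next
    case False
    then have "\<alpha> = 1 / 4 + s / 2" by (simp add: \<alpha>_def max_def)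
    with False assms(4) show ?thesis by auto
  qed
  then have u: "u \<in> L2" and pu: "(\<lambda>\<omega>. of_real (\<bar>p_symbol \<omega>\<bar> powr \<alpha>) * fourier u \<omega>) \<in> L2"
    by (auto simp: heat_pow_dom_def)
  have uh: "fourier u \<in> L2" by (rule fourier_L2[OF u])
  note [measurable] = L2_measurable[OF uh] m_mult_measurable[OF s] m_mult_dz_measurable[OF s]
    heat_symbol_measurable
  define w where "w \<omega> = (1 + \<bar>p_symbol \<omega>\<bar> powr \<alpha>) * cmod (fourier u \<omega>)" for \<omega>
  have w: "integrable lborel (\<lambda>\<omega>. (C * w \<omega>)\<^sup>2)" for C
  proof -
    have "integrable lborel (\<lambda>\<omega>. (cmod (fourier u \<omega> + of_real (\<bar>p_symbol \<omega>\<bar> powr \<alpha>) * fourier u \<omega>))\<^sup>2)"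
      by (intro L2_integrable L2_add uh pu)
    moreover have "cmod (fourier u \<omega> + of_real (\<bar>p_symbol \<omega>\<bar> powr \<alpha>) * fourier u \<omega>) = w \<omega>" for \<omega>
    proof -
      have "fourier u \<omega> + of_real (\<bar>p_symbol \<omega>\<bar> powr \<alpha>) * fourier u \<omega> =
          of_real (1 + \<bar>p_symbol \<omega>\<bar> powr \<alpha>) * fourier u \<omega>"
        by (simp add: distrib_right)
      then show ?thesis
        by (simp only: norm_mult norm_of_real w_def) simp
    qed
    ultimately show ?thesis by (simp add: power_mult_distrib)
  qed
  have dom: "cmod (c * fourier u \<omega>) \<le> C * w \<omega>"
    if "cmod c \<le> C * (1 + \<bar>p_symbol \<omega>\<bar> powr \<alpha>)" for c C \<omega>
    using mult_right_mono[OF that norm_ge_zero[of "fourier u \<omega>"]] by (simp add: norm_mult w_def mult.assoc)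
  have mL: "(\<lambda>\<omega>. m_mult s z \<omega> * fourier u \<omega>) \<in> L2" if z: "z > 0" for z
  proof -
    obtain C where C: "\<forall>y. \<forall>\<omega> :: (real^'d) \<times> real. 0 < y \<and> y \<le> z \<longrightarrow>
        cmod (m_mult s y \<omega>) \<le> C * (1 + \<bar>p_symbol \<omega>\<bar> powr \<alpha>)"
      using m_mult_bound[OF s \<alpha>_def] by blast
    show ?thesis
      by (rule L2_dominated[OF _ w[of C]]) (use C z in \<open>auto intro!: dom\<close>)
  qed
  have dL: "(\<lambda>\<omega>. m_mult_dz s z \<omega> * fourier u \<omega>) \<in> L2" if z: "z > 0" for z
  proof -
    obtain C where C: "\<forall>y. \<forall>\<omega> :: (real^'d) \<times> real. z \<le> y \<and> y \<le> z \<longrightarrow>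
        cmod (m_mult_dz s y \<omega>) \<le> C * (1 + \<bar>p_symbol \<omega>\<bar> powr \<alpha>)"
      using m_mult_dz_bound[OF s \<alpha>_def z] by blast
    show ?thesis
      by (rule L2_dominated[OF _ w[of C]]) (use C in \<open>auto intro!: dom\<close>)
  qed
  define dU where "dU z = inv_fourier (\<lambda>\<omega>. m_mult_dz s z \<omega> * fourier u \<omega>)" for z
  have "L2_has_deriv U (dU z) z" if z: "z > 0" for z
  proof -
    define Q where "Q h \<omega> = (m_mult s (z + h) \<omega> - m_mult s z \<omega>) / of_real h"
      for h and \<omega> :: "(real^'d) \<times> real"
    have near: "\<forall>\<^sub>F h in at 0. h \<noteq> 0 \<and> \<bar>h\<bar> < z / 2"
      using z eventually_at[of _ 0 UNIV] by (auto simp: dist_real_def eventually_at intro!: exI[of _ "z / 2"])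
    obtain C where C: "\<forall>y. \<forall>\<omega> :: (real^'d) \<times> real. z / 2 \<le> y \<and> y \<le> 2 * z \<longrightarrow>
        cmod (m_mult_dz s y \<omega>) \<le> C * (1 + \<bar>p_symbol \<omega>\<bar> powr \<alpha>)"
      using m_mult_dz_bound[OF s \<alpha>_def, of "z / 2" "2 * z"] z by auto
    \<comment> \<open>By the mean value inequality a bound for the derivative on \<open>[z/2, 2 z]\<close> dominates the quotients.\<close>
    have "L2_tendsto (\<lambda>h \<omega>. Q h \<omega> * fourier u \<omega>) (\<lambda>\<omega>. m_mult_dz s z \<omega> * fourier u \<omega>) (at 0)"
    proof (rule L2_tendsto_dominated[OF _ w[of C]])
      show "\<forall>\<^sub>F h in at 0. (\<lambda>\<omega>. Q h \<omega> * fourier u \<omega>) \<in> borel_measurable borel \<and>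
          (AE \<omega> in lborel. cmod (Q h \<omega> * fourier u \<omega>) \<le> C * w \<omega>)"
        using near
      proof eventually_elim
        case (elim h)
        then have "z + h > 0" by (auto simp: abs_less_iff)
        then have "Q h \<in> borel_measurable borel"
          unfolding Q_def using z by measurable
        moreover have "cmod (Q h \<omega>) \<le> C * (1 + \<bar>p_symbol \<omega>\<bar> powr \<alpha>)" for \<omega>
        proof -
          have "cmod (m_mult s (z + h) \<omega> - m_mult s z \<omega>) \<le> C * (1 + \<bar>p_symbol \<omega>\<bar> powr \<alpha>) * \<bar>(z + h) - z\<bar>"
          proof (rule vector_derivative_lipschitz[where a = "z / 2" and b = "2 * z"])
            show "((\<lambda>z. m_mult s z \<omega>) has_vector_derivative m_mult_dz s y \<omega>) (at y)"
              if "y \<in> {z / 2..2 * z}" for y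
              using that z by (intro m_mult_has_derivative s) auto
            show "cmod (m_mult_dz s y \<omega>) \<le> C * (1 + \<bar>p_symbol \<omega>\<bar> powr \<alpha>)" if "y \<in> {z / 2..2 * z}" for y
              using C[rule_format, of y \<omega>] that by simp
          qed (use z elim in \<open>auto simp: abs_less_iff\<close>)
          then show ?thesis
            using elim by (simp add: Q_def norm_divide pos_divide_le_eq)
        qed
        ultimately show ?case by (auto intro!: dom)
      qed
      show "AE \<omega> in lborel. ((\<lambda>h. Q h \<omega> * fourier u \<omega>) \<longlongrightarrow> m_mult_dz s z \<omega> * fourier u \<omega>) (at 0)"
      proof (rule AE_I2, rule tendsto_mult[OF _ tendsto_const])
        fix \<omega> :: "(real^'d) \<times> real"
        show "((\<lambda>h. Q h \<omega>) \<longlongrightarrow> m_mult_dz s z \<omega>) (at 0)"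
          unfolding Q_def by (rule vector_derivative_quotient[OF m_mult_has_derivative[OF s z]])
      qed
    qed (use z in auto)
    note lim = L2_tendstoD[OF this]
    have norm_eq: "L2_norm (\<lambda>x. (U (z + h) x - U z x) / of_real h - dU z x) =
        L2_norm (\<lambda>\<omega>. Q h \<omega> * fourier u \<omega> - m_mult_dz s z \<omega> * fourier u \<omega>)"
      and UL: "(\<lambda>x. (U (z + h) x - U z x) / of_real h) \<in> L2" if h: "h \<noteq> 0" "\<bar>h\<bar> < z / 2" for h
    proof -
      have zh: "z + h > 0" using h by (auto simp: abs_less_iff)
      have U: "U (z + h) = inv_fourier (\<lambda>\<omega>. m_mult s (z + h) \<omega> * fourier u \<omega>)"
          "U z = inv_fourier (\<lambda>\<omega>. m_mult s z \<omega> * fourier u \<omega>)"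
        using assms(5) zh z by auto
      have q: "(U (z + h) x - U z x) / of_real h = inverse (of_real h) * U (z + h) x + (- inverse (of_real h)) * U z x" for x
        by (simp add: divide_inverse algebra_simps)
      have q2: "inverse (of_real h) * (m_mult s (z + h) \<omega> * fourier u \<omega>) + (- inverse (of_real h)) * (m_mult s z \<omega> * fourier u \<omega>)
          = Q h \<omega> * fourier u \<omega>" for \<omega>
        by (simp add: Q_def divide_inverse algebra_simps)
      show "L2_norm (\<lambda>x. (U (z + h) x - U z x) / of_real h - dU z x) =
        L2_norm (\<lambda>\<omega>. Q h \<omega> * fourier u \<omega> - m_mult_dz s z \<omega> * fourier u \<omega>)"
        unfolding q unfolding U dU_def q2[symmetric]
        by (rule inv_fourier_lincomb_norm[OF mL[OF zh] mL[OF z] dL[OF z]])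
      show "(\<lambda>x. (U (z + h) x - U z x) / of_real h) \<in> L2"
        unfolding q unfolding U by (intro L2_add L2_cmult inv_fourier mL zh z)
    qed
    show ?thesis
      unfolding L2_has_deriv_def L2_tendsto_def
    proof (intro conjI)
      show "dU z \<in> L2"
        unfolding dU_def by (rule inv_fourier(1)[OF dL[OF z]])
      show "\<forall>\<^sub>F h in at 0. (\<lambda>x. (U (z + h) x - U z x) / of_real h) \<in> L2"
        using near by eventually_elim (use UL in blast)
      have "\<forall>\<^sub>F h in at 0. L2_norm (\<lambda>\<omega>. Q h \<omega> * fourier u \<omega> - m_mult_dz s z \<omega> * fourier u \<omega>) =
          L2_norm (\<lambda>x. (U (z + h) x - U z x) / of_real h - dU z x)"
        using near by eventually_elim (use norm_eq in simp)
      then show "((\<lambda>h. L2_norm (\<lambda>x. (U (z + h) x - U z x) / of_real h - dU z x)) \<longlongrightarrow> 0) (at 0)"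
        using lim(3) by (rule Lim_transform_eventually[rotated])
    qed
  qed
  moreover have "L2_tendsto
      (\<lambda>z y. - (of_real (Gamma s) * exp (\<i> * of_real (pi * s / 2))
                 / of_real (2 powr (1 - 2 * s) * Gamma (1 - s))
               * of_real (z powr a) * dU z y))
      (heat_pow s u) (at_right 0)"
  proof -
    define k where "k z = - (of_real (Gamma s) * exp (\<i> * of_real (pi * s / 2))
                 / of_real (2 powr (1 - 2 * s) * Gamma (1 - s)) * of_real (z powr a))" for z
    define J where "J \<omega> = (\<i> * of_real (p_symbol \<omega>)) powr of_real s" for \<omega> :: "(real^'d) \<times> real"
    define M where "M z \<omega> = of_real (Gamma s) * bessel_profile (sgn (p_symbol \<omega>)) (1 - s) (z\<^sup>2 * \<bar>p_symbol \<omega>\<bar> / 4)"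
      for z and \<omega> :: "(real^'d) \<times> real"
    have G: "Gamma s > 0" using s by (simp add: Gamma_real_pos)
    have kd: "k z * (m_mult_dz s z \<omega> * fourier u \<omega>) = J \<omega> * M z \<omega> * fourier u \<omega>" if "z > 0" for z \<omega>
      using normalized_m_mult_dz[OF s that, of \<omega>] unfolding k_def J_def M_def assms(3)
      by (simp only: mult.assoc[symmetric])
    have nJ: "cmod (J \<omega>) = \<bar>p_symbol \<omega>\<bar> powr s" for \<omega>
      unfolding J_def heat_symbol_powr by (simp add: norm_mult)
    have pos: "\<forall>\<^sub>F z in at_right (0::real). 0 < z \<and> z \<le> 1"
      by (auto simp: eventually_at_right_field intro!: exI[of _ 1])
    obtain C where C: "\<forall>z. \<forall>\<omega> :: (real^'d) \<times> real. 0 < z \<and> z \<le> 1 \<longrightarrow> \<bar>p_symbol \<omega>\<bar> powr s *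
      cmod (bessel_profile (sgn (p_symbol \<omega>)) (1 - s) (z\<^sup>2 * \<bar>p_symbol \<omega>\<bar> / 4)) \<le> C * (1 + \<bar>p_symbol \<omega>\<bar> powr \<alpha>)"
      using dual_bessel_profile_bound[OF s \<alpha>_def] by blast
    have "L2_tendsto (\<lambda>z \<omega>. k z * (m_mult_dz s z \<omega> * fourier u \<omega>)) (\<lambda>\<omega>. J \<omega> * fourier u \<omega>) (at_right 0)"
    proof (rule L2_tendsto_dominated[OF _ w[of "Gamma s * C"]])
      show "(\<lambda>\<omega>. J \<omega> * fourier u \<omega>) \<in> borel_measurable borel"
        unfolding J_def by measurable
      show "\<forall>\<^sub>F z in at_right 0. (\<lambda>\<omega>. k z * (m_mult_dz s z \<omega> * fourier u \<omega>)) \<in> borel_measurable borel \<and>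
          (AE \<omega> in lborel. cmod (k z * (m_mult_dz s z \<omega> * fourier u \<omega>)) \<le> (Gamma s * C) * w \<omega>)"
        using pos
      proof eventually_elim
        case (elim z)
        have "cmod (J \<omega> * M z \<omega>) \<le> (Gamma s * C) * (1 + \<bar>p_symbol \<omega>\<bar> powr \<alpha>)" for \<omega>
          using mult_left_mono[OF C[rule_format, OF elim, of \<omega>], of "Gamma s"] G
          by (simp add: norm_mult nJ M_def mult_ac)
        then have "cmod (k z * (m_mult_dz s z \<omega> * fourier u \<omega>)) \<le> (Gamma s * C) * w \<omega>" for \<omega>
          using kd[of z] elim by (simp only: dom)
        then show ?case by simp
      qed
      show "AE \<omega> in lborel. ((\<lambda>z. k z * (m_mult_dz s z \<omega> * fourier u \<omega>)) \<longlongrightarrow> J \<omega> * fourier u \<omega>) (at_right 0)"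
      proof (rule AE_I2)
        fix \<omega> :: "(real^'d) \<times> real"
        have lim: "((\<lambda>z. J \<omega> * M z \<omega> * fourier u \<omega>) \<longlongrightarrow> J \<omega> * fourier u \<omega>) (at_right 0)"
        proof (cases "p_symbol \<omega> = 0")
          case True
          then show ?thesis by (simp add: J_def)
        next
          case False
          have "filterlim (\<lambda>z. z\<^sup>2 * \<bar>p_symbol \<omega>\<bar> / 4) (at_right 0) (at_right 0)"
            unfolding filterlim_at
          proof
            show "\<forall>\<^sub>F z in at_right 0. z\<^sup>2 * \<bar>p_symbol \<omega>\<bar> / 4 \<in> {0<..} \<and> z\<^sup>2 * \<bar>p_symbol \<omega>\<bar> / 4 \<noteq> 0"
              using pos by eventually_elim (use False in auto)
            have "((\<lambda>z. z\<^sup>2 * \<bar>p_symbol \<omega>\<bar> / 4) \<longlongrightarrow> 0\<^sup>2 * \<bar>p_symbol \<omega>\<bar> / 4) (at_right 0)"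
              by (intro tendsto_intros) auto
            then show "((\<lambda>z. z\<^sup>2 * \<bar>p_symbol \<omega>\<bar> / 4) \<longlongrightarrow> 0) (at_right 0)" by simp
          qed
          then have "((\<lambda>z. bessel_profile (sgn (p_symbol \<omega>)) (1 - s) (z\<^sup>2 * \<bar>p_symbol \<omega>\<bar> / 4)) \<longlongrightarrow> of_real (rGamma (1 - (1 - s)))) (at_right 0)"
            by (intro filterlim_compose[OF bessel_profile_tendsto]) (use s in auto)
          then have "((\<lambda>z. M z \<omega>) \<longlongrightarrow> of_real (Gamma s) * of_real (rGamma (1 - (1 - s)))) (at_right 0)"
            unfolding M_def by (intro tendsto_intros)
          moreover have "complex_of_real (Gamma s) * of_real (rGamma (1 - (1 - s))) = 1"
            using G by (simp add: of_real_mult[symmetric] rGamma_inverse_Gamma del: of_real_mult)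
          ultimately have "((\<lambda>z. M z \<omega>) \<longlongrightarrow> 1) (at_right 0)" by simp
          then have "((\<lambda>z. J \<omega> * M z \<omega> * fourier u \<omega>) \<longlongrightarrow> J \<omega> * 1 * fourier u \<omega>) (at_right 0)"
            by (intro tendsto_intros)
          then show ?thesis by simp
        qed
        have "\<forall>\<^sub>F z in at_right 0. J \<omega> * M z \<omega> * fourier u \<omega> = k z * (m_mult_dz s z \<omega> * fourier u \<omega>)"
          using pos
        proof eventually_elim
          case (elim z)
          show ?case by (rule kd[symmetric]) (use elim in simp)
        qed
        then show "((\<lambda>z. k z * (m_mult_dz s z \<omega> * fourier u \<omega>)) \<longlongrightarrow> J \<omega> * fourier u \<omega>) (at_right 0)"
          using lim by (rule Lim_transform_eventually[rotated])
      qed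
    qed simp
    note lim = L2_tendstoD[OF this]
    have neq: "L2_norm (\<lambda>y. k z * dU z y - heat_pow s u y) =
        L2_norm (\<lambda>\<omega>. k z * (m_mult_dz s z \<omega> * fourier u \<omega>) - J \<omega> * fourier u \<omega>)" if "z > 0" for z
      using inv_fourier_lincomb_norm[OF dL[OF that] dL[OF that] lim(1), of "k z" 0]
      by (simp add: dU_def heat_pow_def J_def)
    have "L2_tendsto (\<lambda>z y. k z * dU z y) (heat_pow s u) (at_right 0)"
      unfolding L2_tendsto_def
    proof (intro conjI)
      show "heat_pow s u \<in> L2"
        unfolding heat_pow_def J_def[symmetric] by (rule inv_fourier(1)[OF lim(1)])
      show "\<forall>\<^sub>F z in at_right 0. (\<lambda>y. k z * dU z y) \<in> L2"
        using pos by eventually_elim (simp add: dU_def L2_cmult inv_fourier(1) dL)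
      have "\<forall>\<^sub>F z in at_right 0. L2_norm (\<lambda>\<omega>. k z * (m_mult_dz s z \<omega> * fourier u \<omega>) - J \<omega> * fourier u \<omega>) =
          L2_norm (\<lambda>y. k z * dU z y - heat_pow s u y)"
        using pos by eventually_elim (simp only: neq)
      then show "((\<lambda>z. L2_norm (\<lambda>y. k z * dU z y - heat_pow s u y)) \<longlongrightarrow> 0) (at_right 0)"
        using lim(3) by (rule Lim_transform_eventually[rotated])
    qed
    then show ?thesis
      by (simp add: k_def mult.assoc)
  qed
  ultimately show ?thesis by blast
qed

end
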